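(* There exists a universal constant $C>0$ such that the following holds. Let $\mu^*\in\mathcal{F}_{lc}$ be a log-concave distribution on $\mathbb{R}$, let $X_1,\ldots,X_n$ be independent samples from $\mu^*$, let $\mu_n = \sum_{i=1}^n\frac1n\delta_{X_i}$, and let $\hat{\mu}_n = \mathrm{proj}_{\mathcal{F}_{lc}}\,\mu_n$ be the $2$-Wasserstein projection of $\mu_n$ onto $\mathcal{F}_{lc}$. (i) Let $\sigma\in[0,\infty)$ be the standard deviation of $\mu^*$. Then for $n\ge2$, $$\mathbb{E}\left[\mathcal{W}_2^2(\hat{\mu}_n,\mu^* )\right]\le C\sigma^2\frac{\log n}{n}.$$ (ii) Suppose that $\mu^*$ is supported on a compact interval $[a,b]$. Then for $n\ge2$, $$\mathbb{E}\left[\mathcal{W}_2^2(\hat{\mu}_n,\mu^* )\right]\le\frac{C(b-a)^2}{n+1}.$$ (The constant $C$ in each part does not depend on $\mu^*$ or $n$; the constants in the two parts may be different.)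
   Context: A Borel probability measure $\mu$ on $\mathbb{R}$ is log-concave if it is either a point mass, or has a density $f$ with respect to Lebesgue measure such that $\log f:\mathbb{R}\to[-\infty,\infty)$ is concave. $\mathcal{F}_{lc}$ denotes the set of all log-concave distributions on $\mathbb{R}$; every element has finite moments of all orders. $\mathcal{W}_2(\mu,\nu) = \left(\inf_{\pi} \int |x-y|^2\,d\pi(x,y)\right)^{1/2}$, the infimum being over all couplings $\pi$ of $\mu$ and $\nu$. For a Borel probability measure $\mu$ on $\mathbb{R}$ with finite second moment, $\mathrm{proj}_{\mathcal{F}_{lc}}\,\mu$ denotes the unique minimizer of $\nu\mapsto\mathcal{W}_2(\nu,\mu)$ over $\nu\in\mathcal{F}_{lc}$; it exists and is unique because the quantile functions of elements of $\mathcal{F}_{lc}$ form a closed convex subset of $L^2([0,1])$, and $\mathcal{W}_2$ is the $L^2$ distance between quantile functions. *)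

theory Defs
  imports "HOL-Probability.Probability"
begin

definition ext_ln :: "real \<Rightarrow> ereal" where
  "ext_ln y = (if y = 0 then - \<infinity> else ereal (ln y))"

text \<open>
  Concavity of a function with values in \<open>[-\<infinity>, \<infinity>)\<close>.  The value \<open>\<infinity>\<close> is excluded, so no
  sum \<open>\<infinity> + (-\<infinity>)\<close> occurs, and the convention \<open>0 * (-\<infinity>) = 0\<close> of \<^typ>\<open>ereal\<close> makes the
  inequality an equality at the end points \<open>t = 0\<close> and \<open>t = 1\<close>.
\<close>

definition ext_concave :: "(real \<Rightarrow> ereal) \<Rightarrow> bool" where
  "ext_concave g \<longleftrightarrow>
     (\<forall>x. g x \<noteq> \<infinity>) \<and>
     (\<forall>x y. \<forall>t\<in>{0..1}. ereal (1 - t) * g x + ereal t * g y \<le> g ((1 - t) * x + t * y))"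

definition log_concave_dists :: "real measure set" where
  "log_concave_dists = {\<mu>. prob_space \<mu> \<and> sets \<mu> = sets borel \<and>
     ((\<exists>a. \<mu> = return borel a) \<or>
      (\<exists>f :: real \<Rightarrow> real. f \<in> borel_measurable borel \<and> (\<forall>x. 0 \<le> f x) \<and>
         \<mu> = density lborel (\<lambda>x. ennreal (f x)) \<and>
         ext_concave (\<lambda>x. ext_ln (f x))))}"

definition couplings :: "real measure \<Rightarrow> real measure \<Rightarrow> (real \<times> real) measure set" where
  "couplings \<mu> \<nu> = {\<pi>. prob_space \<pi> \<and> sets \<pi> = sets (borel \<Otimes>\<^sub>M borel) \<and>
     distr \<pi> borel fst = \<mu> \<and> distr \<pi> borel snd = \<nu>}"

definition transport_cost :: "real measure \<Rightarrow> real measure \<Rightarrow> ennreal" where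
  "transport_cost \<mu> \<nu> =
     (INF \<pi>\<in>couplings \<mu> \<nu>. \<integral>\<^sup>+p. ennreal (\<bar>fst p - snd p\<bar>\<^sup>2) \<partial>\<pi>)"

text \<open>The case distinction is the square root on \<^typ>\<open>ennreal\<close>.\<close>

definition W2 :: "real measure \<Rightarrow> real measure \<Rightarrow> ennreal" where
  "W2 \<mu> \<nu> =
     (if transport_cost \<mu> \<nu> = \<infinity> then \<infinity> else ennreal (sqrt (enn2real (transport_cost \<mu> \<nu>))))"

text \<open>
  For \<open>F = log_concave_dists\<close> the minimizer exists and is unique whenever \<open>\<mu>\<close> is a Borel
  probability measure with finite second moment; elsewhere the value is unspecified.
\<close>

definition W2_proj :: "real measure set \<Rightarrow> real measure \<Rightarrow> real measure" where
  "W2_proj F \<mu> = (THE \<nu>. is_arg_min (\<lambda>\<nu>. W2 \<nu> \<mu>) (\<lambda>\<nu>. \<nu> \<in> F) \<nu>)"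

definition empirical_measure :: "nat \<Rightarrow> (nat \<Rightarrow> real) \<Rightarrow> real measure" where
  "empirical_measure n x = measure_of UNIV (sets borel)
     (\<lambda>A. \<Sum>i=1..n. ennreal (1 / real n) * emeasure (return borel (x i)) A)"

lemma sets_empirical_measure [simp]: "sets (empirical_measure n x) = sets borel"
  using sets.sets_measure_of_eq[of borel] by (simp add: empirical_measure_def)

text \<open>The set function above is a measure, so \<^const>\<open>measure_of\<close> does not collapse to \<open>0\<close>.\<close>

lemma emeasure_empirical_measure:
  assumes "A \<in> sets borel"
  shows "emeasure (empirical_measure n x) A =
    (\<Sum>i=1..n. ennreal (1 / real n) * emeasure (return borel (x i)) A)"
proof (rule emeasure_measure_of[OF empirical_measure_def])
  show "countably_additive (sets (empirical_measure n x))
    (\<lambda>A. \<Sum>i=1..n. ennreal (1 / real n) * emeasure (return borel (x i)) A)"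
  proof (rule countably_additiveI)
    fix B :: "nat \<Rightarrow> real set"
    assume B: "range B \<subseteq> sets (empirical_measure n x)" "disjoint_family B"
    have *: "(\<Sum>k. emeasure (return borel (x i)) (B k)) =
        emeasure (return borel (x i)) (\<Union>k. B k)" for i
      using B by (intro suminf_emeasure) auto
    show "(\<Sum>k. \<Sum>i=1..n. ennreal (1 / real n) * emeasure (return borel (x i)) (B k)) =
        (\<Sum>i=1..n. ennreal (1 / real n) * emeasure (return borel (x i)) (\<Union>k. B k))"
      by (subst suminf_sum) (auto simp: ennreal_suminf_cmult *)
  qed
qed (use assms in \<open>auto simp: positive_def empirical_measure_def\<close>)

definition std_dev :: "real measure \<Rightarrow> real" where
  "std_dev \<mu> = sqrt (prob_space.variance \<mu> (\<lambda>x. x))"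

definition sq_loss :: "real measure \<Rightarrow> nat \<Rightarrow> (nat \<Rightarrow> real) \<Rightarrow> ennreal" where
  "sq_loss \<mu> n x = (W2 (W2_proj log_concave_dists (empirical_measure n x)) \<mu>)\<^sup>2"

text \<open>
  The joint law of \<open>n\<close> independent samples from \<open>\<mu>\<close>.  Using the law, rather than random
  variables on an arbitrary probability space, keeps universal constants independent of the
  type of that space.
\<close>

abbreviation iid_law :: "nat \<Rightarrow> real measure \<Rightarrow> (nat \<Rightarrow> real) measure" where
  "iid_law n \<mu> \<equiv> Pi\<^sub>M {1..n} (\<lambda>_. \<mu>)"

end

theory Submission
  imports Defs
begin

text \<open>
  On the line \<open>W\<^sub>2\<close> is the \<open>L\<^sup>2\<close> distance of quantile functions, and the quantile functions of
  log-concave laws are closed and convex in \<open>L\<^sup>2(0,1)\<close>: a smooth one satisfies \<open>q' = 1 / I\<close> with \<open>I\<close>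
  concave.  Hence the projection is nonexpansive and fixes the true law, so the loss is at most the
  squared transport cost between the empirical and the true law, and it depends measurably on the sample.
  That cost is bounded, up to a factor 4, by the integral of \<open>(G - F)\<^sup>2 / f\<close>, where \<open>F\<close>, \<open>G\<close> are the
  true and the empirical distribution function and \<open>f = F'\<close>; its mean is the integral of
  \<open>F (1 - F) / (n f)\<close>.  With \<open>K = 1 / (2 I(1/2))\<close> concavity of \<open>I\<close> gives \<open>F (1 - F) / f \<le> K\<close>, so
  between the quantiles of level \<open>1/n\<close> and \<open>1 - 1/n\<close> the mean is at most \<open>K / n\<close> times their distance,
  which is at most the length of the support and at most \<open>2 K ln n\<close>; the tails contribute a multiple
  of \<open>K\<^sup>2 / n\<close>.  Finally \<open>q' \<ge> K\<close> bounds \<open>K\<close> by the standard deviation and by the length of the support.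
\<close>

section \<open>Optimal transport on the line\<close>

text \<open>The cut at level 1/n is forced: for an exponential tail F (1 - F) / f tends to a
  positive constant, so the weighted integral over the whole line has infinite mean. Between the
  levels v < h a quantile function drops by at most K ln (h / v), whose square has an integral of
  order h; with h = 1/n the tails therefore cost no more than the central part.

  The obstacle to the projection argument is that concavity of I is a statement about q', which
  convergence in mean square does not control; the window inequality is its integrated form. A point
  mass has q' = 0, hence no I, and is treated apart. No quotient by null sets is formed, since
  membership in the cone concerns values at points; limits are taken pointwise instead.

  The transport cost is needed exactly, not only as an upper bound: the projection is defined by
  minimizing W2 over measures and has to be identified with the projection in mean square. The
  constants are not optimized, and one number serves both bounds.\<close>

abbreviation unif :: "real measure" where
  "unif \<equiv> restrict_space lborel {0<..<1}"

abbreviation law :: "(real \<Rightarrow> real) \<Rightarrow> real measure" where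
  "law q \<equiv> distr unif borel q"

abbreviation sq_dist :: "(real \<Rightarrow> real) \<Rightarrow> (real \<Rightarrow> real) \<Rightarrow> real" where
  "sq_dist q r \<equiv> \<integral>v. (q v - r v)\<^sup>2 \<partial>unif"

abbreviation nn_sq_dist :: "(real \<Rightarrow> real) \<Rightarrow> (real \<Rightarrow> real) \<Rightarrow> ennreal" where
  "nn_sq_dist q r \<equiv> \<integral>\<^sup>+v. ennreal ((q v - r v)\<^sup>2) \<partial>unif"

lemma prob_space_unif: "prob_space unif"
  by (auto simp: emeasure_restrict_space space_restrict_space intro!: prob_spaceI)

interpretation unif: prob_space unif
  by (rule prob_space_unif)

lemma space_unif [simp]: "space unif = {0<..<1}"
  by (simp add: space_restrict_space)

lemma mono_on_measurable_unif:
  fixes q :: "real \<Rightarrow> real"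
  assumes "mono_on {0<..<1} q" shows "q \<in> borel_measurable unif"
proof -
  have 1: "(borel_measurable unif :: (real \<Rightarrow> real) set) = borel_measurable (restrict_space borel {0<..<1})"
    by (rule measurable_cong_sets) (auto simp: sets_restrict_space)
  show ?thesis
    unfolding 1 by (rule borel_measurable_mono_on_fnc[OF assms])
qed

lemma prob_space_distr_unif:
  fixes q :: "real \<Rightarrow> real"
  assumes "mono_on {0<..<1} q" shows "prob_space (law q)"
  by (intro unif.prob_space_distr mono_on_measurable_unif assms)

text \<open>\<open>q\<close> is the generalized inverse of the distribution function from Skorohod's
  construction. The equivalence in the last clause later turns comparisons of quantiles into
  comparisons of probabilities.\<close>

lemma exists_quantile:
  assumes "prob_space \<mu>" "sets \<mu> = sets borel"
  shows "\<exists>q. mono_on {0<..<1} q \<and> law q = \<mu> \<and>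
    (\<forall>v\<in>{0<..<1}. \<forall>x. v \<le> cdf \<mu> x \<longleftrightarrow> q v \<le> x)"
proof -
  interpret prob_space \<mu> by fact
  interpret cdf_distribution \<mu>
    by unfold_locales (use assms sets_eq_imp_space_eq[OF assms(2)] in auto)
  show ?thesis
    using mono_I distr_I_eq_M pseudoinverse' by blast
qed

text \<open>The joint law of \<open>X\<close> and \<open>Y\<close> is one admissible coupling. It
  serves for quantile functions on the unit interval and, for two samples, with a common random
  index.\<close>

lemma transport_cost_distr_le:
  assumes "prob_space M" "X \<in> borel_measurable M" "Y \<in> borel_measurable M"
  shows "transport_cost (distr M borel X) (distr M borel Y) \<le> (\<integral>\<^sup>+w. ennreal ((X w - Y w)\<^sup>2) \<partial>M)"
proof -
  note [measurable] = assms(2,3)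
  let ?P = "distr M (borel \<Otimes>\<^sub>M borel) (\<lambda>w. (X w, Y w))"
  have "?P \<in> couplings (distr M borel X) (distr M borel Y)"
    unfolding couplings_def
    by (auto simp: distr_distr comp_def intro!: prob_space.prob_space_distr assms(1))
  then have "transport_cost (distr M borel X) (distr M borel Y)
      \<le> (\<integral>\<^sup>+p. ennreal (\<bar>fst p - snd p\<bar>\<^sup>2) \<partial>?P)"
    unfolding transport_cost_def by (rule INF_lower)
  also have "\<dots> = (\<integral>\<^sup>+w. ennreal ((X w - Y w)\<^sup>2) \<partial>M)"
    by (subst nn_integral_distr) auto
  finally show ?thesis .
qed

text \<open>For \<open>x < y\<close> the right-hand side is twice the area of the triangle
  \<open>x \<le> s \<le> t < y\<close>. The second indicator covers \<open>y < x\<close>, and the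
  two events exclude each other. Integrating this form over a coupling produces only masses of
  quadrants.\<close>

lemma sq_eq_nn_integral_layers:
  fixes x y :: real
  shows "ennreal ((x - y)\<^sup>2) = 2 * (\<integral>\<^sup>+s. \<integral>\<^sup>+t. indicator {t. s \<le> t} t *
    (indicator {p. fst p \<le> s \<and> t < snd p} (x, y) + indicator {p. snd p \<le> s \<and> t < fst p} (x, y))
    \<partial>lborel \<partial>lborel)"
proof -
  have *: "(\<integral>\<^sup>+s. \<integral>\<^sup>+t. indicator {t. s \<le> t} t *
      (indicator {p. fst p \<le> s \<and> t < snd p} (x, y) + indicator {p. snd p \<le> s \<and> t < fst p} (x, y))
      \<partial>lborel \<partial>lborel) = ennreal ((y - x)\<^sup>2 / 2)" (is "?L x y = _") if "x \<le> y" for x y :: real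
  proof -
    have "?L x y = (\<integral>\<^sup>+s. \<integral>\<^sup>+t. indicator {x..} s * indicator {s..<y} t \<partial>lborel \<partial>lborel)"
      using that by (intro nn_integral_cong) (auto simp: indicator_def)
    also have "\<dots> = (\<integral>\<^sup>+s. ennreal (y - s) * indicator {x..y} s \<partial>lborel)"
      by (intro nn_integral_cong, subst nn_integral_cmult)
        (auto simp: indicator_def split: if_splits)
    finally have *: "?L x y = (\<integral>\<^sup>+s. ennreal (y - s) * indicator {x..y} s \<partial>lborel)" .
    have "((\<lambda>s. - ((y - s)\<^sup>2 / 2)) has_real_derivative (y - s)) (at s)" for s
      by (auto intro!: derivative_eq_intros simp: field_simps)
    from nn_integral_FTC_Icc[OF _ this, of x y] that
    have "(\<integral>\<^sup>+s. ennreal (y - s) * indicator {x..y} s \<partial>lborel) = ennreal ((y - x)\<^sup>2 / 2)"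
      by (simp add: indicator_def if_distrib cong: if_cong)
    then show ?thesis using * by simp
  qed
  have sym: "(\<integral>\<^sup>+s. \<integral>\<^sup>+t. indicator {t. s \<le> t} t *
      (indicator {p. fst p \<le> s \<and> t < snd p} (x, y) + indicator {p. snd p \<le> s \<and> t < fst p} (x, y))
      \<partial>lborel \<partial>lborel) = (\<integral>\<^sup>+s. \<integral>\<^sup>+t. indicator {t. s \<le> t} t *
      (indicator {p. fst p \<le> s \<and> t < snd p} (y, x) + indicator {p. snd p \<le> s \<and> t < fst p} (y, x))
      \<partial>lborel \<partial>lborel)" by (intro nn_integral_cong) (auto simp: indicator_def)
  have two: "ennreal ((x - y)\<^sup>2) = 2 * ennreal ((x - y)\<^sup>2 / 2)"
    by (subst ennreal_numeral[symmetric], subst ennreal_mult[symmetric]) auto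
  show ?thesis
  proof (cases "x \<le> y")
    case True
    show ?thesis unfolding two *[OF True] by (simp add: power2_commute)
  next
    case False
    then show ?thesis unfolding two sym *[of y x, simplified False, simplified] 
      by (subst *) (auto simp: power2_commute)
  qed
qed

text \<open>Tonelli's theorem applied to the triangle formula.\<close>

lemma nn_integral_sq_diff_layers:
  fixes P :: "(real \<times> real) measure"
  assumes "sigma_finite_measure P" and [measurable_cong]: "sets P = sets (borel \<Otimes>\<^sub>M borel)"
  shows "(\<integral>\<^sup>+p. ennreal ((fst p - snd p)\<^sup>2) \<partial>P) = 2 * (\<integral>\<^sup>+s. \<integral>\<^sup>+t. indicator {t. s \<le> t} t *
    (emeasure P {p. fst p \<le> s \<and> t < snd p} + emeasure P {p. snd p \<le> s \<and> t < fst p})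
    \<partial>lborel \<partial>lborel)"
proof -
  interpret P: sigma_finite_measure P by fact
  interpret PL: pair_sigma_finite P lborel ..
  have sp: "space P = UNIV" using sets_eq_imp_space_eq[OF assms(2)] by (simp add: space_pair_measure)
  have m1[measurable]: "{p. fst p \<le> s \<and> t < snd p} \<in> sets P" "{p. snd p \<le> s \<and> t < fst p} \<in> sets P" for s t :: real
  proof -
    have "{p \<in> space P. fst p \<le> s \<and> t < snd p} \<in> sets P" "{p \<in> space P. snd p \<le> s \<and> t < fst p} \<in> sets P" by measurable
    then show "{p. fst p \<le> s \<and> t < snd p} \<in> sets P" "{p. snd p \<le> s \<and> t < fst p} \<in> sets P" by (simp_all add: sp)
  qed
  let ?k = "\<lambda>p s t. indicator {t. s \<le> t} t *
    (indicator {p. fst p \<le> s \<and> t < snd p} p + indicator {p. snd p \<le> s \<and> t < fst p} p) :: ennreal"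
  have [measurable]: "(\<lambda>x. ?k (fst (fst x)) (snd (fst x)) (snd x)) \<in> borel_measurable ((P \<Otimes>\<^sub>M lborel) \<Otimes>\<^sub>M lborel)"
    "(\<lambda>x. ?k (fst x) (s) (snd x)) \<in> borel_measurable (P \<Otimes>\<^sub>M lborel)" for s
    unfolding indicator_def mem_Collect_eq by measurable
  have "(\<integral>\<^sup>+p. ennreal ((fst p - snd p)\<^sup>2) \<partial>P) = (\<integral>\<^sup>+p. 2 * (\<integral>\<^sup>+s. \<integral>\<^sup>+t. ?k p s t \<partial>lborel \<partial>lborel) \<partial>P)"
    by (subst sq_eq_nn_integral_layers) (simp add: case_prod_beta)
  also have "\<dots> = 2 * (\<integral>\<^sup>+p. (\<integral>\<^sup>+s. \<integral>\<^sup>+t. ?k p s t \<partial>lborel \<partial>lborel) \<partial>P)"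
    by (rule nn_integral_cmult) measurable
  also have "(\<integral>\<^sup>+p. (\<integral>\<^sup>+s. \<integral>\<^sup>+t. ?k p s t \<partial>lborel \<partial>lborel) \<partial>P) = (\<integral>\<^sup>+s. \<integral>\<^sup>+p. \<integral>\<^sup>+t. ?k p s t \<partial>lborel \<partial>P \<partial>lborel)"
    by (rule PL.Fubini'[symmetric]) measurable
  also have "\<dots> = (\<integral>\<^sup>+s. \<integral>\<^sup>+t. \<integral>\<^sup>+p. ?k p s t \<partial>P \<partial>lborel \<partial>lborel)"
    by (intro nn_integral_cong PL.Fubini'[symmetric]) measurable
  also have "\<dots> = (\<integral>\<^sup>+s. \<integral>\<^sup>+t. indicator {t. s \<le> t} t *
    (emeasure P {p. fst p \<le> s \<and> t < snd p} + emeasure P {p. snd p \<le> s \<and> t < fst p})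
    \<partial>lborel \<partial>lborel)"
    by (intro nn_integral_cong) (simp add: nn_integral_cmult nn_integral_add)
  finally show ?thesis .
qed

text \<open>Sublevel sets of monotone functions are initial segments of the unit interval, so the
  two are nested. Either the set on the left is empty and the truncated subtraction of
  \<open>ennreal\<close> gives 0, or the subtraction is exact.\<close>

lemma emeasure_monotone_Diff:
  fixes q r :: "real \<Rightarrow> real"
  assumes "mono_on {0<..<1} q" "mono_on {0<..<1} r"
  shows "emeasure unif {v\<in>{0<..<1}. q v \<le> s \<and> t < r v} =
    emeasure unif {v\<in>{0<..<1}. q v \<le> s} - emeasure unif {v\<in>{0<..<1}. r v \<le> t}"
proof -
  have A: "{v\<in>{0<..<1}. q v \<le> s} \<in> sets unif" 
    using measurable_sets[OF mono_on_measurable_unif[OF assms(1)], of "{..s}"]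
    by (auto simp: vimage_def Int_def conj_commute)
  have B: "{v\<in>{0<..<1}. r v \<le> t} \<in> sets unif" 
    using measurable_sets[OF mono_on_measurable_unif[OF assms(2)], of "{..t}"]
    by (auto simp: vimage_def Int_def conj_commute)
  have D: "{v\<in>{0<..<1}. q v \<le> s \<and> t < r v} = {v\<in>{0<..<1}. q v \<le> s} - {v\<in>{0<..<1}. r v \<le> t}"
    by auto
  have "{v\<in>{0<..<1}. q v \<le> s} \<subseteq> {v\<in>{0<..<1}. r v \<le> t} \<or> {v\<in>{0<..<1}. r v \<le> t} \<subseteq> {v\<in>{0<..<1}. q v \<le> s}"
  proof (rule ccontr)
    assume "\<not> ?thesis"
    then obtain u w where uw: "u \<in> {0<..<1}" "w \<in> {0<..<1}" "q u \<le> s" "\<not> r u \<le> t" "r w \<le> t" "\<not> q w \<le> s"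
      by auto
    then show False
      using mono_onD[OF assms(1), of w u] mono_onD[OF assms(2), of u w] by linarith
  qed
  then show ?thesis
  proof
    assume sub: "{v\<in>{0<..<1}. q v \<le> s} \<subseteq> {v\<in>{0<..<1}. r v \<le> t}"
    then have empty: "{v\<in>{0<..<1}. q v \<le> s \<and> t < r v} = {}" by force
    have "emeasure unif {v\<in>{0<..<1}. q v \<le> s} \<le> emeasure unif {v\<in>{0<..<1}. r v \<le> t}"
      by (intro emeasure_mono sub B)
    then show ?thesis
      unfolding empty by (simp add: unif.emeasure_eq_measure ennreal_minus ennreal_neg)
  next
    assume "{v\<in>{0<..<1}. r v \<le> t} \<subseteq> {v\<in>{0<..<1}. q v \<le> s}"
    then show ?thesis unfolding D by (intro emeasure_Diff A B) auto
  qed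
qed

text \<open>The general lower bound for the mass of a difference; by
  \<open>emeasure_monotone_Diff\<close> the monotone coupling attains it at all levels.\<close>

lemma emeasure_Diff_ge:
  assumes "A \<in> sets M" "B \<in> sets M" "emeasure M B \<noteq> \<infinity>"
  shows "emeasure M A - emeasure M B \<le> emeasure M (A - B)"
proof (rule ennreal_minus_le_iff[THEN iffD2], safe)
  show "emeasure M A \<le> emeasure M B + emeasure M (A - B)"
    using emeasure_mono[of A "B \<union> (A - B)" M] emeasure_subadditive[of B M "A - B"] assms by auto
qed (use assms in \<open>auto intro: order_trans emeasure_mono\<close>)

text \<open>
  Layer-cake formula: the cost of a coupling is an integral over \<open>s \<le> t\<close> of the masses it gives to
  \<open>{x \<le> s, t < y}\<close> and its mirror image.  The marginals bound these masses below by differences of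
  distribution functions, and the monotone coupling attains all these bounds at once.
\<close>

theorem transport_cost_quantiles:
  assumes "mono_on {0<..<1} q" "mono_on {0<..<1} r"
  shows "transport_cost (law q) (law r) = nn_sq_dist q r"
proof (rule antisym)
  note mq[measurable] = assms[THEN mono_on_measurable_unif]
  show "transport_cost (law q) (law r) \<le> nn_sq_dist q r"
    by (intro transport_cost_distr_le prob_space_unif mq)
  let ?M = "distr unif (borel \<Otimes>\<^sub>M borel) (\<lambda>v. (q v, r v))"
  interpret M: prob_space ?M by (intro unif.prob_space_distr) measurable
  show "nn_sq_dist q r \<le> transport_cost (law q) (law r)"
    unfolding transport_cost_def
  proof (rule INF_greatest)
    fix P assume "P \<in> couplings (law q) (law r)"
    then have P: "prob_space P" and sP[measurable_cong]: "sets P = sets (borel \<Otimes>\<^sub>M borel)"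
      and f: "distr P borel fst = law q" and s: "distr P borel snd = law r"
      by (auto simp: couplings_def)
    interpret P: prob_space P by fact
    have sp: "space P = UNIV" using sets_eq_imp_space_eq[OF sP] by (simp add: space_pair_measure)
    have 1: "emeasure P {p. fst p \<le> c} = emeasure unif {v\<in>{0<..<1}. q v \<le> c}" for c
      using arg_cong[OF f, of "\<lambda>m. emeasure m {..c}"]
      by (simp add: emeasure_distr sp vimage_def Int_def conj_commute)
    have 2: "emeasure P {p. snd p \<le> c} = emeasure unif {v\<in>{0<..<1}. r v \<le> c}" for c
      using arg_cong[OF s, of "\<lambda>m. emeasure m {..c}"]
      by (simp add: emeasure_distr sp vimage_def Int_def conj_commute)
    have m: "{p. fst p \<le> c} \<in> sets P" "{p. snd p \<le> c} \<in> sets P" for c :: real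
    proof -
      have "{p \<in> space P. fst p \<le> c} \<in> sets P" "{p \<in> space P. snd p \<le> c} \<in> sets P" by measurable
      then show "{p. fst p \<le> c} \<in> sets P" "{p. snd p \<le> c} \<in> sets P" by (simp_all add: sp)
    qed
    have low: "emeasure P A - emeasure P B \<le> emeasure P (A - B)" if "A \<in> sets P" "B \<in> sets P" for A B
      using that by (intro emeasure_Diff_ge) (simp_all add: P.emeasure_eq_measure)
    have mset: "{p. fst p \<le> s \<and> t < snd p} \<in> sets (borel \<Otimes>\<^sub>M borel)"
      "{p. snd p \<le> s \<and> t < fst p} \<in> sets (borel \<Otimes>\<^sub>M borel)" for s t :: real
      using sets.Diff[OF m(1)[of s] m(2)[of t]] sets.Diff[OF m(2)[of s] m(1)[of t]]
      by (auto simp: sP set_diff_eq not_le)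
    have e1: "emeasure ?M {p. fst p \<le> s \<and> t < snd p} \<le> emeasure P {p. fst p \<le> s \<and> t < snd p}" for s t
    proof -
      have "emeasure ?M {p. fst p \<le> s \<and> t < snd p} = emeasure unif {v\<in>{0<..<1}. q v \<le> s \<and> t < r v}"
        by (subst emeasure_distr) (auto intro!: arg_cong2[where f=emeasure] mset)
      also have "\<dots> \<le> emeasure P ({p. fst p \<le> s} - {p. snd p \<le> t})"
        unfolding emeasure_monotone_Diff[OF assms] 1[symmetric] 2[symmetric] by (intro low m)
      also have "{p. fst p \<le> s} - {p. snd p \<le> t} = {p. fst p \<le> s \<and> t < snd p}" by auto
      finally show ?thesis .
    qed
    have e2: "emeasure ?M {p. snd p \<le> s \<and> t < fst p} \<le> emeasure P {p. snd p \<le> s \<and> t < fst p}" for s t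
    proof -
      have "emeasure ?M {p. snd p \<le> s \<and> t < fst p} = emeasure unif {v\<in>{0<..<1}. r v \<le> s \<and> t < q v}"
        by (subst emeasure_distr) (auto intro!: arg_cong2[where f=emeasure] mset)
      also have "\<dots> \<le> emeasure P ({p. snd p \<le> s} - {p. fst p \<le> t})"
        unfolding emeasure_monotone_Diff[OF assms(2,1)] 1[symmetric] 2[symmetric] by (intro low m)
      also have "{p. snd p \<le> s} - {p. fst p \<le> t} = {p. snd p \<le> s \<and> t < fst p}" by auto
      finally show ?thesis .
    qed
    have "nn_sq_dist q r = (\<integral>\<^sup>+p. ennreal ((fst p - snd p)\<^sup>2) \<partial>?M)"
      by (subst nn_integral_distr) auto
    also have "\<dots> \<le> (\<integral>\<^sup>+p. ennreal ((fst p - snd p)\<^sup>2) \<partial>P)"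
      unfolding nn_integral_sq_diff_layers[OF M.sigma_finite_measure_axioms, simplified]
        nn_integral_sq_diff_layers[OF P.sigma_finite_measure_axioms sP]
      by (intro mult_left_mono nn_integral_mono add_mono e1 e2) auto
    finally show "nn_sq_dist q r \<le> (\<integral>\<^sup>+p. ennreal (\<bar>fst p - snd p\<bar>\<^sup>2) \<partial>P)"
      by simp
  qed
qed

section \<open>Quantile functions of log-concave distributions\<close>

text \<open>
  A quantile function \<open>q\<close> with \<open>q' = 1 / I\<close> belongs to a log-concave law iff \<open>I\<close> is concave.
  The map \<open>(h, y) \<mapsto> h\<^sup>2 / y\<close> is jointly convex and decreasing in \<open>y\<close>, so for such \<open>q\<close> the
  quantity below is jointly convex in the end points of the window \<open>[u, u']\<close>.  Unlike concavity of
  \<open>I\<close>, this condition is linear in \<open>q\<close> and makes sense without derivatives.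
\<close>

definition window :: "(real \<Rightarrow> real) \<Rightarrow> real \<Rightarrow> real \<Rightarrow> real" where
  "window q u u' = (u' - u) * (q u' - q u)"

definition lc_quantiles :: "(real \<Rightarrow> real) set" where
  "lc_quantiles = {q. mono_on {0<..<1} q \<and>
     (\<forall>u u' v v' t. 0 < u \<longrightarrow> u \<le> u' \<longrightarrow> u' < 1 \<longrightarrow> 0 < v \<longrightarrow> v \<le> v' \<longrightarrow> v' < 1 \<longrightarrow> 0 \<le> t \<longrightarrow> t \<le> 1 \<longrightarrow>
        window q ((1 - t) * u + t * v) ((1 - t) * u' + t * v')
          \<le> (1 - t) * window q u u' + t * window q v v')}"

lemma lc_quantiles_mono_on: "q \<in> lc_quantiles \<Longrightarrow> mono_on {0<..<1} q"
  by (simp add: lc_quantiles_def)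

lemma lc_quantiles_mono: "q \<in> lc_quantiles \<Longrightarrow> 0 < u \<Longrightarrow> u \<le> v \<Longrightarrow> v < 1 \<Longrightarrow> q u \<le> q v"
  by (erule mono_onD[OF lc_quantiles_mono_on]) auto

lemma lc_quantiles_window:
  assumes "q \<in> lc_quantiles" "0 < u" "u \<le> u'" "u' < 1" "0 < v" "v \<le> v'" "v' < 1" "0 \<le> t" "t \<le> 1"
  shows "window q ((1 - t) * u + t * v) ((1 - t) * u' + t * v')
          \<le> (1 - t) * window q u u' + t * window q v v'"
  using assms unfolding lc_quantiles_def by blast

section \<open>Closure properties of the cone\<close>

lemma lc_quantiles_const: "(\<lambda>_. c) \<in> lc_quantiles"
  by (simp add: lc_quantiles_def window_def mono_on_def)

lemma lc_quantiles_convex_comb: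
  assumes q: "q \<in> lc_quantiles" and r: "r \<in> lc_quantiles" and s: "0 \<le> s" "s \<le> 1"
  shows "(\<lambda>v. (1 - s) * q v + s * r v) \<in> lc_quantiles"
proof -
  let ?m = "\<lambda>v. (1 - s) * q v + s * r v"
  have w: "window ?m u u' = (1 - s) * window q u u' + s * window r u u'" for u u'
    by (simp add: window_def algebra_simps)
  have "mono_on {0<..<1} ?m"
    using s by (intro mono_onI add_mono mult_left_mono)
      (auto intro: mono_onD lc_quantiles_mono[OF q] lc_quantiles_mono[OF r])
  moreover have "window ?m ((1 - t) * u + t * v) ((1 - t) * u' + t * v')
          \<le> (1 - t) * window ?m u u' + t * window ?m v v'"
    if "0 < u" "u \<le> u'" "u' < 1" "0 < v" "v \<le> v'" "v' < 1" "0 \<le> t" "t \<le> 1" for u u' v v' t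
  proof -
    have "window ?m ((1 - t) * u + t * v) ((1 - t) * u' + t * v')
        \<le> (1 - s) * ((1 - t) * window q u u' + t * window q v v') + s * ((1 - t) * window r u u' + t * window r v v')"
      unfolding w using s by (intro add_mono mult_left_mono lc_quantiles_window[OF q] lc_quantiles_window[OF r] that) auto
    also have "\<dots> = (1 - t) * window ?m u u' + t * window ?m v v'"
      unfolding w by (simp add: algebra_simps)
    finally show ?thesis .
  qed
  ultimately show ?thesis by (simp add: lc_quantiles_def)
qed

lemma convex_comb_in_unit:
  fixes u v t :: real
  assumes "0 < u" "u < 1" "0 < v" "v < 1" "0 \<le> t" "t \<le> 1"
  shows "0 < (1 - t) * u + t * v" "(1 - t) * u + t * v < 1"
proof -
  have "(1 - t) *\<^sub>R u + t *\<^sub>R v \<in> {0<..<1}"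
    using convex_real_interval(8)[of 0 "1::real"] assms by (intro convexD_alt) auto
  then show "0 < (1 - t) * u + t * v" "(1 - t) * u + t * v < 1" by auto
qed

text \<open>Each defining inequality involves only finitely many values of the function, so
  pointwise convergence on the open interval suffices.\<close>

lemma lc_quantiles_lim:
  assumes q: "\<And>k. f k \<in> lc_quantiles" and lim: "\<And>v. 0 < v \<Longrightarrow> v < 1 \<Longrightarrow> (\<lambda>k. f k v) \<longlonglongrightarrow> q v"
  shows "q \<in> lc_quantiles"
proof -
  have wlim: "(\<lambda>k. window (f k) u u') \<longlonglongrightarrow> window q u u'" if "0 < u" "u < 1" "0 < u'" "u' < 1" for u u'
    unfolding window_def by (intro tendsto_intros lim that)
  have "mono_on {0<..<1} q"
  proof (rule mono_onI)
    fix u v :: real assume "u \<in> {0<..<1}" "v \<in> {0<..<1}" "u \<le> v"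
    then show "q u \<le> q v"
      by (intro LIMSEQ_le[OF lim lim]) (auto intro!: exI[of _ 0] lc_quantiles_mono[OF q])
  qed
  moreover have "window q ((1 - t) * u + t * v) ((1 - t) * u' + t * v')
          \<le> (1 - t) * window q u u' + t * window q v v'"
    if A: "0 < u" "u \<le> u'" "u' < 1" "0 < v" "v \<le> v'" "v' < 1" "0 \<le> t" "t \<le> 1" for u u' v v' t
  proof (rule LIMSEQ_le)
    show "(\<lambda>k. window (f k) ((1 - t) * u + t * v) ((1 - t) * u' + t * v'))
        \<longlonglongrightarrow> window q ((1 - t) * u + t * v) ((1 - t) * u' + t * v')"
      using A by (intro wlim convex_comb_in_unit) auto
    show "(\<lambda>k. (1 - t) * window (f k) u u' + t * window (f k) v v') \<longlonglongrightarrow> (1 - t) * window q u u' + t * window q v v'"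
      using A by (intro tendsto_intros wlim) auto
    show "\<exists>N. \<forall>k\<ge>N. window (f k) ((1 - t) * u + t * v) ((1 - t) * u' + t * v')
       \<le> (1 - t) * window (f k) u u' + t * window (f k) v v'"
      using A lc_quantiles_window[OF q] by blast
  qed
  ultimately show ?thesis by (simp add: lc_quantiles_def)
qed

section \<open>Regularity of functions in the cone\<close>

lemma lc_quantiles_convex_window:
  assumes "q \<in> lc_quantiles" "0 < a"
  shows "convex_on {a<..<1} (\<lambda>v. (v - a) * (q v - q a))"
proof (rule convex_onI)
  fix t u v :: real assume "0 < t" "t < 1" "u \<in> {a<..<1}" "v \<in> {a<..<1}"
  then show "((1 - t) *\<^sub>R u + t *\<^sub>R v - a) * (q ((1 - t) *\<^sub>R u + t *\<^sub>R v) - q a)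
      \<le> (1 - t) * ((u - a) * (q u - q a)) + t * ((v - a) * (q v - q a))"
    \<comment> \<open>Both windows start at \<open>a\<close>, hence so does their combination, and
      joint convexity becomes ordinary convexity in the right end point.\<close>
    using lc_quantiles_window[OF assms(1), of a u a v t] assms(2)
    by (simp add: window_def algebra_simps)
qed simp

text \<open>Chord slopes of the convex function \<open>(v - a) * (q v - q a)\<close> increase, so
  its slope over \<open>[v, v']\<close> is at most that over \<open>[v', c]\<close>; division by
  \<open>v - a\<close> returns to \<open>q\<close>. The constant involves \<open>q\<close> only
  through \<open>q c - q a\<close>, which makes it uniform over families bounded at two
  points.\<close>

lemma lc_quantiles_lipschitz:
  assumes q: "q \<in> lc_quantiles" and 0: "0 < a" "a < v" "v \<le> v'" "v' < c" "c < 1"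
  shows "\<bar>q v' - q v\<bar> \<le> (v' - v) * ((c - a) * (q c - q a) / ((v - a) * (c - v')))"
proof (cases "v = v'")
  case False
  let ?g = "\<lambda>v. (v - a) * (q v - q a)"
  have m: "q a \<le> q v" "q v \<le> q v'" "q a \<le> q v'"
    by (intro lc_quantiles_mono[OF q]; use 0 in simp)+
  have "(?g v - ?g c) / (v - c) \<le> (?g v' - ?g c) / (v' - c)"
    "(?g v - ?g v') / (v - v') \<le> (?g v - ?g c) / (v - c)"
    using convex_on_slope_le[OF lc_quantiles_convex_window[OF q 0(1)], of v c v'] 0 False by auto
  then have "(?g v' - ?g v) / (v' - v) \<le> (?g c - ?g v') / (c - v')"
    by (smt (verit, best) minus_diff_eq minus_divide_divide)
  also have "\<dots> \<le> ?g c / (c - v')"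
    using 0 m by (intro divide_right_mono) auto
  finally have 1: "(?g v' - ?g v) / (v' - v) \<le> ?g c / (c - v')" .
  have "(v - a) * (q v' - q v) \<le> ?g v' - ?g v"
    using 0 m mult_nonneg_nonneg[of "v' - v" "q v' - q a"] by (simp add: algebra_simps)
  also have "\<dots> \<le> (v' - v) * (?g c / (c - v'))"
    using 1 False 0 by (simp add: divide_le_eq mult.commute)
  finally have "q v' - q v \<le> (v' - v) * (?g c / (c - v')) / (v - a)"
    using 0 by (simp add: pos_le_divide_eq mult.commute mult.left_commute)
  then show ?thesis
    using m by (simp add: field_simps)
qed auto

lemma lc_quantiles_isCont:
  assumes q: "q \<in> lc_quantiles" and v: "0 < v" "v < 1"
  shows "isCont q v"
proof -
  define a where "a = v / 2"
  have g: "continuous_on {a<..<1} (\<lambda>v. (v - a) * (q v - q a))"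
    using v by (intro convex_on_continuous lc_quantiles_convex_window q) (auto simp: a_def)
  from g have c: "continuous_on {a<..<1} (\<lambda>v. (v - a) * (q v - q a) / (v - a) + q a)"
    by (intro continuous_on_add continuous_on_divide continuous_on_diff continuous_on_id continuous_on_const) auto
  have eq: "(v - a) * (q v - q a) / (v - a) + q a = q v" if "v \<in> {a<..<1}" for v
    using that by simp
  have "continuous_on {a<..<1} q"
    using c by (subst (asm) continuous_on_cong[OF refl eq])
  then show ?thesis
    using v by (subst (asm) continuous_on_eq_continuous_at) (auto simp: a_def)
qed

text \<open>Chord slopes from \<open>v\<close> to points on its right decrease to their infimum
  \<open>L\<close> as the point approaches \<open>v\<close>; the slopes of chords on the left bound
  them from below, so the infimum is finite.\<close>

lemma convex_on_right_derivative:
  fixes g :: "real \<Rightarrow> real"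
  assumes g: "convex_on {a<..<b} g" and v: "a < v" "v < b"
  shows "\<exists>L. ((\<lambda>h. (g (v + h) - g v) / h) \<longlongrightarrow> L) (at_right 0) \<and>
    (\<forall>w. v < w \<longrightarrow> w < b \<longrightarrow> L \<le> (g w - g v) / (w - v)) \<and>
    (\<forall>w. a < w \<longrightarrow> w < v \<longrightarrow> (g v - g w) / (v - w) \<le> L)"
proof -
  let ?s = "\<lambda>w. (g w - g v) / (w - v)"
  define L where "L = Inf (?s ` {v<..<b})"
  have flip: "(g x - g y) / (x - y) = (g y - g x) / (y - x)" for x y
    by (metis minus_diff_eq minus_divide_divide)
  have low: "(g v - g w) / (v - w) \<le> ?s w'" if "a < w" "w < v" "v < w'" "w' < b" for w w'
    using convex_on_slope_le[OF g, of w w' v] that flip by (auto intro: order_trans)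
  obtain w0 where w0: "a < w0" "w0 < v" using dense v by blast
  have bdd: "bdd_below (?s ` {v<..<b})"
    using low[OF w0] by (auto intro!: bdd_belowI)
  have ne: "{v<..<b} \<noteq> {}" using v by simp
  have L1: "L \<le> ?s w" if "v < w" "w < b" for w
    unfolding L_def using that by (intro cInf_lower bdd) auto
  have L2: "(g v - g w) / (v - w) \<le> L" if "a < w" "w < v" for w
    unfolding L_def using that low ne by (intro cINF_greatest) auto
  have mono: "?s w \<le> ?s w'" if "v < w" "w < w'" "w' < b" for w w'
    using convex_on_slope_le(1)[OF g, of v w' w] that v flip by auto
  have "((\<lambda>h. (g (v + h) - g v) / h) \<longlongrightarrow> L) (at_right 0)"
  proof (rule tendstoI)
    fix e :: real assume "0 < e"
    then obtain w1 where w1: "v < w1" "w1 < b" "?s w1 < L + e"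
      using cInf_lessD[of "?s ` {v<..<b}" "L + e"] ne unfolding L_def by fastforce
    have "eventually (\<lambda>h. h < w1 - v) (at_right 0)"
      using w1 by (intro order_tendstoD(2)[of _ 0] tendsto_ident_at) auto
    then show "eventually (\<lambda>h. dist ((g (v + h) - g v) / h) L < e) (at_right 0)"
      using eventually_at_right_less[of 0]
    proof eventually_elim
      case (elim h)
      then show ?case using L1[of "v + h"] mono[of "v + h" w1] w1 by (auto simp: dist_real_def)
    qed
  qed
  with L1 L2 show ?thesis by blast
qed

text \<open>Convexity of the windows starting at a fixed point gives a right derivative
  \<open>R\<close>. Windows of equal length \<open>h\<close> at two points combine to a window of
  length \<open>h\<close>; dividing by \<open>h\<close> twice and letting \<open>h\<close> tend to 0
  makes \<open>R\<close> convex, hence continuous. A continuous right derivative excludes a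
  kink.\<close>

lemma lc_quantiles_differentiable:
  assumes q: "q \<in> lc_quantiles"
  obtains P where "\<And>v. 0 < v \<Longrightarrow> v < 1 \<Longrightarrow> (q has_real_derivative P v) (at v)"
proof -
  let ?g = "\<lambda>a v. (v - a) * (q v - q a)"
  let ?D = "\<lambda>v h. (q (v + h) - q v) / h"
  \<comment> \<open>A one-sided product rule: the right difference quotients of \<open>?g a\<close>
    and of \<open>q\<close> converge together.\<close>
  have Dg: "((\<lambda>h. (?g a (v + h) - ?g a v) / h) \<longlongrightarrow> L) (at_right 0) \<longleftrightarrow>
      (?D v \<longlongrightarrow> (L - (q v - q a)) / (v - a)) (at_right 0)"
    if "0 < a" "a < v" "v < 1" for a v L
  proof -
    have ct: "((\<lambda>h. q (v + h) - q a) \<longlongrightarrow> q v - q a) (at_right 0)"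
      using lc_quantiles_isCont[OF q, of v] that
      by (intro tendsto_intros filterlim_mono[OF iffD1[OF isCont_iff] order_refl at_le]) auto
    show ?thesis
    proof
      assume *: "((\<lambda>h. (?g a (v + h) - ?g a v) / h) \<longlongrightarrow> L) (at_right 0)"
      have "((\<lambda>h. ((?g a (v + h) - ?g a v) / h - (q (v + h) - q a)) / (v - a))
          \<longlongrightarrow> (L - (q v - q a)) / (v - a)) (at_right 0)"
        using that by (intro tendsto_divide[OF tendsto_diff[OF * ct] tendsto_const]) auto
      then show "(?D v \<longlongrightarrow> (L - (q v - q a)) / (v - a)) (at_right 0)"
        by (rule filterlim_cong[THEN iffD1, rotated -1])
          (use that eventually_at_right_less[of "0::real"] in \<open>auto elim!: eventually_mono simp: field_simps\<close>)
    next
      assume *: "(?D v \<longlongrightarrow> (L - (q v - q a)) / (v - a)) (at_right 0)"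
      have "((\<lambda>h. (v - a) * ?D v h + (q (v + h) - q a))
          \<longlongrightarrow> (v - a) * ((L - (q v - q a)) / (v - a)) + (q v - q a)) (at_right 0)"
        by (intro tendsto_add tendsto_mult tendsto_const * ct)
      moreover have "(v - a) * ((L - (q v - q a)) / (v - a)) + (q v - q a) = L"
        using that by simp
      ultimately have "((\<lambda>h. (v - a) * ?D v h + (q (v + h) - q a)) \<longlongrightarrow> L) (at_right 0)"
        by simp
      then show "((\<lambda>h. (?g a (v + h) - ?g a v) / h) \<longlongrightarrow> L) (at_right 0)"
        by (rule filterlim_cong[THEN iffD1, rotated -1])
          (use that eventually_at_right_less[of "0::real"] in \<open>auto elim!: eventually_mono simp: field_simps\<close>)
    qed
  qed
  have "\<exists>L. (?D v \<longlongrightarrow> L) (at_right 0)" if "0 < v" "v < 1" for v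
    using convex_on_right_derivative[OF lc_quantiles_convex_window[OF q, of "v/2"], of v]
      Dg[of "v/2" v] that by auto
  then obtain R where R: "\<And>v. 0 < v \<Longrightarrow> v < 1 \<Longrightarrow> (?D v \<longlongrightarrow> R v) (at_right 0)"
    by metis
  have "convex_on {0<..<1} R"
  proof (rule convex_onI)
    fix t u v :: real assume A: "0 < t" "t < 1" "u \<in> {0<..<1}" "v \<in> {0<..<1}"
    let ?w = "(1 - t) * u + t * v"
    have w: "0 < ?w" "?w < 1" using A convex_comb_in_unit[of u v t] by auto
    have "R ?w \<le> (1 - t) * R u + t * R v"
    proof (rule tendsto_le[OF trivial_limit_at_right_real _ R[OF w]])
      show "((\<lambda>h. (1 - t) * ?D u h + t * ?D v h) \<longlongrightarrow> (1 - t) * R u + t * R v) (at_right 0)"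
        using A by (intro tendsto_intros R) auto
      have "eventually (\<lambda>h. h < 1 - u) (at_right 0)" "eventually (\<lambda>h. h < 1 - v) (at_right 0)"
        using A by (auto intro!: order_tendstoD(2)[of _ 0] tendsto_ident_at)
      then show "\<forall>\<^sub>F h in at_right 0. ?D ?w h \<le> (1 - t) * ?D u h + t * ?D v h"
        using eventually_at_right_less[of "0::real"]
      proof eventually_elim
        case (elim h)
        have "window q ((1 - t) * u + t * v) ((1 - t) * (u + h) + t * (v + h)) \<le>
            (1 - t) * window q u (u + h) + t * window q v (v + h)"
          using A elim by (intro lc_quantiles_window[OF q]) auto
        moreover have "(1 - t) * (u + h) + t * (v + h) = ?w + h" by (simp add: algebra_simps)
        ultimately have "h * (q (?w + h) - q ?w) \<le> h * ((1 - t) * (q (u + h) - q u) + t * (q (v + h) - q v))"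
          by (simp add: window_def algebra_simps)
        then have "q (?w + h) - q ?w \<le> (1 - t) * (q (u + h) - q u) + t * (q (v + h) - q v)"
          using elim by simp
        from divide_right_mono[OF this, of h] elim show ?case by (simp add: add_divide_distrib)
      qed
    qed
    then show "R ((1 - t) *\<^sub>R u + t *\<^sub>R v) \<le> (1 - t) * R u + t * R v" by simp
  qed simp
  then have contR: "continuous_on {0<..<1} R" by (intro convex_on_continuous) auto
  have "(q has_real_derivative R v) (at v)" if v: "0 < v" "v < 1" for v
  proof -
    define a where "a = v / 2"
    have a: "0 < a" "a < v" using v by (auto simp: a_def)
    \<comment> \<open>The right derivative of \<open>?g a\<close> by the product rule. Chord slopes
      of \<open>?g a\<close> are squeezed between the values of \<open>G\<close> at their ends, and
      \<open>G\<close> is continuous at \<open>v\<close> because \<open>R\<close> and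
      \<open>q\<close> are.\<close>
    define G where "G w = (w - a) * R w + (q w - q a)" for w
    have slope: "G w \<le> (?g a w' - ?g a w) / (w' - w) \<and> (?g a w' - ?g a w) / (w' - w) \<le> G w'"
      if w: "a < w" "w < w'" "w' < 1" for w w'
    proof -
      have *: "((\<lambda>h. (?g a (x + h) - ?g a x) / h) \<longlongrightarrow> G x) (at_right 0)" if "a < x" "x < 1" for x
        using Dg[of a x "G x"] R[of x] that a by (simp add: G_def)
      have u: "L = G x" if "((\<lambda>h. (?g a (x + h) - ?g a x) / h) \<longlongrightarrow> L) (at_right 0)" "a < x" "x < 1" for x L
        using tendsto_unique[OF trivial_limit_at_right_real that(1) *] that(2,3) by blast
      obtain L where L: "((\<lambda>h. (?g a (w + h) - ?g a w) / h) \<longlongrightarrow> L) (at_right 0)"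
        "\<forall>x. w < x \<longrightarrow> x < 1 \<longrightarrow> L \<le> (?g a x - ?g a w) / (x - w)"
        using convex_on_right_derivative[OF lc_quantiles_convex_window[OF q a(1)], of w] w by auto
      obtain L' where L': "((\<lambda>h. (?g a (w' + h) - ?g a w') / h) \<longlongrightarrow> L') (at_right 0)"
        "\<forall>x. a < x \<longrightarrow> x < w' \<longrightarrow> (?g a w' - ?g a x) / (w' - x) \<le> L'"
        using convex_on_right_derivative[OF lc_quantiles_convex_window[OF q a(1)], of w'] w by auto
      have "L = G w" "L' = G w'"
        using u[OF L(1)] u[OF L'(1)] w by auto
      then show ?thesis
        using L(2) L'(2) w by blast
    qed
    have flip: "(?g a x - ?g a y) / (x - y) = (?g a y - ?g a x) / (y - x)" for x y
      by (metis minus_diff_eq minus_divide_divide)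
    have iR: "isCont R v" using contR v by (simp add: continuous_on_eq_continuous_at)
    then have GL: "((\<lambda>w. \<bar>G w - G v\<bar>) \<longlongrightarrow> 0) (at v)"
    proof -
      have "isCont G v"
        unfolding G_def using iR lc_quantiles_isCont[OF q v] by (intro continuous_intros)
      then show ?thesis by (intro tendsto_rabs_zero LIM_zero) (simp add: isCont_def)
    qed
    have "((\<lambda>w. (?g a w - ?g a v) / (w - v)) \<longlongrightarrow> G v) (at v)"
    proof (rule LIM_zero_cancel, rule Lim_null_comparison[OF _ GL])
      have "eventually (\<lambda>w. w \<in> {a<..<1}) (at v)" "eventually (\<lambda>w. w \<noteq> v) (at v)"
        using v a by (intro eventually_at_in_open' eventually_neq_at_within; simp)+
      then show "\<forall>\<^sub>F w in at v. norm ((?g a w - ?g a v) / (w - v) - G v) \<le> \<bar>G w - G v\<bar>"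
      proof eventually_elim
        case (elim w)
        then show ?case
          using slope[of w v] slope[of v w] a v flip[of w v] by (cases "w < v") auto
      qed
    qed
    then have "(?g a has_real_derivative G v) (at v)"
      by (simp add: has_field_derivative_iff)
    moreover have "((\<lambda>w. w - a) has_real_derivative 1) (at v)"
      by (auto intro!: derivative_eq_intros)
    ultimately have "((\<lambda>w. ?g a w / (w - a)) has_real_derivative (G v * (v - a) - ?g a v * 1) / ((v - a) * (v - a))) (at v)"
      by (rule DERIV_divide) (use a in simp)
    from DERIV_add[OF this DERIV_const[of "q a"]]
    have "((\<lambda>w. ?g a w / (w - a) + q a) has_real_derivative (G v * (v - a) - ?g a v) / ((v - a) * (v - a))) (at v)"
      by simp
    moreover have "(G v * (v - a) - ?g a v) / ((v - a) * (v - a)) = R v"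
    proof -
      have "G v * (v - a) - ?g a v = R v * ((v - a) * (v - a))" by (simp add: G_def algebra_simps)
      then show ?thesis using a by simp
    qed
    ultimately have "((\<lambda>w. ?g a w / (w - a) + q a) has_real_derivative R v) (at v)" by simp
    then show ?thesis
      by (rule has_field_derivative_transform_within_open[where S="{a<..<1}"]) (use a v in auto)
  qed
  then show ?thesis using that by blast
qed

text \<open>A window of length \<open>e * h\<close> is of size
  \<open>e\<^sup>2 * h\<^sup>2 * D\<close>. With \<open>D = 1 / I\<close> the limit is the form
  \<open>h\<^sup>2 / I\<close>, whose joint convexity encodes the concavity of
  \<open>I\<close>.\<close>

lemma DERIV_window_limit:
  fixes q :: "real \<Rightarrow> real"
  assumes "(q has_real_derivative D) (at w)"
  shows "((\<lambda>e. window q w (w + e * h) / e\<^sup>2) \<longlongrightarrow> h\<^sup>2 * D) (at_right 0)"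
proof -
  have "((\<lambda>e. q (w + e * h)) has_real_derivative D * h) (at 0)"
    using assms by (intro DERIV_chain2[of q D]) (auto intro!: derivative_eq_intros)
  then have "((\<lambda>e. (q (w + e * h) - q w) / e) \<longlongrightarrow> D * h) (at_right 0)"
    by (auto simp: DERIV_def intro: filterlim_mono[OF _ order_refl at_le])
  then have "((\<lambda>e. h * ((q (w + e * h) - q w) / e)) \<longlongrightarrow> h * (D * h)) (at_right 0)"
    by (intro tendsto_mult tendsto_const)
  moreover have "h * (D * h) = h\<^sup>2 * D" by (simp add: power2_eq_square)
  ultimately have "((\<lambda>e. h * ((q (w + e * h) - q w) / e)) \<longlongrightarrow> h\<^sup>2 * D) (at_right 0)" by simp
  then show ?thesis
    by (rule filterlim_cong[THEN iffD1, rotated -1])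
      (auto intro!: eventually_mono[OF eventually_at_right_less[of "0::real"]] simp: window_def power2_eq_square)
qed

text \<open>Shrinking two windows of different relative lengths \<open>h\<close>, \<open>k\<close>
  shows that \<open>(v, h) \<mapsto> h\<^sup>2 * P v\<close>, with \<open>P\<close> the derivative
  and \<open>h \<ge> 0\<close>, is jointly convex. Special choices of \<open>h\<close> and
  \<open>k\<close> then show that a single zero of \<open>P\<close> forces \<open>P = 0\<close>
  everywhere, and that otherwise \<open>1 / P\<close> is concave.\<close>

lemma lc_quantiles_cases:
  assumes q: "q \<in> lc_quantiles"
  obtains (const) c where "\<And>v. 0 < v \<Longrightarrow> v < 1 \<Longrightarrow> q v = c"
  | (deriv) I where "\<And>v. 0 < v \<Longrightarrow> v < 1 \<Longrightarrow> (q has_real_derivative 1 / I v) (at v)"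
      "\<And>v. 0 < v \<Longrightarrow> v < 1 \<Longrightarrow> 0 < I v" "concave_on {0<..<1} I"
proof -
  obtain P where P: "\<And>v. 0 < v \<Longrightarrow> v < 1 \<Longrightarrow> (q has_real_derivative P v) (at v)"
    using lc_quantiles_differentiable[OF q] by blast
  have ineq: "((1 - t) * h + t * k)\<^sup>2 * P ((1 - t) * u + t * v) \<le> (1 - t) * (h\<^sup>2 * P u) + t * (k\<^sup>2 * P v)"
    if A: "0 < u" "u < 1" "0 < v" "v < 1" "0 \<le> t" "t \<le> 1" and hk: "0 \<le> h" "0 \<le> k" for u v t h k
  proof -
    let ?w = "(1 - t) * u + t * v" and ?l = "(1 - t) * h + t * k"
    note w = convex_comb_in_unit[OF A]
    show ?thesis
    proof (rule tendsto_le[OF trivial_limit_at_right_real _ DERIV_window_limit[OF P[OF w]]])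
      show "((\<lambda>e. (1 - t) * (window q u (u + e * h) / e\<^sup>2) + t * (window q v (v + e * k) / e\<^sup>2))
          \<longlongrightarrow> (1 - t) * (h\<^sup>2 * P u) + t * (k\<^sup>2 * P v)) (at_right 0)"
        by (intro tendsto_add tendsto_mult tendsto_const DERIV_window_limit P A)
      have "((\<lambda>e. u + e * h) \<longlongrightarrow> u + 0 * h) (at_right 0)" "((\<lambda>e. v + e * k) \<longlongrightarrow> v + 0 * k) (at_right 0)"
        by (intro tendsto_intros)+
      then have "eventually (\<lambda>e. u + e * h < 1) (at_right 0)" "eventually (\<lambda>e. v + e * k < 1) (at_right 0)"
        using A by (auto intro!: order_tendstoD(2))
      then show "\<forall>\<^sub>F e in at_right 0. window q ?w (?w + e * ?l) / e\<^sup>2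
          \<le> (1 - t) * (window q u (u + e * h) / e\<^sup>2) + t * (window q v (v + e * k) / e\<^sup>2)"
        using eventually_at_right_less[of "0::real"]
      proof eventually_elim
        case (elim e)
        have "window q ?w ((1 - t) * (u + e * h) + t * (v + e * k)) \<le>
            (1 - t) * window q u (u + e * h) + t * window q v (v + e * k)"
          using A elim hk by (intro lc_quantiles_window[OF q]) auto
        moreover have "(1 - t) * (u + e * h) + t * (v + e * k) = ?w + e * ?l" by (simp add: algebra_simps)
        ultimately have "window q ?w (?w + e * ?l) \<le>
            (1 - t) * window q u (u + e * h) + t * window q v (v + e * k)" by simp
        from divide_right_mono[OF this, of "e\<^sup>2"] show ?case by (simp add: add_divide_distrib)
      qed
    qed
  qed
  have P0: "0 \<le> P v" if "0 < v" "v < 1" for v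
  proof (rule tendsto_le[OF trivial_limit_at_right_real DERIV_window_limit[OF P[OF that], of 1, simplified] tendsto_const])
    have "eventually (\<lambda>e. e < 1 - v) (at_right 0)"
      using that by (auto intro!: order_tendstoD(2)[of _ 0] tendsto_ident_at)
    then show "\<forall>\<^sub>F e in at_right 0. 0 \<le> window q v (v + e) / e\<^sup>2"
      using eventually_at_right_less[of "0::real"]
      by eventually_elim (use that lc_quantiles_mono[OF q, of v] in \<open>auto simp: window_def\<close>)
  qed
  show thesis
  proof (cases "\<exists>u. 0 < u \<and> u < 1 \<and> P u = 0")
    case True
    then obtain u where u: "0 < u" "u < 1" "P u = 0" by blast
    have "P w = 0" if w: "0 < w" "w < 1" for w
    proof -
      \<comment> \<open>\<open>v\<close> lies beyond \<open>w\<close> as seen from \<open>u\<close>,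
        so \<open>w\<close> is a mixture of \<open>u\<close> and \<open>v\<close> with weight
        \<open>t < 1\<close> on \<open>v\<close>. A window of length 0 at \<open>v\<close> leaves
        only the vanishing term at \<open>u\<close> on the right-hand side.\<close>
      define v where "v = (if w < u then w / 2 else (w + 1) / 2)"
      define t where "t = (w - u) / (v - u)"
      have v: "0 < v" "v < 1" "v \<noteq> u" using w u by (auto simp: v_def)
      have t: "0 \<le> t" "t < 1"
        using w u v by (auto simp: t_def v_def field_simps split: if_splits)
      have "t * (v - u) = w - u" using v by (simp add: t_def)
      then have uv: "(1 - t) * u + t * v = w" by (simp add: algebra_simps)
      have "(1 - t)\<^sup>2 * P w \<le> 0"
        using ineq[of u v t 1 0] t v u uv by simp
      then show ?thesis using P0[OF w] t by (simp add: mult_le_0_iff)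
    qed
    then have "(q has_field_derivative 0) (at v within {0<..<1})" if "v \<in> {0<..<1}" for v
      using that P[of v] by (auto intro: has_field_derivative_at_within)
    then obtain c where "\<And>v. v \<in> {0<..<1} \<Longrightarrow> q v = c"
      using has_field_derivative_zero_constant[of "{0<..<1}" q] by auto
    then show ?thesis by (intro const) auto
  next
    case False
    then have pos: "0 < P v" if "0 < v" "v < 1" for v
      using P0[OF that] that by (auto simp: less_le)
    show ?thesis
    proof (rule deriv[of "\<lambda>v. 1 / P v"])
      show "(q has_real_derivative 1 / (1 / P v)) (at v)" if "0 < v" "v < 1" for v
        using P that by simp
      show "concave_on {0<..<1} (\<lambda>v. 1 / P v)"
      proof -
        have *: "1 / P ((1 - t) * u + t * v) \<ge> (1 - t) * (1 / P u) + t * (1 / P v)"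
          if A: "0 < u" "u < 1" "0 < v" "v < 1" "0 < t" "t < 1" for u v t
        proof -
          \<comment> \<open>With window lengths \<open>1 / P u\<close> and \<open>1 / P v\<close>
            the right-hand side collapses to \<open>?h\<close>, while the left-hand side is
            \<open>?h\<^sup>2\<close> times the derivative at the mixture.\<close>
          let ?h = "(1 - t) * (1 / P u) + t * (1 / P v)"
          have h: "0 < ?h" using A pos by (intro add_pos_pos mult_pos_pos) auto
          have "?h\<^sup>2 * P ((1 - t) * u + t * v) \<le> (1 - t) * ((1 / P u)\<^sup>2 * P u) + t * ((1 / P v)\<^sup>2 * P v)"
            using ineq[of u v t "1 / P u" "1 / P v"] A pos by (simp add: less_imp_le)
          also have "\<dots> = ?h"
            using pos[OF A(1,2)] pos[OF A(3,4)] by (simp add: power2_eq_square)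
          finally have "?h * P ((1 - t) * u + t * v) \<le> 1"
            using h by (simp add: power2_eq_square)
          then show ?thesis
            using pos[OF convex_comb_in_unit[of u v t]] A by (simp add: pos_le_divide_eq)
        qed
        show ?thesis
          unfolding concave_on_def
        proof (rule convex_onI)
          fix t x y :: real assume "0 < t" "t < 1" "x \<in> {0<..<1}" "y \<in> {0<..<1}"
          then show "- (1 / P ((1 - t) *\<^sub>R x + t *\<^sub>R y)) \<le> (1 - t) * - (1 / P x) + t * - (1 / P y)"
            using *[of x y t] by simp
        qed simp
      qed
    qed (use pos in auto)
  qed
qed

text \<open>Cauchy-Schwarz in Titu's form. Once the denominator \<open>(1 - t) * a + t * b\<close>
  is cleared, the deficit is explicit,
  \<open>t * (1 - t) * (h * b - k * a)\<^sup>2 / (a * b)\<close>; a larger denominator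
  \<open>c\<close> only decreases the left-hand side.\<close>

lemma quadratic_over_concave:
  fixes a b c h k t :: real
  assumes "0 < a" "0 < b" "0 \<le> t" "t \<le> 1" "(1 - t) * a + t * b \<le> c"
  shows "((1 - t) * h + t * k)\<^sup>2 / c \<le> (1 - t) * h\<^sup>2 / a + t * k\<^sup>2 / b"
proof -
  have pos: "0 < (1 - t) * a + t * b"
    using assms(1-4) by (cases "t = 0") (auto intro: add_nonneg_pos)
  have "((1 - t) * h\<^sup>2 / a + t * k\<^sup>2 / b) * ((1 - t) * a + t * b) - ((1 - t) * h + t * k)\<^sup>2
      = t * (1 - t) * (h * b - k * a)\<^sup>2 / (a * b)"
    using assms(1,2) by (simp add: divide_simps) algebra
  also have "\<dots> \<ge> 0" using assms by simp
  finally have "((1 - t) * h + t * k)\<^sup>2 / ((1 - t) * a + t * b) \<le> (1 - t) * h\<^sup>2 / a + t * k\<^sup>2 / b"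
    using pos by (simp add: pos_divide_le_eq)
  moreover have "((1 - t) * h + t * k)\<^sup>2 / c \<le> ((1 - t) * h + t * k)\<^sup>2 / ((1 - t) * a + t * b)"
    using pos assms(5) by (intro divide_left_mono) auto
  ultimately show ?thesis by linarith
qed

text \<open>Let the right ends of the three windows travel from their left ends at speeds
  \<open>h\<close>, \<open>k\<close> and \<open>l\<close>. The difference of the two sides of the
  window inequality has, in the travel time \<open>s\<close>, the derivative that
  \<open>quadratic_over_concave\<close> shows to be nonnegative.\<close>

lemma lc_quantilesI:
  assumes q: "\<And>v. 0 < v \<Longrightarrow> v < 1 \<Longrightarrow> (q has_real_derivative 1 / I v) (at v)"
    and pos: "\<And>v. 0 < v \<Longrightarrow> v < 1 \<Longrightarrow> 0 < I v" and conc: "concave_on {0<..<1} I"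
  shows "q \<in> lc_quantiles"
proof -
  have "mono_on {0<..<1} q"
  proof (rule mono_onI)
    fix u v :: real assume A: "u \<in> {0<..<1}" "v \<in> {0<..<1}" "u \<le> v"
    show "q u \<le> q v"
    proof (rule DERIV_nonneg_imp_nondecreasing[OF A(3)])
      fix x assume "u \<le> x" "x \<le> v"
      then show "\<exists>y. (q has_real_derivative y) (at x) \<and> 0 \<le> y"
        using A q[of x] pos[of x] by (intro exI[of _ "1 / I x"]) auto
    qed
  qed
  moreover have "window q ((1 - t) * u + t * v) ((1 - t) * u' + t * v')
          \<le> (1 - t) * window q u u' + t * window q v v'"
    if A: "0 < u" "u \<le> u'" "u' < 1" "0 < v" "v \<le> v'" "v' < 1" "0 \<le> t" "t \<le> 1" for u u' v v' t
  proof -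
    define h k l w where "h = u' - u" and "k = v' - v" and "l = (1 - t) * h + t * k" and "w = (1 - t) * u + t * v"
    define D where "D s = (1 - t) * h * q (u + s * h) + t * k * q (v + s * k) - l * q (w + s * l)" for s
    have "D 0 \<le> D 1"
    proof (rule DERIV_nonneg_imp_nondecreasing[of 0 1 D])
      fix s :: real assume s: "0 \<le> s" "s \<le> 1"
      have "s * h \<le> h" "s * k \<le> k" "0 \<le> s * h" "0 \<le> s * k"
        using s A by (auto simp: h_def k_def mult_left_le_one_le)
      then have us: "0 < u + s * h" "u + s * h < 1" and vs: "0 < v + s * k" "v + s * k < 1"
        using A by (auto simp: h_def k_def)
      have ws: "w + s * l = (1 - t) * (u + s * h) + t * (v + s * k)"
        by (simp add: w_def l_def algebra_simps)
      note ws' = convex_comb_in_unit[OF us vs A(7,8), folded ws]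
      have 1: "((\<lambda>s. q (x + s * m)) has_real_derivative 1 / I (x + s * m) * m) (at s)"
        if "0 < x + s * m" "x + s * m < 1" for x m
        using q[OF that] by (intro DERIV_chain2[of q]) (auto intro!: derivative_eq_intros)
      have D: "(D has_real_derivative (1 - t) * h * (1 / I (u + s * h) * h) + t * k * (1 / I (v + s * k) * k)
          - l * (1 / I (w + s * l) * l)) (at s)"
        unfolding D_def by (intro DERIV_add DERIV_diff DERIV_cmult 1 us vs ws')
      have le: "l\<^sup>2 / I (w + s * l) \<le> (1 - t) * h\<^sup>2 / I (u + s * h) + t * k\<^sup>2 / I (v + s * k)"
        unfolding l_def
        using concave_onD[OF conc, of t "u + s * h" "v + s * k"] us vs A(7,8)
        by (intro quadratic_over_concave pos) (auto simp: ws[unfolded l_def])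
      show "\<exists>y. (D has_real_derivative y) (at s) \<and> 0 \<le> y"
        by (rule exI, rule conjI[OF D]) (use le in \<open>simp add: power2_eq_square mult_ac\<close>)
    qed simp
    moreover have "(1 - t) * u' + t * v' = w + l"
      by (simp add: w_def l_def h_def k_def algebra_simps)
    ultimately show ?thesis
      by (simp add: D_def window_def w_def[symmetric] h_def[symmetric] k_def[symmetric])
        (simp add: h_def k_def algebra_simps)
  qed
  ultimately show ?thesis by (simp add: lc_quantiles_def)
qed

section \<open>Projection onto the cone of log-concave quantile functions\<close>

definition sq_integrable :: "(real \<Rightarrow> real) \<Rightarrow> bool" where
  "sq_integrable f \<longleftrightarrow> f \<in> borel_measurable unif \<and> integrable unif (\<lambda>v. (f v)\<^sup>2)"

lemma sq_integrable_measurable: "sq_integrable f \<Longrightarrow> f \<in> borel_measurable unif"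
  by (simp add: sq_integrable_def)

lemma sq_integrable_mult:
  assumes "sq_integrable f" "sq_integrable g"
  shows "integrable unif (\<lambda>v. f v * g v)"
proof (rule Bochner_Integration.integrable_bound)
  show "integrable unif (\<lambda>v. (f v)\<^sup>2 + (g v)\<^sup>2)"
    using assms by (auto simp: sq_integrable_def)
  show "(\<lambda>v. f v * g v) \<in> borel_measurable unif"
    using assms by (auto simp: sq_integrable_def)
  have "\<bar>x * y\<bar> \<le> x\<^sup>2 + y\<^sup>2" for x y :: real
    using sum_squares_bound[of "\<bar>x\<bar>" "\<bar>y\<bar>", unfolded power2_abs] mult_nonneg_nonneg[OF abs_ge_zero abs_ge_zero, of x y]
    unfolding abs_mult by linarith
  then show "AE v in unif. norm (f v * g v) \<le> norm ((f v)\<^sup>2 + (g v)\<^sup>2)"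
    by auto
qed

lemma sq_integrable_lincomb:
  assumes "sq_integrable f" "sq_integrable g"
  shows "sq_integrable (\<lambda>v. a * f v + b * g v)"
proof -
  have "integrable unif (\<lambda>v. a\<^sup>2 * (f v)\<^sup>2 + (2 * a * b) * (f v * g v) + b\<^sup>2 * (g v)\<^sup>2)"
    using assms sq_integrable_mult[OF assms] by (auto simp: sq_integrable_def)
  then have "integrable unif (\<lambda>v. (a * f v + b * g v)\<^sup>2)"
    by (simp add: power2_eq_square algebra_simps)
  then show ?thesis
    using assms by (auto simp: sq_integrable_def)
qed

lemma sq_integrable_diff:
  assumes "sq_integrable f" "sq_integrable g"
  shows "sq_integrable (\<lambda>v. f v - g v)"
  using sq_integrable_lincomb[OF assms, of 1 "-1"] by simp

lemma sq_integrable_const: "sq_integrable (\<lambda>_. c)"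
  by (simp add: sq_integrable_def)

lemma nn_integral_sq:
  assumes "sq_integrable f" shows "(\<integral>\<^sup>+v. ennreal ((f v)\<^sup>2) \<partial>unif) = ennreal (\<integral>v. (f v)\<^sup>2 \<partial>unif)"
  using assms by (intro nn_integral_eq_integral) (auto simp: sq_integrable_def)

lemma sq_integrableI:
  assumes "f \<in> borel_measurable unif" "(\<integral>\<^sup>+v. ennreal ((f v)\<^sup>2) \<partial>unif) < \<infinity>"
  shows "sq_integrable f"
  unfolding sq_integrable_def using assms by (auto intro!: integrableI_nonneg)

lemma integral_sq_lincomb:
  assumes "sq_integrable f" "sq_integrable g"
  shows "(\<integral>v. (a * f v + b * g v)\<^sup>2 \<partial>unif) =
    a\<^sup>2 * (\<integral>v. (f v)\<^sup>2 \<partial>unif) + 2 * a * b * (\<integral>v. f v * g v \<partial>unif) + b\<^sup>2 * (\<integral>v. (g v)\<^sup>2 \<partial>unif)"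
proof -
  have "(\<integral>v. (a * f v + b * g v)\<^sup>2 \<partial>unif) =
      (\<integral>v. a\<^sup>2 * (f v)\<^sup>2 + (2 * a * b) * (f v * g v) + b\<^sup>2 * (g v)\<^sup>2 \<partial>unif)"
    by (intro Bochner_Integration.integral_cong) (auto simp: power2_eq_square algebra_simps)
  then show ?thesis
    using assms sq_integrable_mult[OF assms] by (simp add: sq_integrable_def)
qed

section \<open>From convergence in mean square to pointwise convergence\<close>

lemma AE_unif_dense:
  assumes "AE v in unif. P v" "0 \<le> a" "a < b" "b \<le> 1"
  shows "\<exists>v. a < v \<and> v < b \<and> P v"
proof (rule ccontr)
  assume "\<not> ?thesis"
  with assms(1) have "AE v in unif. v \<notin> {a<..<b}" by (auto elim!: eventually_mono)
  moreover have sub: "{v \<in> space unif. \<not> v \<notin> {a<..<b}} = {a<..<b}"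
    using assms by auto
  moreover have m: "{a<..<b} \<in> sets unif"
    using assms by (auto simp: sets_restrict_space intro!: image_eqI[of _ _ "{a<..<b}"])
  ultimately have "emeasure unif {a<..<b} = 0"
    using AE_iff_measurable[OF m, of "\<lambda>v. v \<notin> {a<..<b}"] sub by blast
  moreover have "emeasure unif {a<..<b} = ennreal (b - a)"
    using assms by (subst emeasure_restrict_space) auto
  ultimately show False using assms by (simp add: ennreal_eq_0_iff)
qed

text \<open>
  Elements of the cone are locally Lipschitz with a constant controlled by two of their values, so
  convergence almost everywhere upgrades to convergence everywhere.
\<close>

lemma lc_quantiles_AE_convergent:
  assumes f: "\<And>k. f k \<in> lc_quantiles" and AE: "AE v in unif. convergent (\<lambda>k. f k v)"
    and v: "0 < v" "v < 1"
  shows "convergent (\<lambda>k. f k v)"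
proof -
  obtain a where a: "0 < a" "a < v" "convergent (\<lambda>k. f k a)"
    using AE_unif_dense[OF AE, of 0 v] v by auto
  obtain c where c: "v < c" "c < 1" "convergent (\<lambda>k. f k c)"
    using AE_unif_dense[OF AE, of v 1] v by auto
  have "convergent (\<lambda>k. f k c - f k a)" by (intro convergent_diff a c)
  then obtain M where M: "\<And>k. \<bar>f k c - f k a\<bar> \<le> M" and M0: "0 < M"
    using Bseq_def[of "\<lambda>k. f k c - f k a"] convergent_imp_Bseq by auto
  define m where "m = (v + c) / 2"
  \<comment> \<open>A Lipschitz constant at \<open>v\<close> valid for all indices: \<open>M\<close>
    bounds the increments over \<open>[a, c]\<close>, and the midpoint \<open>m\<close> keeps
    \<open>c - w\<close> away from 0 for \<open>w \<le> m\<close>.\<close>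
  define L where "L = (c - a) * M / ((v - a) * (c - m))"
  have m: "v < m" "m < c" using c by (auto simp: m_def)
  have L0: "0 < L" using a c m M0 by (auto simp: L_def)
  have lip: "\<bar>f k w - f k v\<bar> \<le> (w - v) * L" if "v \<le> w" "w \<le> m" for w k
  proof -
    have "\<bar>f k w - f k v\<bar> \<le> (w - v) * ((c - a) * (f k c - f k a) / ((v - a) * (c - w)))"
      using that a c m by (intro lc_quantiles_lipschitz f) auto
    also have "\<dots> \<le> (w - v) * L"
      unfolding L_def using that a c m M[of k] M0
      by (intro mult_left_mono frac_le mult_nonneg_nonneg mult_pos_pos) auto
    finally show ?thesis .
  qed
  have "Cauchy (\<lambda>k. f k v)"
  proof (rule CauchyI)
    fix e :: real assume e: "0 < e"
    have "v < min m (v + e / (4 * L))" using m e L0 by auto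
    moreover have b1: "min m (v + e / (4 * L)) \<le> 1" using m c by linarith
    \<comment> \<open>A point of convergence so close to \<open>v\<close> that the passage between
      \<open>v\<close> and \<open>w\<close> costs less than \<open>e / 4\<close> for each of the two
      indices compared.\<close>
    ultimately obtain w where w: "v < w" "w < m" "w < v + e / (4 * L)" "convergent (\<lambda>k. f k w)"
      using AE_unif_dense[OF AE, of v "min m (v + e / (4 * L))"] v c m by auto
    have wL: "(w - v) * L < e / 4"
      using w L0 by (simp add: field_simps)
    obtain N where N: "\<And>i j. i \<ge> N \<Longrightarrow> j \<ge> N \<Longrightarrow> norm (f i w - f j w) < e / 4"
      using CauchyD[OF convergent_Cauchy[OF w(4)], of "e / 4"] e by auto
    have "norm (f i v - f j v) < e" if "i \<ge> N" "j \<ge> N" for i j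
      using N[OF that] lip[of w i] lip[of w j] w wL by (auto simp: abs_if split: if_splits)
    then show "\<exists>N. \<forall>i\<ge>N. \<forall>j\<ge>N. norm (f i v - f j v) < e" by blast
  qed
  then show ?thesis by (rule Cauchy_convergent)
qed

text \<open>Multiplying the squared increments by \<open>2^k\<close> keeps their integrals summable,
  with bound \<open>B * (1/4)^k\<close>, so the weighted squares are summable almost everywhere. An
  increment \<open>d\<close> is at most \<open>2^k * d\<^sup>2 + (1/2)^k\<close> in absolute value,
  and the telescoping series converges absolutely.\<close>

lemma fast_L2_Cauchy_AE_convergent:
  assumes f: "\<And>k. sq_integrable (f k)"
    and le: "\<And>k. (\<integral>v. (f (Suc k) v - f k v)\<^sup>2 \<partial>unif) \<le> B * (1/8)^k"
  shows "AE v in unif. convergent (\<lambda>k. f k v)"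
proof -
  note [measurable] = sq_integrable_measurable[OF f]
  let ?d = "\<lambda>k v. f (Suc k) v - f k v"
  have B: "0 \<le> B"
    using order_trans[OF _ le[of 0], of 0] by simp
  have "(\<integral>\<^sup>+v. (\<Sum>k. ennreal (2^k * (?d k v)\<^sup>2)) \<partial>unif) = (\<Sum>k. \<integral>\<^sup>+v. ennreal (2^k * (?d k v)\<^sup>2) \<partial>unif)"
    by (rule nn_integral_suminf) measurable
  also have "\<dots> \<le> (\<Sum>k. ennreal (B * (1/4)^k))"
  proof (rule suminf_le)
    fix k
    have "(\<integral>\<^sup>+v. ennreal (2^k * (?d k v)\<^sup>2) \<partial>unif) = ennreal (2^k) * (\<integral>\<^sup>+v. ennreal ((?d k v)\<^sup>2) \<partial>unif)"
      by (simp add: ennreal_mult nn_integral_cmult)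
    also have "\<dots> = ennreal (2^k * (\<integral>v. (?d k v)\<^sup>2 \<partial>unif))"
      by (subst nn_integral_sq) (auto intro!: sq_integrable_diff f simp: ennreal_mult)
    also have "\<dots> \<le> ennreal (B * (1/4)^k)"
    proof (rule ennreal_leI)
      have "2^k * (\<integral>v. (?d k v)\<^sup>2 \<partial>unif) \<le> 2^k * (B * (1/8)^k)"
        by (intro mult_left_mono le) auto
      also have "\<dots> = B * (2 * (1/8))^k" by (simp only: power_mult_distrib mult_ac)
      finally show "2^k * (\<integral>v. (?d k v)\<^sup>2 \<partial>unif) \<le> B * (1/4)^k" by simp
    qed
    finally show "(\<integral>\<^sup>+v. ennreal (2^k * (?d k v)\<^sup>2) \<partial>unif) \<le> ennreal (B * (1/4)^k)" .
  qed auto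
  also have "\<dots> < \<infinity>"
    using B by (subst suminf_ennreal2) (auto intro!: summable_mult summable_geometric)
  finally have "AE v in unif. (\<Sum>k. ennreal (2^k * (?d k v)\<^sup>2)) \<noteq> \<infinity>"
    by (intro nn_integral_PInf_AE) auto
  then show ?thesis
  proof eventually_elim
    case (elim v)
    then have "summable (\<lambda>k. 2^k * (?d k v)\<^sup>2)"
      by (intro summable_suminf_not_top) auto
    then have "summable (\<lambda>k. 2^k * (?d k v)\<^sup>2 + (1/2)^k)"
      by (intro summable_add summable_geometric) auto
    then have "summable (\<lambda>k. ?d k v)"
    proof (rule summable_comparison_test'[where N=0])
      fix k :: nat
      let ?x = "?d k v"
      have "0 \<le> (2^k * \<bar>?x\<bar> - 1)\<^sup>2 + 2^k * \<bar>?x\<bar>" by simp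
      then have "2^k * \<bar>?x\<bar> \<le> 2^k * (2^k * ?x\<^sup>2 + (1/2)^k)"
        by (simp add: power2_eq_square algebra_simps power_one_over)
      then show "norm ?x \<le> 2^k * ?x\<^sup>2 + (1/2)^k" by simp
    qed
    then have "(\<lambda>n. (\<Sum>k<n. ?d k v)) \<longlonglongrightarrow> suminf (\<lambda>k. ?d k v)" by (rule summable_LIMSEQ)
    then have "(\<lambda>n. f n v - f 0 v) \<longlonglongrightarrow> suminf (\<lambda>k. ?d k v)"
      unfolding sum_lessThan_telescope[of "\<lambda>k. f k v"] .
    from tendsto_add[OF this tendsto_const[of "f 0 v"]]
    show ?case by (auto simp: convergent_def)
  qed
qed

section \<open>Existence and nonexpansiveness of the projection\<close>

definition is_lc_projection :: "(real \<Rightarrow> real) \<Rightarrow> (real \<Rightarrow> real) \<Rightarrow> bool" where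
  "is_lc_projection p q \<longleftrightarrow> q \<in> lc_quantiles \<and> (\<forall>r\<in>lc_quantiles. nn_sq_dist q p \<le> nn_sq_dist r p)"

lemma is_lc_projectionD:
  assumes "is_lc_projection p q"
  shows "q \<in> lc_quantiles" and "r \<in> lc_quantiles \<Longrightarrow> nn_sq_dist q p \<le> nn_sq_dist r p"
  using assms by (auto simp: is_lc_projection_def)

lemma is_lc_projection_self: "q \<in> lc_quantiles \<Longrightarrow> is_lc_projection q q"
  by (simp add: is_lc_projection_def)

text \<open>Midpoints of a minimizing sequence stay in the convex cone, so the parallelogram
  identity makes the sequence Cauchy in mean square. The cone contains the pointwise limit, and
  Fatou's lemma carries the minimal value over to it.\<close>

lemma lc_projection_exists:
  assumes p: "sq_integrable p"
  obtains q where "is_lc_projection p q"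
proof -
  note pm[measurable] = sq_integrable_measurable[OF p]
  define S where "S = {q\<in>lc_quantiles. sq_integrable q}"
  define D where "D q = sq_dist q p" for q
  define d where "d = Inf (D ` S)"
  have S0: "(\<lambda>_. 0) \<in> S" by (simp add: S_def lc_quantiles_const sq_integrable_const)
  have bdd: "bdd_below (D ` S)" by (auto intro!: bdd_belowI[of _ 0] simp: D_def)
  have dle: "d \<le> D q" if "q \<in> S" for q
    unfolding d_def using that by (intro cInf_lower bdd) auto
  \<comment> \<open>The rate is the one that \<open>fast_L2_Cauchy_AE_convergent\<close> asks for;
    the parallelogram identity costs a factor 4.\<close>
  have "\<exists>q\<in>S. D q < d + (1/8)^k" for k :: nat
    using cInf_lessD[of "D ` S" "d + (1/8)^k"] S0 unfolding d_def by fastforce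
  then obtain f where f: "\<And>k. f k \<in> S" "\<And>k. D (f k) < d + (1/8)^k" by metis
  have fK: "f k \<in> lc_quantiles" and fS: "sq_integrable (f k)" for k
    using f(1) by (auto simp: S_def)
  note [measurable] = sq_integrable_measurable[OF fS]
  have "AE v in unif. convergent (\<lambda>k. f k v)"
  proof (rule fast_L2_Cauchy_AE_convergent[OF fS, where B=4])
    fix k
    let ?m = "\<lambda>v. (1 - 1/2) * f k v + 1/2 * f (Suc k) v"
    have "?m \<in> S"
      using lc_quantiles_convex_comb[OF fK[of k] fK[of "Suc k"], of "1/2"] sq_integrable_lincomb[OF fS[of k] fS[of "Suc k"], of "1 - 1/2" "1/2"]
      by (simp add: S_def)
    from dle[OF this] have 1: "d \<le> D ?m" .
    have s: "sq_integrable (\<lambda>v. f j v - p v)" for j by (intro sq_integrable_diff fS p)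
    let ?c = "\<integral>v. (f (Suc k) v - p v) * (f k v - p v) \<partial>unif"
    have "D ?m = (\<integral>v. (1/2 * (f (Suc k) v - p v) + 1/2 * (f k v - p v))\<^sup>2 \<partial>unif)"
      unfolding D_def
    proof (intro Bochner_Integration.integral_cong refl)
      fix v
      have "?m v - p v = 1/2 * (f (Suc k) v - p v) + 1/2 * (f k v - p v)" by (simp add: field_simps)
      then show "(?m v - p v)\<^sup>2 = (1/2 * (f (Suc k) v - p v) + 1/2 * (f k v - p v))\<^sup>2" by simp
    qed
    also have "\<dots> = D (f (Suc k)) / 4 + ?c / 2 + D (f k) / 4"
      by (subst integral_sq_lincomb[OF s s]) (simp add: D_def power2_eq_square)
    finally have 2: "D ?m = D (f (Suc k)) / 4 + ?c / 2 + D (f k) / 4" .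
    have "(\<integral>v. (f (Suc k) v - f k v)\<^sup>2 \<partial>unif) = (\<integral>v. (1 * (f (Suc k) v - p v) + (-1) * (f k v - p v))\<^sup>2 \<partial>unif)"
      by simp
    also have "\<dots> = D (f (Suc k)) - 2 * ?c + D (f k)"
      by (subst integral_sq_lincomb[OF s s]) (simp add: D_def)
    finally have 3: "(\<integral>v. (f (Suc k) v - f k v)\<^sup>2 \<partial>unif) = D (f (Suc k)) - 2 * ?c + D (f k)" .
    have "(1/8::real)^Suc k \<le> (1/8)^k" by simp
    then show "(\<integral>v. (f (Suc k) v - f k v)\<^sup>2 \<partial>unif) \<le> 4 * (1/8)^k"
      using 1 2 3 f(2)[of k] f(2)[of "Suc k"] by linarith
  qed
  then have conv: "convergent (\<lambda>k. f k v)" if "0 < v" "v < 1" for v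
    using lc_quantiles_AE_convergent[where f=f, OF fK _ that] \<open>AE v in unif. convergent (\<lambda>k. f k v)\<close> by blast
  define q where "q v = lim (\<lambda>k. f k v)" for v
  have lim: "(\<lambda>k. f k v) \<longlonglongrightarrow> q v" if "0 < v" "v < 1" for v
    using conv[OF that] by (simp add: q_def convergent_LIMSEQ_iff)
  have qK: "q \<in> lc_quantiles" by (rule lc_quantiles_lim[OF fK lim])
  have qm[measurable]: "q \<in> borel_measurable unif"
    by (intro mono_on_measurable_unif lc_quantiles_mono_on qK)
  have "nn_sq_dist q p = (\<integral>\<^sup>+v. liminf (\<lambda>k. ennreal ((f k v - p v)\<^sup>2)) \<partial>unif)"
    by (intro nn_integral_cong lim_imp_Liminf[symmetric]) (auto intro!: tendsto_intros lim)
  also have "\<dots> \<le> liminf (\<lambda>k. \<integral>\<^sup>+v. ennreal ((f k v - p v)\<^sup>2) \<partial>unif)"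
    by (intro nn_integral_liminf) measurable
  also have "\<dots> = liminf (\<lambda>k. ennreal (D (f k)))"
    by (simp add: nn_integral_sq sq_integrable_diff fS p D_def)
  also have "\<dots> = ennreal d"
  proof (rule lim_imp_Liminf)
    have "(\<lambda>k. D (f k)) \<longlonglongrightarrow> d"
    proof (rule tendsto_sandwich[OF _ _ tendsto_const])
      show "\<forall>\<^sub>F k in sequentially. d \<le> D (f k)" using dle f(1) by auto
      show "\<forall>\<^sub>F k in sequentially. D (f k) \<le> d + (1/8)^k" by (intro always_eventually allI less_imp_le f(2))
      have "(\<lambda>k. d + (1/8)^k) \<longlonglongrightarrow> d + 0"
        by (intro tendsto_add tendsto_const LIMSEQ_realpow_zero) auto
      then show "(\<lambda>k. d + (1/8)^k) \<longlonglongrightarrow> d" by simp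
    qed
    then show "(\<lambda>k. ennreal (D (f k))) \<longlonglongrightarrow> ennreal d" by (rule tendsto_ennrealI)
  qed simp
  finally have qd: "nn_sq_dist q p \<le> ennreal d" .
  have undo: "sq_integrable r" if "r \<in> borel_measurable unif" "nn_sq_dist r p < \<infinity>" for r
  proof -
    have "sq_integrable (\<lambda>v. r v - p v)" using that by (intro sq_integrableI) auto
    from sq_integrable_lincomb[OF this p, of 1 1] show ?thesis by simp
  qed
  have "nn_sq_dist q p \<le> nn_sq_dist r p"
    if r: "r \<in> lc_quantiles" for r
  proof (cases "nn_sq_dist r p < \<infinity>")
    case True
    then have "sq_integrable r"
      by (intro undo mono_on_measurable_unif lc_quantiles_mono_on r)
    then have "ennreal d \<le> nn_sq_dist r p"
      using dle[of r] r by (auto simp: nn_integral_sq sq_integrable_diff p S_def D_def intro: ennreal_leI)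
    with qd show ?thesis by (rule order_trans)
  qed (simp add: less_top[symmetric])
  then show ?thesis using qK that unfolding is_lc_projection_def by blast
qed

text \<open>First-order optimality: moving from \<open>q\<close> a fraction \<open>e\<close> towards
  \<open>r\<close> stays in the cone, and a negative inner product would decrease the distance to
  \<open>p\<close> for small \<open>e\<close>.\<close>

lemma lc_projection_variational:
  assumes q: "is_lc_projection p q" "sq_integrable q" and r: "r \<in> lc_quantiles" "sq_integrable r"
    and p: "sq_integrable p"
  shows "0 \<le> (\<integral>v. (q v - p v) * (r v - q v) \<partial>unif)" (is "0 \<le> ?A")
proof (rule ccontr)
  assume neg: "\<not> 0 \<le> ?A"
  let ?B = "\<integral>v. (r v - q v)\<^sup>2 \<partial>unif"
  have B: "0 \<le> ?B" by simp
  \<comment> \<open>For this step size the second-order term \<open>e * ?B\<close> is at most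
    \<open>- ?A\<close>, too small to outweigh \<open>2 * ?A\<close>; the summand 1 covers
    \<open>?B = 0\<close>.\<close>
  define e where "e = min 1 (- ?A / (?B + 1))"
  have "0 < - ?A / (?B + 1)" using neg B by (intro divide_pos_pos) linarith+
  then have e: "0 < e" "e \<le> 1" by (auto simp: e_def)
  have s: "sq_integrable (\<lambda>v. q v - p v)" "sq_integrable (\<lambda>v. r v - q v)"
    by (intro sq_integrable_diff q(2) r(2) p)+
  let ?m = "\<lambda>v. (1 - e) * q v + e * r v"
  have m: "?m \<in> lc_quantiles" "sq_integrable ?m"
    using e by (auto intro!: lc_quantiles_convex_comb sq_integrable_lincomb is_lc_projectionD(1)[OF q(1)] q(2) r)
  have "sq_dist q p \<le> (\<integral>v. (?m v - p v)\<^sup>2 \<partial>unif)"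
    using is_lc_projectionD(2)[OF q(1) m(1)] by (simp add: nn_integral_sq s(1) sq_integrable_diff[OF m(2) p])
  also have "\<dots> = (\<integral>v. (1 * (q v - p v) + e * (r v - q v))\<^sup>2 \<partial>unif)"
    by (intro Bochner_Integration.integral_cong) (auto simp: algebra_simps)
  also have "\<dots> = sq_dist q p + 2 * e * ?A + e\<^sup>2 * ?B"
    by (subst integral_sq_lincomb[OF s]) simp
  finally have "0 \<le> e * (2 * ?A + e * ?B)" by (simp add: power2_eq_square algebra_simps)
  then have "0 \<le> 2 * ?A + e * ?B" using e by (simp add: zero_le_mult_iff)
  moreover have "e * ?B \<le> - ?A / (?B + 1) * (?B + 1)"
    using e B by (intro mult_mono) (auto simp: e_def)
  ultimately show False using neg B by simp
qed

text \<open>Each projection is a competitor in the variational inequality of the other. The sum of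
  the two inequalities bounds the squared distance of \<open>q\<close> and \<open>r\<close> by the
  inner product of \<open>p - s\<close> and \<open>q - r\<close>; expanding the square of the
  difference of these two finishes.\<close>

lemma lc_projection_nonexpansive:
  assumes q: "is_lc_projection p q" "sq_integrable q" and r: "is_lc_projection s r" "sq_integrable r"
    and p: "sq_integrable p" and s: "sq_integrable s"
  shows "sq_dist q r \<le> sq_dist p s"
proof -
  have d: "sq_integrable (\<lambda>v. q v - p v)" "sq_integrable (\<lambda>v. r v - q v)" "sq_integrable (\<lambda>v. q v - r v)"
    "sq_integrable (\<lambda>v. r v - s v)" "sq_integrable (\<lambda>v. p v - s v)"
    by (intro sq_integrable_diff q(2) r(2) p s)+
  have "0 \<le> (\<integral>v. (q v - p v) * (r v - q v) \<partial>unif) + (\<integral>v. (r v - s v) * (q v - r v) \<partial>unif)"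
    using lc_projection_variational[OF q is_lc_projectionD(1)[OF r(1)] r(2) p]
      lc_projection_variational[OF r is_lc_projectionD(1)[OF q(1)] q(2) s] by simp
  also have "\<dots> = (\<integral>v. (p v - s v) * (q v - r v) - (q v - r v)\<^sup>2 \<partial>unif)"
    by (subst Bochner_Integration.integral_add[OF sq_integrable_mult[OF d(1,2)] sq_integrable_mult[OF d(4,3)], symmetric])
      (auto intro!: Bochner_Integration.integral_cong simp: power2_eq_square algebra_simps)
  also have "\<dots> = (\<integral>v. (p v - s v) * (q v - r v) \<partial>unif) - sq_dist q r"
    using d sq_integrable_mult[OF d(5,3)] by (simp add: sq_integrable_def)
  finally have 1: "sq_dist q r \<le> (\<integral>v. (p v - s v) * (q v - r v) \<partial>unif)" by simp
  have "0 \<le> (\<integral>v. (1 * (p v - s v) + (-1) * (q v - r v))\<^sup>2 \<partial>unif)" by simp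
  also have "\<dots> = sq_dist p s - 2 * (\<integral>v. (p v - s v) * (q v - r v) \<partial>unif) + sq_dist q r"
    by (subst integral_sq_lincomb[OF d(5,3)]) simp
  finally show ?thesis using 1 by linarith
qed

section \<open>Tangents of densities and of density quantile functions\<close>

text \<open>
  If \<open>F' = f\<close>, then \<open>ln f\<close> lies below the line of slope \<open>b\<close> through \<open>(z, ln (f z))\<close> iff \<open>f\<close>, as a
  function of \<open>F\<close>, lies below the line of slope \<open>b\<close> through \<open>(F z, f z)\<close>.  The next two lemmas are
  the two directions to the right of \<open>z\<close>, under a monotonicity condition that concavity provides.
\<close>

lemma diff_le_if_exp_scaled_antimono:
  fixes f F :: "real \<Rightarrow> real"
  assumes "z \<le> y" and F: "\<And>x. z \<le> x \<Longrightarrow> x \<le> y \<Longrightarrow> (F has_real_derivative f x) (at x)"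
    and anti: "\<And>w x. z \<le> w \<Longrightarrow> w \<le> x \<Longrightarrow> x \<le> y \<Longrightarrow> f x * exp (- b * x) \<le> f w * exp (- b * w)"
  shows "f y - f z \<le> b * (F y - F z)"
proof -
  \<comment> \<open>The minimum over \<open>[z, y]\<close> of the decreasing function
    \<open>f x * exp (- b * x)\<close> if \<open>b \<ge> 0\<close>, its maximum otherwise; so
    \<open>b\<close> times the difference of that function and \<open>c\<close> is nonnegative. This
    compares \<open>f\<close> with an exponential of rate \<open>b\<close>, whose increments are
    known.\<close>
  define c where "c = (if 0 \<le> b then f y * exp (- b * y) else f z * exp (- b * z))"
  have ex: "f x * exp (- b * x) * exp (b * x) = f x" for x
    by (simp add: mult.assoc flip: exp_add)
  have "b * F z - c * exp (b * z) \<le> b * F y - c * exp (b * y)"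
  proof (rule DERIV_nonneg_imp_nondecreasing[of z y "\<lambda>x. b * F x - c * exp (b * x)"])
    fix x assume x: "z \<le> x" "x \<le> y"
    have "b * (f x * exp (- b * x) - c) \<ge> 0"
      using anti[of z x] anti[of x y] x by (auto simp: c_def zero_le_mult_iff)
    then have "0 \<le> b * (f x * exp (- b * x) - c) * exp (b * x)" by simp
    also have "\<dots> = b * (f x * exp (- b * x) * exp (b * x)) - c * (exp (b * x) * b)"
      by (simp only: left_diff_distrib right_diff_distrib mult_ac)
    finally have "0 \<le> b * f x - c * (exp (b * x) * b)" by (simp only: ex)
    moreover have "((\<lambda>x. b * F x - c * exp (b * x)) has_real_derivative b * f x - c * (exp (b * x) * b)) (at x)"
      using F[OF x] by (auto intro!: derivative_eq_intros)
    ultimately show "\<exists>d. ((\<lambda>x. b * F x - c * exp (b * x)) has_real_derivative d) (at x) \<and> 0 \<le> d" by blast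
  qed fact
  moreover have "f y - f z \<le> c * exp (b * y) - c * exp (b * z)"
  proof (cases "0 \<le> b")
    case True
    have "f y * exp (- b * y) * exp (b * z) \<le> f z * exp (- b * z) * exp (b * z)"
      using anti[of z y] assms(1) by (intro mult_right_mono) auto
    moreover have c: "c = f y * exp (- b * y)" using True by (simp add: c_def)
    ultimately show ?thesis unfolding c ex by linarith
  next
    case False
    have "f y * exp (- b * y) * exp (b * y) \<le> f z * exp (- b * z) * exp (b * y)"
      using anti[of z y] assms(1) by (intro mult_right_mono) auto
    moreover have c: "c = f z * exp (- b * z)" using False by (simp add: c_def)
    ultimately show ?thesis unfolding c ex by linarith
  qed
  ultimately show ?thesis by (simp add: algebra_simps)
qed

lemma le_exp_if_diff_antimono:
  fixes f F :: "real \<Rightarrow> real"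
  assumes "z \<le> y" and F: "\<And>x. z \<le> x \<Longrightarrow> x \<le> y \<Longrightarrow> (F has_real_derivative f x) (at x)"
    and anti: "\<And>w x. z \<le> w \<Longrightarrow> w \<le> x \<Longrightarrow> x \<le> y \<Longrightarrow> f x - b * F x \<le> f w - b * F w"
  shows "f y \<le> f z * exp (b * (y - z))"
proof -
  \<comment> \<open>\<open>f\<close> without its part that is linear in \<open>F\<close>, normalized
    by \<open>G z = f z\<close>; the hypothesis says that it decreases.\<close>
  define G where "G x = f x - b * (F x - F z)" for x
  have G: "G x \<le> G w" if "z \<le> w" "w \<le> x" "x \<le> y" for w x
    using anti[OF that] by (simp add: G_def algebra_simps)
  \<comment> \<open>The maximum of \<open>G\<close> for \<open>b \<ge> 0\<close> and its minimum
    otherwise. With the integrating factor \<open>exp (- b * x)\<close> the derivative of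
    \<open>?k\<close> is \<open>b * (G x - c) * exp (- b * x)\<close>, which is then
    nonpositive.\<close>
  define c where "c = (if 0 \<le> b then G z else G y)"
  let ?k = "\<lambda>x. b * ((F x - F z) * exp (- b * x)) + c * exp (- b * x)"
  have "?k y \<le> ?k z"
  proof (rule DERIV_nonpos_imp_nonincreasing[of z y ?k])
    fix x assume x: "z \<le> x" "x \<le> y"
    have "b * (G x - c) \<le> 0"
      using G[of z x] G[of x y] x by (auto simp: c_def mult_le_0_iff)
    then have "b * (G x - c) * exp (- b * x) \<le> 0" by (simp add: mult_le_0_iff)
    moreover have "(?k has_real_derivative b * (G x - c) * exp (- b * x)) (at x)"
      using F[OF x] by (auto intro!: derivative_eq_intros simp: G_def algebra_simps)
    ultimately show "\<exists>d. (?k has_real_derivative d) (at x) \<and> d \<le> 0" by blast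
  qed fact
  then have 1: "b * ((F y - F z) * exp (- b * y)) + c * exp (- b * y) \<le> c * exp (- b * z)" by simp
  have "f y * exp (- b * y) = G y * exp (- b * y) + b * ((F y - F z) * exp (- b * y))"
    by (simp add: G_def algebra_simps)
  also have "\<dots> \<le> f z * exp (- b * z)"
  proof (cases "0 \<le> b")
    case True
    have "G y * exp (- b * y) \<le> G z * exp (- b * y)"
      using G[of z y] assms(1) by (intro mult_right_mono) auto
    moreover have c: "c = f z" and Gz: "G z = f z" using True by (simp_all add: c_def G_def)
    ultimately show ?thesis using 1 unfolding c Gz by linarith
  next
    case False
    have "G y * exp (- b * z) \<le> G z * exp (- b * z)"
      using G[of z y] assms(1) by (intro mult_right_mono) auto
    moreover have c: "c = G y" and Gz: "G z = f z" using False by (simp_all add: c_def G_def)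
    ultimately show ?thesis using 1 unfolding c Gz by linarith
  qed
  finally have "f y * exp (- b * y) * exp (b * y) \<le> f z * exp (- b * z) * exp (b * y)"
    by (intro mult_right_mono) auto
  then show ?thesis by (simp add: mult.assoc algebra_simps flip: exp_add)
qed

text \<open>To be applied to a concave function minus its tangent line at \<open>z\<close>: this is
  maximal at \<open>z\<close> and decreases to the right, which is the monotonicity that the two
  comparison lemmas ask for.\<close>

lemma concave_on_antimono_right_of_max:
  fixes g :: "real \<Rightarrow> real"
  assumes g: "concave_on S g" and S: "z \<in> S" "y \<in> S" and max: "g y \<le> g z" and w: "z \<le> w" "w \<le> y"
  shows "g y \<le> g w"
proof (cases "z = y")
  case False
  define t where "t = (w - z) / (y - z)"
  have t: "0 \<le> t" "t \<le> 1" using w False by (auto simp: t_def field_simps)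
  have "t * (y - z) = w - z" using False by (simp add: t_def)
  then have tw: "(1 - t) *\<^sub>R z + t *\<^sub>R y = w" by (simp add: algebra_simps)
  have "g y \<le> (1 - t) * g z + t * g y"
    using mult_left_mono[OF max, of "1 - t"] t by (simp add: algebra_simps)
  also have "\<dots> \<le> g w"
    using concave_onD[OF g t S] tw by simp
  finally show ?thesis .
qed (use w in auto)

lemma concave_on_supergradient:
  fixes g :: "real \<Rightarrow> real"
  assumes "concave_on S g" "open S" "z \<in> S"
  shows "\<exists>b. \<forall>y\<in>S. g y \<le> g z + b * (y - z)"
proof -
  have "convex_on S (\<lambda>x. - g x)" using assms(1) by (simp add: concave_on_def)
  from convex_le_Inf_differential[OF this, of z] assms(2,3) show ?thesis
    by (intro exI[of _ "- Inf ((\<lambda>t. (- g z - - g t) / (z - t)) ` ({z<..} \<inter> S))"])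
      (fastforce simp: interior_open algebra_simps)
qed

text \<open>The converse of \<open>concave_on_supergradient\<close>. Existence of supergradients is
  the form in which concavity passes between \<open>ln f\<close> and \<open>I\<close>, with the same
  slope on both sides.\<close>

lemma concave_on_if_supergradients:
  fixes g :: "real \<Rightarrow> real"
  assumes "convex S" "\<And>z. z \<in> S \<Longrightarrow> \<exists>b. \<forall>y\<in>S. g y \<le> g z + b * (y - z)"
  shows "concave_on S g"
proof -
  obtain b where "\<And>y z. y \<in> S \<Longrightarrow> z \<in> S \<Longrightarrow> g y \<le> g z + b z * (y - z)"
    using assms(2) by metis
  then show ?thesis
    unfolding concave_on_def by (intro pos_convex_function[where f' = "\<lambda>z. - b z"] assms(1)) (auto simp: algebra_simps)
qed

lemma reflect_convex: "convex (uminus ` S)" if "convex (S :: real set)"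
  using convex_linear_image[OF _ that, of uminus] by (simp add: linear_uminus)

text \<open>Reflection reduces points left of \<open>z\<close> to points right of it; negating
  \<open>F\<close> as well as its argument keeps it an antiderivative of the reflected
  density.\<close>

lemma reflect_DERIV:
  fixes F :: "real \<Rightarrow> real"
  assumes "(F has_real_derivative f (- x)) (at (- x))"
  shows "((\<lambda>x. - F (- x)) has_real_derivative f (- x)) (at x)"
proof -
  have "((\<lambda>x. F (- x)) has_real_derivative f (- x) * (- 1)) (at x)"
    by (rule DERIV_chain2[of F "f (- x)" uminus x "- 1" UNIV]) (auto intro!: derivative_eq_intros assms)
  from DERIV_minus[OF this] show ?thesis by simp
qed

text \<open>Minus the line of slope \<open>b\<close>, \<open>ln f\<close> is concave with maximum at
  \<open>z\<close>, so \<open>f x * exp (- b * x)\<close> decreases to the right of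
  \<open>z\<close>. On the left the reflected functions are used with slope
  \<open>- b\<close>.\<close>

lemma density_tangent:
  fixes f F :: "real \<Rightarrow> real"
  assumes J: "convex J" and F: "\<And>x. x \<in> J \<Longrightarrow> (F has_real_derivative f x) (at x)"
    and pos: "\<And>x. x \<in> J \<Longrightarrow> 0 < f x" and conc: "concave_on J (\<lambda>x. ln (f x))"
    and z: "z \<in> J" and tan: "\<And>y. y \<in> J \<Longrightarrow> ln (f y) \<le> ln (f z) + b * (y - z)" and y: "y \<in> J"
  shows "f y \<le> f z + b * (F y - F z)"
proof -
  have lin: "concave_on J (\<lambda>x. ln (f x) - b * x)"
    by (intro concave_on_diff conc) (auto intro!: convex_onI J simp: algebra_simps)
  have e: "f x * exp (- b * x) = exp (ln (f x) - b * x)" if "x \<in> J" for x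
    using pos[OF that] by (simp add: exp_diff exp_minus divide_inverse)
  show ?thesis
  proof (cases "z \<le> y")
    case True
    have sub: "x \<in> J" if "z \<le> x" "x \<le> y" for x
      using mem_is_interval_1_I[of J z y x] J z y that by (simp add: is_interval_convex_1)
    have "f y - f z \<le> b * (F y - F z)"
    proof (rule diff_le_if_exp_scaled_antimono[OF True])
      fix w x assume wx: "z \<le> w" "w \<le> x" "x \<le> y"
      then have J': "w \<in> J" "x \<in> J" using sub by auto
      have "ln (f x) - b * x \<le> ln (f w) - b * w"
        using concave_on_antimono_right_of_max[OF lin z J'(2) _ wx(1,2)] tan[OF J'(2)] by (simp add: algebra_simps)
      then show "f x * exp (- b * x) \<le> f w * exp (- b * w)"
        unfolding e[OF J'(1)] e[OF J'(2)] by simp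
    qed (use F sub in auto)
    then show ?thesis by simp
  next
    case False
    have sub: "x \<in> J" if "y \<le> x" "x \<le> z" for x
      using mem_is_interval_1_I[of J y z x] J z y that by (simp add: is_interval_convex_1)
    have lin': "concave_on (uminus ` J) (\<lambda>x. ln (f (- x)) - b * (- x))"
      using concave_onD[OF lin] reflect_convex[OF J]
      unfolding concave_on_def by (intro convex_onI) (force simp: algebra_simps)+
    have "f (- (- y)) - f (- (- z)) \<le> (- b) * ((- F (- (- y))) - (- F (- (- z))))"
    proof (rule diff_le_if_exp_scaled_antimono[where f="\<lambda>x. f (- x)" and F="\<lambda>x. - F (- x)"])
      fix w x assume wx: "- z \<le> w" "w \<le> x" "x \<le> - y"
      then have J': "- w \<in> J" "- x \<in> J" using sub by auto
      then have J'': "x \<in> uminus ` J" "- z \<in> uminus ` J" using z by (force simp: image_iff)+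
      have "ln (f (- x)) - b * (- x) \<le> ln (f (- w)) - b * (- w)"
        using concave_on_antimono_right_of_max[OF lin' J''(2,1) _ wx(1,2)] tan[OF J'(2)] by (simp add: algebra_simps)
      then show "f (- x) * exp (- (- b) * x) \<le> f (- w) * exp (- (- b) * w)"
        using e[OF J'(1)] e[OF J'(2)] by simp
    qed (use False sub F in \<open>auto intro!: reflect_DERIV\<close>)
    then show ?thesis by (simp add: algebra_simps)
  qed
qed

text \<open>\<open>I p - b * p\<close> is concave with maximum at \<open>F z\<close>, and the
  monotone \<open>F\<close> carries its decrease over to \<open>f - b * F\<close> on the right of
  \<open>z\<close>; reflection treats the left. The resulting bound on \<open>f\<close> is
  exponential, hence linear for \<open>ln f\<close>.\<close>

lemma log_density_tangent:
  fixes f F I :: "real \<Rightarrow> real"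
  assumes J: "convex J" and F: "\<And>x. x \<in> J \<Longrightarrow> (F has_real_derivative f x) (at x)"
    and pos: "\<And>x. x \<in> J \<Longrightarrow> 0 < f x" and conc: "concave_on S I"
    and FS: "\<And>x. x \<in> J \<Longrightarrow> F x \<in> S" and fI: "\<And>x. x \<in> J \<Longrightarrow> f x = I (F x)"
    and z: "z \<in> J" and tan: "\<And>p. p \<in> S \<Longrightarrow> I p \<le> I (F z) + b * (p - F z)" and y: "y \<in> J"
  shows "ln (f y) \<le> ln (f z) + b * (y - z)"
proof -
  have lin: "concave_on S (\<lambda>p. I p - b * p)"
    by (intro concave_on_diff conc) (auto intro!: convex_onI concave_on_imp_convex[OF conc] simp: algebra_simps)
  have S: "convex S" using concave_on_imp_convex[OF conc] .
  have mono: "F w \<le> F x" if "w \<in> J" "x \<in> J" "w \<le> x" for w x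
  proof (rule DERIV_nonneg_imp_nondecreasing[OF that(3)])
    fix u assume "w \<le> u" "u \<le> x"
    then have "u \<in> J" using mem_is_interval_1_I[of J w x u] J that by (simp add: is_interval_convex_1)
    then show "\<exists>d. (F has_real_derivative d) (at u) \<and> 0 \<le> d" using F pos by (meson less_imp_le)
  qed
  have "f y \<le> f z * exp (b * (y - z))"
  proof (cases "z \<le> y")
    case True
    have sub: "x \<in> J" if "z \<le> x" "x \<le> y" for x
      using mem_is_interval_1_I[of J z y x] J z y that by (simp add: is_interval_convex_1)
    show ?thesis
    proof (rule le_exp_if_diff_antimono[OF True])
      fix w x assume wx: "z \<le> w" "w \<le> x" "x \<le> y"
      then have J': "w \<in> J" "x \<in> J" using sub by auto
      then show "f x - b * F x \<le> f w - b * F w"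
        using concave_on_antimono_right_of_max[OF lin FS[OF z] FS[OF J'(2)] _ mono[OF z J'(1) wx(1)] mono[OF J' wx(2)]]
          tan[OF FS[OF J'(2)]] by (simp add: fI algebra_simps)
    qed (use F sub in auto)
  next
    case False
    have sub: "x \<in> J" if "y \<le> x" "x \<le> z" for x
      using mem_is_interval_1_I[of J y z x] J z y that by (simp add: is_interval_convex_1)
    have lin': "concave_on (uminus ` S) (\<lambda>p. I (- p) - b * (- p))"
      using concave_onD[OF lin] reflect_convex[OF S]
      unfolding concave_on_def by (intro convex_onI) (force simp: algebra_simps)+
    have "f (- (- y)) \<le> f (- (- z)) * exp ((- b) * (- y - - z))"
    proof (rule le_exp_if_diff_antimono[where f="\<lambda>x. f (- x)" and F="\<lambda>x. - F (- x)"])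
      fix w x assume wx: "- z \<le> w" "w \<le> x" "x \<le> - y"
      then have J': "- w \<in> J" "- x \<in> J" using sub by auto
      have J'': "- F z \<in> uminus ` S" "- F (- x) \<in> uminus ` S" using FS[OF z] FS[OF J'(2)] by auto
      have "- F z \<le> - F (- w)" "- F (- w) \<le> - F (- x)" using mono z J' wx by auto
      then show "f (- x) - (- b) * (- F (- x)) \<le> f (- w) - (- b) * (- F (- w))"
        using concave_on_antimono_right_of_max[OF lin' J'', of "- F (- w)"] tan[OF FS[OF J'(2)]] J'
        by (simp add: fI algebra_simps)
    qed (use False sub F in \<open>auto intro!: reflect_DERIV\<close>)
    then show ?thesis by (simp add: algebra_simps)
  qed
  then have "ln (f y) \<le> ln (f z * exp (b * (y - z)))"
    using pos[OF y] by (subst ln_le_cancel_iff) (auto intro: pos[OF z] less_le_trans)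
  also have "\<dots> = ln (f z) + b * (y - z)"
    using pos[OF z] by (simp add: ln_mult)
  finally show ?thesis .
qed

section \<open>The cone consists of the log-concave quantile functions\<close>

lemma ext_concave_ext_lnI:
  assumes J: "convex J" and pos: "\<And>x. x \<in> J \<Longrightarrow> 0 < f x" and zero: "\<And>x. x \<notin> J \<Longrightarrow> f x = 0"
    and conc: "concave_on J (\<lambda>x. ln (f x))"
  shows "ext_concave (\<lambda>x. ext_ln (f x))"
  unfolding ext_concave_def
proof (intro conjI allI ballI)
  fix x show "ext_ln (f x) \<noteq> \<infinity>" by (simp add: ext_ln_def)
next
  fix x y t :: real assume t: "t \<in> {0..1}"
  show "ereal (1 - t) * ext_ln (f x) + ereal t * ext_ln (f y) \<le> ext_ln (f ((1 - t) * x + t * y))"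
  proof (cases "t = 0 \<or> t = 1")
    case True
    then show ?thesis by (auto simp: zero_ereal_def[symmetric] one_ereal_def[symmetric])
  next
    case False
    then have t: "0 < t" "t < 1" using t by auto
    show ?thesis
    proof (cases "x \<in> J \<and> y \<in> J")
      case True
      then have xy: "x \<in> J" "y \<in> J" by auto
      have m: "(1 - t) * x + t * y \<in> J"
        using convexD_alt[OF J xy, of t] t by simp
      have "(1 - t) * ln (f x) + t * ln (f y) \<le> ln (f ((1 - t) * x + t * y))"
        using concave_onD[OF conc, of t x y] xy t by simp
      then show ?thesis using pos[OF xy(1)] pos[OF xy(2)] pos[OF m] by (simp add: ext_ln_def)
    next
      case False
      then have "ext_ln (f x) = -\<infinity> \<or> ext_ln (f y) = -\<infinity>" using zero by (auto simp: ext_ln_def)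
      moreover have "ext_ln (f x) \<noteq> \<infinity>" "ext_ln (f y) \<noteq> \<infinity>" by (auto simp: ext_ln_def)
      ultimately have "ereal (1 - t) * ext_ln (f x) + ereal t * ext_ln (f y) = -\<infinity>"
        using t by (cases "ext_ln (f x)"; cases "ext_ln (f y)") auto
      then show ?thesis by (rule ord_eq_le_trans) simp
    qed
  qed
qed

text \<open>A finite left-hand side forces \<open>f\<close> to be positive at the intermediate
  point, so convexity of the positivity set comes out together with the inequality.\<close>

lemma ext_concave_ext_lnD:
  assumes e: "ext_concave (\<lambda>x. ext_ln (f x))" and f: "\<And>x. 0 \<le> f x"
  shows "concave_on {x. 0 < f x} (\<lambda>x. ln (f x))"
proof -
  have *: "0 < f ((1 - t) * x + t * y) \<and> (1 - t) * ln (f x) + t * ln (f y) \<le> ln (f ((1 - t) * x + t * y))"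
    if "0 < f x" "0 < f y" "0 \<le> t" "t \<le> 1" for x y t
  proof -
    have "ereal (1 - t) * ext_ln (f x) + ereal t * ext_ln (f y) \<le> ext_ln (f ((1 - t) * x + t * y))"
      using e that unfolding ext_concave_def by auto
    then have "ereal ((1 - t) * ln (f x) + t * ln (f y)) \<le> ext_ln (f ((1 - t) * x + t * y))"
      using that by (simp add: ext_ln_def)
    then show ?thesis using f[of "(1 - t) * x + t * y"] by (auto simp: ext_ln_def split: if_splits)
  qed
  have "convex {x. 0 < f x}"
    unfolding convex_alt using * by (simp add: mult.commute)
  moreover have "convex_on {x. 0 < f x} (\<lambda>x. - ln (f x))"
  proof (rule convex_onI)
    fix t x y :: real assume "0 < t" "t < 1" "x \<in> {x. 0 < f x}" "y \<in> {x. 0 < f x}"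
    then show "- ln (f ((1 - t) *\<^sub>R x + t *\<^sub>R y)) \<le> (1 - t) * - ln (f x) + t * - ln (f y)"
      using *[of x y t] by simp
  qed fact
  ultimately show ?thesis by (simp add: concave_on_def)
qed

text \<open>On the range of \<open>q\<close> its inverse is the distribution function of
  \<open>law q\<close>; the last claim thus identifies \<open>I v\<close> as the density at the
  quantile of level \<open>v\<close>.\<close>

lemma quantile_inverse:
  fixes q I :: "real \<Rightarrow> real"
  assumes q: "\<And>v. 0 < v \<Longrightarrow> v < 1 \<Longrightarrow> (q has_real_derivative 1 / I v) (at v)"
    and pos: "\<And>v. 0 < v \<Longrightarrow> v < 1 \<Longrightarrow> 0 < I v"
  shows "\<And>u v. 0 < u \<Longrightarrow> u < v \<Longrightarrow> v < 1 \<Longrightarrow> q u < q v"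
    and "continuous_on {0<..<1} q" and "inj_on q {0<..<1}"
    and "open (q ` {0<..<1})" and "convex (q ` {0<..<1})"
    and "\<And>v. 0 < v \<Longrightarrow> v < 1 \<Longrightarrow> (the_inv_into {0<..<1} q has_real_derivative I v) (at (q v))"
proof -
  show less: "q u < q v" if "0 < u" "u < v" "v < 1" for u v
  proof (rule DERIV_pos_imp_increasing[OF that(2)])
    fix x assume "u \<le> x" "x \<le> v"
    then show "\<exists>y. (q has_real_derivative y) (at x) \<and> 0 < y"
      using that q[of x] pos[of x] by (intro exI[of _ "1 / I x"]) auto
  qed
  show cont: "continuous_on {0<..<1} q"
    by (intro continuous_at_imp_continuous_on ballI DERIV_isCont[OF q]) auto
  show inj: "inj_on q {0<..<1}"
  proof (rule inj_onI)
    fix u v assume "u \<in> {0<..<1}" "v \<in> {0<..<1}" "q u = q v"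
    then show "u = v" using less[of u v] less[of v u] by (cases u v rule: linorder_cases) auto
  qed
  show "open (q ` {0<..<1})"
    by (rule injective_into_1d_imp_open_map_UNIV[OF _ cont inj]) auto
  have "connected (q ` {0<..<1})" by (intro connected_continuous_image cont) auto
  then show "convex (q ` {0<..<1})" by (metis is_interval_connected_1 is_interval_convex_1)
  fix v :: real assume v: "0 < v" "v < 1"
  let ?F = "the_inv_into {0<..<1} q"
  have Fq: "?F (q w) = w" if "0 < w" "w < 1" for w
    using that by (intro the_inv_into_f_f inj) auto
  have "isCont ?F (q v)"
  proof (rule isCont_inverse_function[where d="min v (1 - v) / 2" and f=q and x=v])
    have "0 < w \<and> w < 1" if "\<bar>w - v\<bar> \<le> min v (1 - v) / 2" for w
      using that v by (auto simp: abs_if min_def split: if_splits)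
    then show "\<And>z. \<bar>z - v\<bar> \<le> min v (1 - v) / 2 \<Longrightarrow> ?F (q z) = z"
      "\<And>z. \<bar>z - v\<bar> \<le> min v (1 - v) / 2 \<Longrightarrow> isCont q z"
      by (auto intro: Fq DERIV_isCont[OF q])
  qed (use v in auto)
  obtain e where e: "0 < e" "ball (q v) e \<subseteq> q ` {0<..<1}"
    using openE[OF \<open>open (q ` {0<..<1})\<close>, of "q v"] v by auto
  define a b where "a = q v - e" and "b = q v + e"
  have ab: "q v \<in> {a<..<b}" "{a<..<b} \<subseteq> q ` {0<..<1}"
    using e by (auto simp: a_def b_def ball_eq_greaterThanLessThan)
  have "(?F has_real_derivative inverse (1 / I v)) (at (q v))"
  proof (rule DERIV_inverse_function[where a=a and b=b])
    show "(q has_real_derivative 1 / I v) (at (?F (q v)))" using q v Fq by simp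
    show "1 / I v \<noteq> 0" using pos[OF v] by simp
    show "q (?F y) = y" if "a < y" "y < b" for y
      using ab(2) that by (intro f_the_inv_into_f inj) auto
    show "isCont ?F (q v)" by fact
  qed (use ab in auto)
  then show "(?F has_real_derivative I v) (at (q v))" by simp
qed

lemma distr_unif_const:
  assumes "\<And>v. 0 < v \<Longrightarrow> v < 1 \<Longrightarrow> q v = c"
  shows "law q = return borel c"
proof -
  have "law q = law (\<lambda>_. c)"
    by (intro distr_cong) (auto simp: assms)
  then show ?thesis by (simp add: unif.distr_const)
qed

text \<open>Substitution \<open>x = q v\<close> needs a compact interval with a continuous
  derivative. Both measures are therefore compared on \<open>A\<close> cut to
  \<open>[q (a k), q (b k)]\<close>; these sets increase to \<open>A\<close> within the range of
  \<open>q\<close>, outside of which both measures vanish.\<close>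

lemma distr_unif_eq_density:
  fixes q I :: "real \<Rightarrow> real"
  assumes q: "\<And>v. 0 < v \<Longrightarrow> v < 1 \<Longrightarrow> (q has_real_derivative 1 / I v) (at v)"
    and pos: "\<And>v. 0 < v \<Longrightarrow> v < 1 \<Longrightarrow> 0 < I v" and I: "continuous_on {0<..<1} I"
  defines "f \<equiv> \<lambda>x. if x \<in> q ` {0<..<1} then I (the_inv_into {0<..<1} q x) else 0"
  shows "f \<in> borel_measurable borel" and "law q = density lborel (\<lambda>x. ennreal (f x))"
proof -
  let ?N = "density lborel (\<lambda>x. ennreal (f x))"
  note inv = quantile_inverse[OF q pos]
  let ?F = "the_inv_into {0<..<1} q"
  have Fq: "?F (q w) = w" if "0 < w" "w < 1" for w
    using that by (intro the_inv_into_f_f inv(3)) auto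
  have fq: "f (q v) = I v" if "0 < v" "v < 1" for v
    using that by (auto simp: f_def Fq)
  have "continuous_on (q ` {0<..<1}) ?F"
    using DERIV_isCont[OF inv(6)] by (intro continuous_at_imp_continuous_on) auto
  then have "continuous_on (q ` {0<..<1}) (\<lambda>x. I (?F x))"
    by (rule continuous_on_compose2[OF I]) (auto simp: Fq)
  then show fm[measurable]: "f \<in> borel_measurable borel"
    unfolding f_def using inv(4) by (intro borel_measurable_continuous_on_if) auto
  have mono: "mono_on {0<..<1} q"
    using inv(1) by (intro mono_onI) (metis greaterThanLessThan_iff le_less)
  note qm[measurable] = mono_on_measurable_unif[OF mono]
  have q_le: "q u \<le> q v \<longleftrightarrow> u \<le> v" if "0 < u" "u < 1" "0 < v" "v < 1" for u v
    using inv(1)[of u v] inv(1)[of v u] that by (cases u v rule: linorder_cases) auto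
  have f0: "0 \<le> f x" for x using pos by (auto simp: f_def Fq less_imp_le)
  show "law q = ?N"
  proof (rule measure_eqI)
    fix A assume "A \<in> sets (law q)"
    then have A[measurable]: "A \<in> sets borel" by simp
    \<comment> \<open>The summand 3 makes \<open>a k < b k\<close> true already at
      \<open>k = 0\<close>.\<close>
    define a b :: "nat \<Rightarrow> real" where "a k = 1 / (k + 3)" and "b k = 1 - 1 / (k + 3)" for k
    have ab: "0 < a k" "a k < b k" "b k < 1" for k
      by (auto simp: a_def b_def field_simps)
    define E where "E k = A \<inter> {q (a k)..q (b k)}" for k
    have Em[measurable]: "E k \<in> sets borel" for k by (simp add: E_def)
    have eq: "emeasure (law q) (E k) = emeasure ?N (E k)" for k
    proof -
      have sub: "v \<in> {0<..<1}" if "v \<in> {a k..b k}" for v using that ab[of k] by auto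
      have "emeasure ?N (E k) =
          (\<integral>\<^sup>+x. ennreal (f x * indicator A x * indicator {q (a k)..q (b k)} x) \<partial>lborel)"
        by (subst emeasure_density) (auto simp: E_def indicator_def intro!: nn_integral_cong)
      also have "\<dots> = (\<integral>\<^sup>+v. ennreal (f (q v) * indicator A (q v) * (1 / I v) * indicator {a k..b k} v) \<partial>lborel)"
      proof (rule nn_integral_substitution[where f="\<lambda>x. f x * indicator A x" and g=q and g'="\<lambda>v. 1 / I v"])
        show "continuous_on {a k..b k} (\<lambda>v. 1 / I v)"
          using sub pos by (intro continuous_intros continuous_on_subset[OF I]) (auto, force)
      qed (use sub q pos ab[of k] in \<open>auto simp: set_borel_measurable_def less_imp_le\<close>)
      also have "\<dots> = (\<integral>\<^sup>+v. indicator A (q v) * indicator {a k..b k} v \<partial>unif)"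
      proof (subst nn_integral_restrict_space)
        have "f (q v) * indicator A (q v) * (1 / I v) = indicator A (q v)" if "v \<in> {a k..b k}" for v
          using sub[OF that] pos[of v] fq[of v] by (simp add: indicator_def)
        then show "(\<integral>\<^sup>+v. ennreal (f (q v) * indicator A (q v) * (1 / I v) * indicator {a k..b k} v) \<partial>lborel)
            = (\<integral>\<^sup>+v. indicator A (q v) * indicator {a k..b k} v * indicator {0<..<1} v \<partial>lborel)"
          using sub by (intro nn_integral_cong) (simp add: indicator_def)
      qed simp
      also have "\<dots> = (\<integral>\<^sup>+v. indicator (E k) (q v) \<partial>unif)"
        using ab[of k] by (intro nn_integral_cong) (auto simp: E_def indicator_def q_le)
      also have "\<dots> = emeasure (law q) (E k)"
        by (subst nn_integral_indicator[symmetric], simp, subst nn_integral_distr) auto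
      finally show ?thesis by simp
    qed
    have inc: "incseq E"
    proof (rule incseq_SucI)
      fix k
      have "a (Suc k) \<le> a k" "b k \<le> b (Suc k)" by (auto simp: a_def b_def field_simps)
      then show "E k \<subseteq> E (Suc k)"
        using ab[of k] ab[of "Suc k"] q_le[of "a (Suc k)" "a k"] q_le[of "b k" "b (Suc k)"]
        by (auto simp: E_def intro: order_trans)
    qed
    have cover: "\<exists>k. v \<in> {a k..b k}" if v: "0 < v" "v < 1" for v
    proof -
      obtain k where "1 / real (Suc k) < min v (1 - v)"
        using nat_approx_posE[of "min v (1 - v)"] v by (auto simp: field_simps)
      moreover have "1 / (real k + 3) \<le> 1 / real (Suc k)" by (auto simp: field_simps)
      ultimately show ?thesis by (intro exI[of _ k]) (auto simp: a_def b_def)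
    qed
    have UE: "(\<Union>k. E k) = A \<inter> q ` {0<..<1}"
    proof safe
      fix k x assume "x \<in> E k"
      then show "x \<in> A" by (simp add: E_def)
      have "continuous_on {a k..b k} q"
        using ab[of k] by (intro continuous_on_subset[OF inv(2)]) auto
      then obtain v where "a k \<le> v" "v \<le> b k" "q v = x"
        using IVT'[of q "a k" x "b k"] \<open>x \<in> E k\<close> ab[of k] by (auto simp: E_def)
      then show "x \<in> q ` {0<..<1}" using ab[of k] by (intro image_eqI[of _ _ v]) auto
    next
      fix v :: real assume v: "v \<in> {0<..<1}" "q v \<in> A"
      then obtain k where "v \<in> {a k..b k}" using cover[of v] by auto
      then show "q v \<in> (\<Union>k. E k)"
        using v ab[of k] by (auto simp: E_def q_le intro!: exI[of _ k])
    qed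
    have "(\<lambda>k. emeasure (law q) (E k)) \<longlonglongrightarrow> emeasure (law q) (\<Union>k. E k)"
      by (intro Lim_emeasure_incseq inc) auto
    moreover have "(\<lambda>k. emeasure ?N (E k)) \<longlonglongrightarrow> emeasure ?N (\<Union>k. E k)"
      by (intro Lim_emeasure_incseq inc) auto
    ultimately have "emeasure (law q) (\<Union>k. E k) = emeasure ?N (\<Union>k. E k)"
      unfolding eq by (rule LIMSEQ_unique)
    moreover have "emeasure (law q) (\<Union>k. E k) = emeasure (law q) A"
      unfolding UE using inv(4)
      by (subst (1 2) emeasure_distr) (auto intro!: arg_cong2[where f=emeasure] borel_open)
    moreover have "emeasure ?N (\<Union>k. E k) = emeasure ?N A"
    proof -
      have "A \<inter> q ` {0<..<1} \<in> sets borel" using inv(4) by (intro sets.Int borel_open A)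
      moreover have "ennreal (f x) * indicator (A \<inter> q ` {0<..<1}) x = ennreal (f x) * indicator A x" for x
        by (simp add: f_def indicator_def)
      ultimately show ?thesis unfolding UE by (simp add: emeasure_density)
    qed
    ultimately show "emeasure (law q) A = emeasure ?N A"
      by simp
  qed simp
qed

text \<open>A constant gives a point mass. Otherwise the density is \<open>I\<close> composed with
  the inverse of \<open>q\<close>, and each supergradient of \<open>I\<close> is one of the
  logarithm of the density.\<close>

theorem distr_lc_quantiles:
  assumes q: "q \<in> lc_quantiles"
  shows "law q \<in> log_concave_dists"
proof -
  have ps: "prob_space (law q)"
    by (intro prob_space_distr_unif lc_quantiles_mono_on q)
  show ?thesis
  proof (cases rule: lc_quantiles_cases[OF q, case_names const deriv])
    case (const c)
    then show ?thesis using ps distr_unif_const[of q c] by (auto simp: log_concave_dists_def)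
  next
    case (deriv I)
    note inv = quantile_inverse[OF deriv(1,2)]
    let ?F = "the_inv_into {0<..<1} q" and ?J = "q ` {0<..<1}"
    have Fq: "?F (q w) = w" if "0 < w" "w < 1" for w
      using that by (intro the_inv_into_f_f inv(3)) auto
    have "convex_on {0<..<1} (\<lambda>v. - I v)" using deriv(3) by (simp add: concave_on_def)
    then have "continuous_on {0<..<1} (\<lambda>v. - (- I v))"
      by (intro continuous_on_minus convex_on_continuous) auto
    then have cI: "continuous_on {0<..<1} I" by simp
    define f where "f x = (if x \<in> ?J then I (?F x) else 0)" for x
    have fm: "f \<in> borel_measurable borel" "law q = density lborel (\<lambda>x. ennreal (f x))"
      using distr_unif_eq_density[OF deriv(1,2) cI] unfolding f_def[abs_def] by auto
    have fpos: "0 < f x" if "x \<in> ?J" for x using that deriv(2) by (auto simp: f_def Fq)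
    have "concave_on ?J (\<lambda>x. ln (f x))"
    proof (rule concave_on_if_supergradients[OF inv(5)])
      fix z assume z: "z \<in> ?J"
      then have "?F z \<in> {0<..<1}" by (auto simp: Fq)
      then obtain b where "\<forall>p\<in>{0<..<1}. I p \<le> I (?F z) + b * (p - ?F z)"
        using concave_on_supergradient[OF deriv(3), of "?F z"] by auto
      then have "ln (f y) \<le> ln (f z) + b * (y - z)" if "y \<in> ?J" for y
        using that z fpos inv(6)
        by (intro log_density_tangent[OF inv(5) _ _ deriv(3), where F="?F"]) (auto simp: f_def Fq)
      then show "\<exists>b. \<forall>y\<in>?J. ln (f y) \<le> ln (f z) + b * (y - z)" by blast
    qed
    then have "ext_concave (\<lambda>x. ext_ln (f x))"
      by (intro ext_concave_ext_lnI[OF inv(5) fpos]) (simp_all add: f_def)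
    moreover have "0 \<le> f x" for x using fpos[of x] by (cases "x \<in> ?J") (auto simp: f_def)
    ultimately show ?thesis using ps fm by (auto simp: log_concave_dists_def intro!: exI[of _ f])
  qed
qed

text \<open>On a compact interval inside \<open>J\<close> the distribution function is a constant
  plus the integral of the continuous \<open>f\<close>, so the fundamental theorem of calculus
  applies.\<close>

lemma cdf_density_DERIV:
  fixes f :: "real \<Rightarrow> real"
  assumes ps: "prob_space (density lborel (\<lambda>x. ennreal (f x)))"
    and [measurable]: "f \<in> borel_measurable borel" and f0: "\<And>x. 0 \<le> f x"
    and J: "open J" "x \<in> J" "continuous_on J f"
  shows "(cdf (density lborel (\<lambda>x. ennreal (f x))) has_real_derivative f x) (at x)"
proof -
  let ?M = "density lborel (\<lambda>x. ennreal (f x))"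
  interpret M: prob_space ?M by fact
  interpret finite_borel_measure ?M by unfold_locales auto
  obtain e where e: "0 < e" "cball x e \<subseteq> J"
    using J open_contains_cball by blast
  define a b where "a = x - e" and "b = x + e"
  have ab: "a < x" "x < b" "{a..b} \<subseteq> J" using e by (auto simp: a_def b_def cball_eq_atLeastAtMost)
  have cf: "continuous_on {a..b} f" using J(3) ab(3) by (rule continuous_on_subset)
  have eq: "cdf ?M y = cdf ?M a + integral {a..y} f" if y: "y \<in> {a<..<b}" for y
  proof -
    have si: "set_integrable lborel {a..y} f"
      using y by (intro borel_integrable_atLeastAtMost' continuous_on_subset[OF cf]) auto
    have "emeasure ?M {a<..y} = (\<integral>\<^sup>+x. ennreal (f x) * indicator {a<..y} x \<partial>lborel)"
      by (subst emeasure_density) auto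
    also have "\<dots> = (\<integral>\<^sup>+x. ennreal (indicator {a..y} x * f x) \<partial>lborel)"
      using AE_lborel_singleton[of a]
      by (intro nn_integral_cong_AE) (auto elim!: eventually_mono simp: indicator_def)
    also have "\<dots> = ennreal (\<integral>x. indicator {a..y} x * f x \<partial>lborel)"
      using si f0 by (intro nn_integral_eq_integral) (auto simp: set_integrable_def)
    also have "(\<integral>x. indicator {a..y} x * f x \<partial>lborel) = integral {a..y} f"
      using set_borel_integral_eq_integral(2)[OF si] by (simp add: set_lebesgue_integral_def)
    finally have "measure ?M {a<..y} = integral {a..y} f"
      using set_borel_integral_eq_integral(1)[OF si] f0
      by (simp add: measure_def Henstock_Kurzweil_Integration.integral_nonneg)
    then show ?thesis using cdf_diff_eq[of a y] y by simp
  qed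
  have "((\<lambda>y. integral {a..y} f) has_real_derivative f x) (at x within {a..b})"
    using ab by (intro integral_has_real_derivative cf) auto
  then have "((\<lambda>y. integral {a..y} f) has_real_derivative f x) (at x)"
    using ab by (simp add: at_within_interior[of x "{a..b}"])
  then have "((\<lambda>y. cdf ?M a + integral {a..y} f) has_real_derivative f x) (at x)"
    by (auto intro!: derivative_eq_intros)
  then show ?thesis
    by (rule has_field_derivative_transform_within_open[where S="{a<..<b}"]) (use ab eq in auto)
qed

text \<open>On the interior \<open>J\<close> of the positivity set \<open>ln f\<close> is concave,
  hence continuous, so the distribution function is differentiable there with derivative
  \<open>f > 0\<close>. Its inverse is \<open>q\<close> with \<open>q' = 1 / f (q v)\<close>, and
  the supergradients of \<open>ln f\<close> become supergradients of \<open>f\<close> composed with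
  \<open>q\<close>.\<close>

theorem log_concave_dists_quantile:
  assumes mu: "\<mu> \<in> log_concave_dists"
  shows "\<exists>q\<in>lc_quantiles. law q = \<mu>"
proof -
  have ps: "prob_space \<mu>" and s: "sets \<mu> = sets borel" using mu by (auto simp: log_concave_dists_def)
  consider a where "\<mu> = return borel a"
    | f where "f \<in> borel_measurable borel" "\<And>x. 0 \<le> f x" "\<mu> = density lborel (\<lambda>x. ennreal (f x))"
      "ext_concave (\<lambda>x. ext_ln (f x))"
    using mu by (auto simp: log_concave_dists_def)
  then show ?thesis
  proof cases
    case (1 a)
    then show ?thesis
      using distr_unif_const[of "\<lambda>_. a" a] lc_quantiles_const by blast
  next
    case (2 f)
    note [measurable] = 2(1) and f0 = 2(2)
    interpret prob_space \<mu> by fact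
    interpret finite_borel_measure \<mu> by unfold_locales (use s in auto)
    let ?F = "cdf \<mu>"
    define S where "S = {x. 0 < f x}"
    define J where "J = interior S"
    have concS: "concave_on S (\<lambda>x. ln (f x))"
      unfolding S_def by (intro ext_concave_ext_lnD 2)
    have convS: "convex S" using concS by (rule concave_on_imp_convex)
    have JS: "J \<subseteq> S" by (simp add: J_def interior_subset)
    have oJ: "open J" and cJ: "convex J" using convS by (simp_all add: J_def convex_interior)
    have JB[measurable]: "J \<in> sets borel" using oJ by (rule borel_open)
    have conc: "concave_on J (\<lambda>x. ln (f x))"
      using concS cJ JS unfolding concave_on_iff by blast
    have "convex_on J (\<lambda>x. - ln (f x))" using conc by (simp add: concave_on_def)
    then have "continuous_on J (\<lambda>x. exp (- (- ln (f x))))"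
      by (intro continuous_on_exp continuous_on_minus convex_on_continuous oJ)
    then have cf: "continuous_on J f"
      by (rule continuous_on_cong[THEN iffD1, rotated -1]) (use JS in \<open>auto simp: S_def\<close>)
    have fpos: "0 < f x" if "x \<in> J" for x using that JS by (auto simp: S_def)
    have dF: "(?F has_real_derivative f x) (at x)" if "x \<in> J" for x
      using cdf_density_DERIV[OF _ 2(1,2) oJ that cf] ps unfolding 2(3) by simp
    \<comment> \<open>Outside \<open>J\<close> the density is positive only on the frontier of the
      convex set \<open>S\<close>, which is a Lebesgue null set.\<close>
    have null: "emeasure \<mu> (- J) = 0"
    proof -
      have "frontier S \<in> null_sets lborel"
        using negligible_convex_frontier[OF convS]
        by (simp add: negligible_iff_null_sets null_sets_completion_iff)
      then have "AE x in lborel. x \<notin> frontier S" by (rule AE_not_in)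
      then have "AE x in lborel. ennreal (f x) * indicator (- J) x = 0"
      proof eventually_elim
        case (elim x)
        then have "x \<in> S \<Longrightarrow> x \<in> J" using closure_subset[of S] by (auto simp: frontier_def J_def)
        then show ?case using f0[of x] by (auto simp: S_def indicator_def less_le)
      qed
      then have "(\<integral>\<^sup>+x. ennreal (f x) * indicator (- J) x \<partial>lborel) = 0"
        by (subst nn_integral_0_iff_AE) auto
      then show ?thesis unfolding 2(3) by (subst emeasure_density) auto
    qed
    have contF: "isCont ?F x" for x
    proof -
      have "emeasure \<mu> {x} = 0"
        unfolding 2(3) using AE_lborel_singleton[of x]
        by (subst emeasure_density) (auto simp: nn_integral_0_iff_AE elim!: eventually_mono)
      then show ?thesis by (simp add: isCont_cdf measure_def)
    qed
    obtain q where q: "mono_on {0<..<1} q" "law q = \<mu>"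
      "\<And>v x. 0 < v \<Longrightarrow> v < 1 \<Longrightarrow> v \<le> ?F x \<longleftrightarrow> q v \<le> x"
      using exists_quantile[OF ps s] by auto
    have Fq: "?F (q v) = v" if v: "0 < v" "v < 1" for v
    proof (rule antisym)
      show "v \<le> ?F (q v)" using q(3)[OF v] by simp
      show "?F (q v) \<le> v"
      proof (rule tendsto_upperbound)
        show "(?F \<longlongrightarrow> ?F (q v)) (at_left (q v))"
          using contF[of "q v"] unfolding isCont_def by (rule filterlim_mono) (simp_all add: at_le)
        have "?F x \<le> v" if "x < q v" for x using q(3)[OF v, of x] that by simp
        then show "\<forall>\<^sub>F x in at_left (q v). ?F x \<le> v"
          by (auto simp: eventually_at_filter)
      qed simp
    qed
    have qJ: "q v \<in> J" if v: "0 < v" "v < 1" for v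
    proof (rule ccontr)
      assume n: "q v \<notin> J"
      \<comment> \<open>An interval that misses \<open>q v\<close> lies on one side of it, which
        would make \<open>?F (q v)\<close> equal to 1 or 0 instead of \<open>v\<close>.\<close>
      have "J \<subseteq> {..q v} \<or> J \<subseteq> - {..q v}"
      proof (rule ccontr)
        assume "\<not> ?thesis"
        then obtain x y where "x \<in> J" "y \<in> J" "q v < x" "y \<le> q v"
          by (metis ComplI atMost_iff not_le subsetI)
        then show False using n mem_is_interval_1_I[of J y x "q v"] cJ by (simp add: is_interval_convex_1)
      qed
      then show False
      proof
        assume "J \<subseteq> {..q v}"
        then have "- {..q v} \<subseteq> - J" by auto
        then have "emeasure \<mu> (- {..q v}) = 0"
          using emeasure_mono[of "- {..q v}" "- J" \<mu>] null s by auto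
        moreover have "measure \<mu> (space \<mu> - {..q v}) = 1 - measure \<mu> {..q v}"
          using s by (intro prob_compl) auto
        moreover have "space \<mu> - {..q v} = - {..q v}" using sets_eq_imp_space_eq[OF s] by auto
        ultimately show False using Fq[OF v] v by (simp add: cdf_def measure_def)
      next
        assume "J \<subseteq> - {..q v}"
        then have "{..q v} \<subseteq> - J" by auto
        then have "emeasure \<mu> {..q v} = 0"
          using emeasure_mono[of "{..q v}" "- J" \<mu>] null s by auto
        then show False using Fq[OF v] v by (simp add: cdf_def measure_def)
      qed
    qed
    have qF: "q (?F x) = x" if x: "x \<in> J" for x
    proof -
      have less: "?F y < ?F y'" if "y \<in> J" "y' \<in> J" "y < y'" for y y'
      proof (rule DERIV_pos_imp_increasing[OF that(3)])
        fix u assume "y \<le> u" "u \<le> y'"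
        then have "u \<in> J" using mem_is_interval_1_I[of J y y' u] cJ that by (simp add: is_interval_convex_1)
        then show "\<exists>d. (?F has_real_derivative d) (at u) \<and> 0 < d" using dF fpos by blast
      qed
      obtain e where e: "0 < e" "cball x e \<subseteq> J" using oJ x open_contains_cball by blast
      then have "x - e \<in> J" "x + e \<in> J" by (auto simp: cball_eq_atLeastAtMost subset_iff)
      then have "?F (x - e) < ?F x" "?F x < ?F (x + e)" using less x e by auto
      then have F01: "0 < ?F x" "?F x < 1"
        using measure_nonneg[of \<mu> "{..x - e}"] prob_le_1[of "{..x + e}"] unfolding cdf_def by linarith+
      then show ?thesis
        using Fq[OF F01] less[OF qJ[OF F01] x] less[OF x qJ[OF F01]]
        by (cases "q (?F x)" x rule: linorder_cases) auto
    qed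
    have contq: "isCont q v" if v: "0 < v" "v < 1" for v
    proof -
      obtain e where e: "0 < e" "cball (q v) e \<subseteq> J" using oJ qJ[OF v] open_contains_cball by blast
      have "isCont q (?F (q v))"
      proof (rule isCont_inverse_function[where d=e and f="?F" and x="q v"])
        fix z assume "\<bar>z - q v\<bar> \<le> e"
        then have "z \<in> J" using e by (auto simp: dist_real_def abs_minus_commute)
        then show "q (?F z) = z" by (rule qF)
      qed (use e contF in auto)
      then show ?thesis by (simp add: Fq v)
    qed
    have dq: "(q has_real_derivative 1 / f (q v)) (at v)" if v: "0 < v" "v < 1" for v
    proof -
      have "(q has_real_derivative inverse (f (q v))) (at v)"
        by (rule DERIV_inverse_function[where f="?F" and a=0 and b=1])
          (use v fpos[OF qJ[OF v]] in \<open>auto intro: dF qJ Fq contq\<close>)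
      then show ?thesis by (simp add: inverse_eq_divide)
    qed
    have "concave_on {0<..<1} (\<lambda>v. f (q v))"
    proof (rule concave_on_if_supergradients)
      fix v :: real assume "v \<in> {0<..<1}"
      then have v: "0 < v" "v < 1" by auto
      obtain b where b: "\<And>y. y \<in> J \<Longrightarrow> ln (f y) \<le> ln (f (q v)) + b * (y - q v)"
        using concave_on_supergradient[OF conc oJ qJ[OF v]] by blast
      have "f (q u) \<le> f (q v) + b * (u - v)" if u: "0 < u" "u < 1" for u
        using density_tangent[OF cJ dF fpos conc qJ[OF v] b qJ[OF u]] Fq[OF u] Fq[OF v] by simp
      then show "\<exists>b. \<forall>u\<in>{0<..<1}. f (q u) \<le> f (q v) + b * (u - v)"
        by (intro exI[of _ b]) auto
    qed simp
    then have "q \<in> lc_quantiles"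
      using dq fpos qJ by (intro lc_quantilesI[where I="\<lambda>v. f (q v)"]) auto
    then show ?thesis using q(2) by blast
  qed
qed

section \<open>Quantitative bounds for log-concave quantile functions\<close>

lemma indicator_Icc_measurable_unif [measurable]:
  "(indicator {a..b} :: real \<Rightarrow> ennreal) \<in> borel_measurable unif"
  by (rule measurable_restrict_space1) simp

lemma nn_integral_unif_reflect:
  assumes [measurable]: "f \<in> borel_measurable unif"
  shows "(\<integral>\<^sup>+v. f (1 - v) \<partial>unif) = (\<integral>\<^sup>+v. f v \<partial>unif)"
proof -
  have [measurable]: "(\<lambda>v. f v * indicator {0<..<1} v) \<in> borel_measurable borel"
    using assms by (subst (asm) borel_measurable_restrict_space_iff_ennreal) auto
  have "(\<integral>\<^sup>+v. f v \<partial>unif) = (\<integral>\<^sup>+v. f v * indicator {0<..<1} v \<partial>lborel)"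
    by (subst nn_integral_restrict_space) auto
  also have "\<dots> = (\<integral>\<^sup>+v. f (1 - v) * indicator {0<..<1} (1 - v) \<partial>lborel)"
    by (subst nn_integral_real_affine[where c="- 1" and t=1]) auto
  also have "\<dots> = (\<integral>\<^sup>+v. f (1 - v) * indicator {0<..<1} v \<partial>lborel)"
    by (intro nn_integral_cong) (auto simp: indicator_def)
  also have "\<dots> = (\<integral>\<^sup>+v. f (1 - v) \<partial>unif)"
    by (subst nn_integral_restrict_space) auto
  finally show ?thesis by simp
qed

text \<open>For a positive concave function the slope \<open>I v / v\<close> from the origin
  decreases. The end point 0 lies outside the domain, so the chord starts at \<open>e\<close>, its
  nonnegative term in \<open>I e\<close> is dropped, and \<open>e\<close> tends to 0.\<close>

lemma concave_pos_left:
  assumes conc: "concave_on {0<..<1} I" and pos: "\<And>v. 0 < v \<Longrightarrow> v < 1 \<Longrightarrow> 0 < (I v :: real)"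
    and uv: "0 < v" "v \<le> u" "u < 1"
  shows "v * I u \<le> u * I v"
proof (cases "u = v")
  case False
  have "v * I u - 0 * I u \<le> u * I v - 0 * I v"
  proof (rule tendsto_le[of "at_right (0::real)"])
    show "((\<lambda>e. v * I u - e * I u) \<longlongrightarrow> v * I u - 0 * I u) (at_right 0)" by (intro tendsto_intros)
    show "((\<lambda>e. u * I v - e * I v) \<longlongrightarrow> u * I v - 0 * I v) (at_right 0)" by (intro tendsto_intros)
    have "eventually (\<lambda>e. e < v) (at_right 0)"
      using uv by (auto intro!: order_tendstoD(2)[of _ 0] tendsto_ident_at)
    then show "eventually (\<lambda>e. v * I u - e * I u \<le> u * I v - e * I v) (at_right 0)"
      using eventually_at_right_less[of "0::real"]
    proof eventually_elim
      case (elim e)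
      define t where "t = (v - e) / (u - e)"
      have t: "0 \<le> t" "t \<le> 1" using elim uv by (auto simp: t_def field_simps)
      have te: "t * (u - e) = v - e" using elim uv by (simp add: t_def)
      then have "(1 - t) *\<^sub>R e + t *\<^sub>R u = v" by (simp add: algebra_simps)
      moreover have "(1 - t) * I e + t * I u \<le> I ((1 - t) *\<^sub>R e + t *\<^sub>R u)"
        using elim uv t by (intro concave_onD[OF conc]) auto
      moreover have "0 \<le> (1 - t) * I e" using t pos[of e] elim uv by auto
      ultimately have "t * I u \<le> I v" by simp
      then have "(u - e) * (t * I u) \<le> (u - e) * I v" using elim uv by (intro mult_left_mono) auto
      moreover have "(u - e) * (t * I u) = (v - e) * I u" using te by (simp add: mult_ac flip: te)
      ultimately show ?case by (simp add: algebra_simps)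
    qed
  qed simp
  then show ?thesis by simp
qed simp

lemma concave_reflect_unit:
  assumes "concave_on {0<..<1} (I :: real \<Rightarrow> real)" shows "concave_on {0<..<1} (\<lambda>v. I (1 - v))"
  unfolding concave_on_def
proof (rule convex_onI)
  fix t x y :: real assume "0 < t" "t < 1" "x \<in> {0<..<1}" "y \<in> {0<..<1}"
  then have "(1 - t) * I (1 - x) + t * I (1 - y) \<le> I ((1 - t) *\<^sub>R (1 - x) + t *\<^sub>R (1 - y))"
    by (intro concave_onD[OF assms]) auto
  moreover have "(1 - t) *\<^sub>R (1 - x) + t *\<^sub>R (1 - y) = 1 - ((1 - t) *\<^sub>R x + t *\<^sub>R y)"
    by (simp add: algebra_simps)
  ultimately show "- I (1 - ((1 - t) *\<^sub>R x + t *\<^sub>R y)) \<le> (1 - t) * - I (1 - x) + t * - I (1 - y)"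
    by (simp only:)
qed simp

text \<open>The nondegenerate case of \<open>lc_quantiles_cases\<close>; \<open>I\<close> is the
  density evaluated at the quantile.\<close>

locale lc_density_quantile =
  fixes q I :: "real \<Rightarrow> real"
  assumes dq: "\<And>v. 0 < v \<Longrightarrow> v < 1 \<Longrightarrow> (q has_real_derivative 1 / I v) (at v)"
    and pos: "\<And>v. 0 < v \<Longrightarrow> v < 1 \<Longrightarrow> 0 < I v" and conc: "concave_on {0<..<1} I"
begin

text \<open>The scale of the law, from the density at its median. Concavity and positivity give
  \<open>I v \<le> 2 * I (1/2)\<close> and \<open>2 * I (1/2) * min v (1 - v) \<le> I v\<close>, so
  \<open>q' v\<close> lies between \<open>K\<close> and \<open>K / min v (1 - v)\<close>.\<close>

definition K :: real where "K = 1 / (2 * I (1/2))"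

lemma K_pos: "0 < K"
  using pos[of "1/2"] by (simp add: K_def)

lemma strict: "0 < u \<Longrightarrow> u < v \<Longrightarrow> v < 1 \<Longrightarrow> q u < q v"
  using quantile_inverse(1)[OF dq pos] by blast

lemma q_le_iff: "0 < u \<Longrightarrow> u < 1 \<Longrightarrow> 0 < v \<Longrightarrow> v < 1 \<Longrightarrow> q u \<le> q v \<longleftrightarrow> u \<le> v"
  using strict[of u v] strict[of v u] by (cases u v rule: linorder_cases) auto

lemma q_mono_on: "mono_on {0<..<1} q"
  by (rule mono_onI) (simp add: q_le_iff)

lemma q_measurable [measurable]: "q \<in> borel_measurable unif"
  by (intro mono_on_measurable_unif q_mono_on)

lemma continuous_I: "continuous_on {0<..<1} I"
proof -
  have "convex_on {0<..<1} (\<lambda>v. - I v)" using conc by (simp add: concave_on_def)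
  then have "continuous_on {0<..<1} (\<lambda>v. - (- I v))"
    by (intro continuous_on_minus convex_on_continuous) auto
  then show ?thesis by simp
qed

lemma reflect: "lc_density_quantile (\<lambda>v. - q (1 - v)) (\<lambda>v. I (1 - v))"
proof
  fix v :: real assume v: "0 < v" "v < 1"
  have "((\<lambda>v. q (1 - v)) has_real_derivative 1 / I (1 - v) * (- 1)) (at v)"
    using v by (intro DERIV_chain2[OF dq]) (auto intro!: derivative_eq_intros)
  from DERIV_minus[OF this] show "((\<lambda>v. - q (1 - v)) has_real_derivative 1 / I (1 - v)) (at v)" by simp
  show "0 < I (1 - v)" using v by (intro pos) auto
qed (rule concave_reflect_unit[OF conc])

lemma K_reflect: "lc_density_quantile.K (\<lambda>v. I (1 - v)) = K"
  using lc_density_quantile.K_def[OF reflect] by (simp add: K_def)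

lemma I_right: "0 < u \<Longrightarrow> u \<le> v \<Longrightarrow> v < 1 \<Longrightarrow> (1 - v) * I u \<le> (1 - u) * I v"
  using concave_pos_left[OF concave_reflect_unit[OF conc], of "1 - v" "1 - u"] pos by simp

lemma K_le_deriv: assumes v: "0 < v" "v < 1" shows "K \<le> 1 / I v"
proof -
  have "I v \<le> 2 * I (1/2)"
  proof (cases "v \<le> 1/2")
    case True
    have "1/2 * I v \<le> (1 - v) * I (1/2)" using I_right[of v "1/2"] v True by simp
    also have "\<dots> \<le> 1 * I (1/2)" using v pos[of "1/2"] by (intro mult_right_mono) auto
    finally show ?thesis by simp
  next
    case False
    have "1/2 * I v \<le> v * I (1/2)" using concave_pos_left[OF conc pos, of "1/2" v] v False by simp
    also have "\<dots> \<le> 1 * I (1/2)" using v pos[of "1/2"] by (intro mult_right_mono) auto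
    finally show ?thesis by simp
  qed
  then show ?thesis
    unfolding K_def using pos[OF v] by (intro divide_left_mono) auto
qed

lemma deriv_le_left: assumes v: "0 < v" "v \<le> 1/2" shows "1 / I v \<le> K / v"
proof -
  have "v * I (1/2) \<le> 1/2 * I v" using concave_pos_left[OF conc pos, of v "1/2"] v by simp
  then have "2 * I (1/2) * v \<le> I v" by (simp add: mult_ac)
  then have "1 / I v \<le> 1 / (2 * I (1/2) * v)"
    using pos[of v] pos[of "1/2"] v by (intro divide_left_mono) auto
  then show ?thesis by (simp add: K_def)
qed

lemma deriv_le_right: assumes v: "1/2 \<le> v" "v < 1" shows "1 / I v \<le> K / (1 - v)"
  using lc_density_quantile.deriv_le_left[OF reflect, of "1 - v"] v by (simp add: K_reflect)

lemma deriv_le: assumes v: "0 < v" "v < 1" shows "v * (1 - v) * (1 / I v) \<le> K"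
proof (cases "v \<le> 1/2")
  case True
  have "v * (1 - v) * (1 / I v) \<le> v * (1 - v) * (K / v)"
    using v deriv_le_left True by (intro mult_left_mono) auto
  also have "\<dots> = (1 - v) * K" using v by simp
  also have "\<dots> \<le> 1 * K" using v K_pos by (intro mult_right_mono) auto
  finally show ?thesis by simp
next
  case False
  have "v * (1 - v) * (1 / I v) \<le> v * (1 - v) * (K / (1 - v))"
    using v deriv_le_right False by (intro mult_left_mono) auto
  also have "\<dots> = v * K" using v by simp
  also have "\<dots> \<le> 1 * K" using v K_pos by (intro mult_right_mono) auto
  finally show ?thesis by simp
qed

section \<open>Spread of quantiles, tails and second moments\<close>

lemma spread_ge: assumes uv: "0 < u" "u \<le> v" "v < 1" shows "K * (v - u) \<le> q v - q u"
proof -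
  have "q u - K * u \<le> q v - K * v"
  proof (rule DERIV_nonneg_imp_nondecreasing[of u v "\<lambda>v. q v - K * v"])
    fix x assume "u \<le> x" "x \<le> v"
    then have x: "0 < x" "x < 1" using uv by auto
    have "((\<lambda>v. q v - K * v) has_real_derivative 1 / I x - K) (at x)"
      using dq[OF x] by (auto intro!: derivative_eq_intros)
    then show "\<exists>d. ((\<lambda>v. q v - K * v) has_real_derivative d) (at x) \<and> 0 \<le> d"
      using K_le_deriv[OF x] by (intro exI[of _ "1 / I x - K"]) auto
  qed (use uv in auto)
  then show ?thesis by (simp add: algebra_simps)
qed

lemma spread_le_left: assumes uv: "0 < u" "u \<le> v" "v \<le> 1/2" shows "q v - q u \<le> K * ln (v / u)"
proof -
  have "K * ln u - q u \<le> K * ln v - q v"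
  proof (rule DERIV_nonneg_imp_nondecreasing[of u v "\<lambda>v. K * ln v - q v"])
    fix x assume "u \<le> x" "x \<le> v"
    then have x: "0 < x" "x < 1" "x \<le> 1/2" using uv by auto
    have "((\<lambda>v. K * ln v - q v) has_real_derivative K / x - 1 / I x) (at x)"
      using dq[OF x(1,2)] x by (auto intro!: derivative_eq_intros)
    then show "\<exists>d. ((\<lambda>v. K * ln v - q v) has_real_derivative d) (at x) \<and> 0 \<le> d"
      using deriv_le_left[OF x(1,3)] by (intro exI[of _ "K / x - 1 / I x"]) auto
  qed (use uv in auto)
  then show ?thesis using uv by (simp add: ln_div algebra_simps)
qed

lemma spread_le_right: assumes "1/2 \<le> u" "u \<le> v" "v < 1" shows "q v - q u \<le> K * ln ((1 - u) / (1 - v))"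
  using lc_density_quantile.spread_le_left[OF reflect, of "1 - v" "1 - u"] assms by (simp add: K_reflect)

text \<open>\<open>q h - q v \<le> K * ln (h / v)\<close>, and the logarithm is at most
  \<open>4 * (h / v) powr (1/4)\<close>. The exponent is chosen so that the square is integrable at
  0: its integral over \<open>[0, h]\<close> is \<open>16 * K\<^sup>2\<close> times
  \<open>2 * h\<close>.\<close>

lemma tail_left:
  assumes h: "0 < h" "h \<le> 1/2"
  shows "(\<integral>\<^sup>+v. ennreal ((q h - q v)\<^sup>2) * indicator {0..h} v \<partial>unif) \<le> ennreal (32 * K\<^sup>2 * h)"
proof -
  have int: "((\<lambda>v. 16 * K\<^sup>2 * h powr (1/2) * v powr (-1/2)) has_integral
      16 * K\<^sup>2 * h powr (1/2) * (h powr (-1/2 + 1) / (-1/2 + 1))) {0..h}"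
    using has_integral_powr_from_0[of "-1/2" h] h by (intro has_integral_mult_right) auto
  have "(\<integral>\<^sup>+v. ennreal ((q h - q v)\<^sup>2) * indicator {0..h} v \<partial>unif)
      \<le> (\<integral>\<^sup>+v. ennreal (indicator {0..h} v * (16 * K\<^sup>2 * h powr (1/2) * v powr (-1/2))) \<partial>unif)"
  proof (rule nn_integral_mono)
    fix v assume v: "v \<in> space unif"
    show "ennreal ((q h - q v)\<^sup>2) * indicator {0..h} v
        \<le> ennreal (indicator {0..h} v * (16 * K\<^sup>2 * h powr (1/2) * v powr (-1/2)))"
    proof (cases "v \<in> {0..h}")
      case True
      then have v: "0 < v" "v \<le> h" using v by auto
      have "q h - q v \<le> K * ln (h / v)" using spread_le_left[OF v h(2)] .
      also have "\<dots> \<le> K * ((h / v) powr (1/4) / (1/4))"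
        using ln_powr_bound[of "h / v" "1/4"] v K_pos by (intro mult_left_mono) auto
      finally have "(q h - q v)\<^sup>2 \<le> (4 * K * (h / v) powr (1/4))\<^sup>2"
        using q_le_iff[of v h] v h by (intro power_mono) auto
      also have "\<dots> = 16 * K\<^sup>2 * (h / v) powr (1/2)"
        by (simp add: power_mult_distrib power2_eq_square flip: powr_add)
      also have "(h / v) powr (1/2) = h powr (1/2) * v powr (-1/2)"
        using v h by (simp add: powr_divide powr_minus_divide)
      finally show ?thesis using True by (simp add: mult_ac ennreal_leI)
    qed simp
  qed
  also have "\<dots> \<le> (\<integral>\<^sup>+v. ennreal (indicator {0..h} v * (16 * K\<^sup>2 * h powr (1/2) * v powr (-1/2))) \<partial>lborel)"
    by (subst nn_integral_restrict_space) (auto intro!: nn_integral_mono simp: indicator_def)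
  also have "\<dots> = ennreal (16 * K\<^sup>2 * h powr (1/2) * (h powr (-1/2 + 1) / (-1/2 + 1)))"
    using nn_integral_has_integral_lebesgue[OF _ int] by simp
  also have "h powr (1/2) * h powr (-1/2 + 1) = h"
    using h by (simp flip: powr_add)
  then have "16 * K\<^sup>2 * h powr (1/2) * (h powr (-1/2 + 1) / (-1/2 + 1)) = 32 * K\<^sup>2 * h" by simp
  finally show ?thesis .
qed

lemma tail_right:
  assumes h: "0 < h" "h \<le> 1/2"
  shows "(\<integral>\<^sup>+v. ennreal ((q v - q (1 - h))\<^sup>2) * indicator {1 - h..1} v \<partial>unif) \<le> ennreal (32 * K\<^sup>2 * h)"
proof -
  have "(\<integral>\<^sup>+v. ennreal ((q v - q (1 - h))\<^sup>2) * indicator {1 - h..1} v \<partial>unif) =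
      (\<integral>\<^sup>+v. ennreal ((q (1 - v) - q (1 - h))\<^sup>2) * indicator {1 - h..1} (1 - v) \<partial>unif)"
    by (rule nn_integral_unif_reflect[symmetric]) measurable
  also have "\<dots> = (\<integral>\<^sup>+v. ennreal ((- q (1 - h) - (- q (1 - v)))\<^sup>2) * indicator {0..h} v \<partial>unif)"
    by (intro nn_integral_cong) (auto simp: indicator_def)
  also have "\<dots> \<le> ennreal (32 * K\<^sup>2 * h)"
    using lc_density_quantile.tail_left[OF reflect h] by (simp add: K_reflect)
  finally show ?thesis .
qed

lemma tails:
  fixes h :: real
  assumes h: "0 < h" "h \<le> 1/2"
  shows "(\<integral>\<^sup>+v. ennreal ((q v - max (q h) (min (q v) (q (1 - h))))\<^sup>2) \<partial>unif) \<le> ennreal (64 * K\<^sup>2 * h)"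
proof -
  have "(\<integral>\<^sup>+v. ennreal ((q v - max (q h) (min (q v) (q (1 - h))))\<^sup>2) \<partial>unif)
      \<le> (\<integral>\<^sup>+v. (ennreal ((q h - q v)\<^sup>2) * indicator {0..h} v + ennreal ((q v - q (1 - h))\<^sup>2) * indicator {1 - h..1} v) \<partial>unif)"
  proof (rule nn_integral_mono)
    fix v assume "v \<in> space unif"
    then have v: "0 < v" "v < 1" by auto
    consider "v \<le> h" | "h < v" "v < 1 - h" | "1 - h \<le> v" by linarith
    then show "ennreal ((q v - max (q h) (min (q v) (q (1 - h))))\<^sup>2)
      \<le> ennreal ((q h - q v)\<^sup>2) * indicator {0..h} v + ennreal ((q v - q (1 - h))\<^sup>2) * indicator {1 - h..1} v"
    proof cases
      case 1
      then have "max (q h) (min (q v) (q (1 - h))) = q h"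
        using v h q_le_iff[of v h] q_le_iff[of v "1 - h"] by simp
      then show ?thesis using 1 v by (simp add: power2_commute)
    next
      case 2
      then have "max (q h) (min (q v) (q (1 - h))) = q v"
        using v h q_le_iff[of h v] q_le_iff[of v "1 - h"] by simp
      then show ?thesis by simp
    next
      case 3
      then have "max (q h) (min (q v) (q (1 - h))) = q (1 - h)"
        using v h q_le_iff[of h "1 - h"] q_le_iff[of "1 - h" v] by simp
      then show ?thesis using 3 v by simp
    qed
  qed
  also have "\<dots> = (\<integral>\<^sup>+v. ennreal ((q h - q v)\<^sup>2) * indicator {0..h} v \<partial>unif)
      + (\<integral>\<^sup>+v. ennreal ((q v - q (1 - h))\<^sup>2) * indicator {1 - h..1} v \<partial>unif)"
    by (rule nn_integral_add) auto
  also have "\<dots> \<le> ennreal (32 * K\<^sup>2 * h) + ennreal (32 * K\<^sup>2 * h)"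
    by (intro add_mono tail_left tail_right h)
  also have "\<dots> = ennreal (64 * K\<^sup>2 * h)"
    using h by (simp flip: ennreal_plus)
  finally show ?thesis .
qed

text \<open>For \<open>h = 1/2\<close> both truncation points coincide with the median, and the tail
  bound controls all of \<open>q\<close>.\<close>

lemma q_sq_integrable: "sq_integrable q"
proof -
  have m: "max (q (1/2)) (min (q v) (q (1 - 1/2))) = q (1/2)" for v by (simp add: max_def min_def)
  have "sq_integrable (\<lambda>v. q v - q (1/2))"
    using tails[of "1/2"] unfolding m by (intro sq_integrableI) (auto intro: le_less_trans)
  from sq_integrable_lincomb[OF this sq_integrable_const[of "q (1/2)"], of 1 1] show ?thesis by simp
qed

text \<open>Since \<open>q\<close> has slope at least \<open>K\<close>, all quantiles of level below
  1/4, or all those of level above 3/4, are at distance at least \<open>K / 4\<close> from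
  \<open>m\<close>, depending on the side of \<open>m\<close> on which the median lies. Such a set
  has mass 1/4, and \<open>1/4 * (K / 4)\<^sup>2 = K\<^sup>2 / 64\<close>.\<close>

lemma K_sq_le:
  "K\<^sup>2 \<le> 64 * (\<integral>v. (q v - m)\<^sup>2 \<partial>unif)"
proof -
  define S :: "real set" where "S = (if q (1/2) \<le> m then {0<..<1/4} else {3/4<..<1})"
  have S: "S \<in> sets unif" "measure unif S = 1/4" "S \<inter> {0<..<1} = S"
  proof -
    show "S \<in> sets unif"
      by (auto simp: S_def sets_restrict_space intro!: image_eqI[of _ _ S])
    have "measure unif S = measure lborel S"
      by (rule measure_restrict_space) (auto simp: S_def)
    then show "measure unif S = 1/4" by (simp add: S_def)
    show "S \<inter> {0<..<1} = S" by (auto simp: S_def)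
  qed
  have sq: "sq_integrable (\<lambda>v. q v - m)"
    by (intro sq_integrable_diff q_sq_integrable sq_integrable_const)
  have "K\<^sup>2 / 16 * measure unif S = (\<integral>v. indicator S v * (K\<^sup>2 / 16) \<partial>unif)"
    using S by simp
  also have "\<dots> \<le> (\<integral>v. (q v - m)\<^sup>2 \<partial>unif)"
  proof (rule integral_mono)
    show "integrable unif (\<lambda>v. indicator S v * (K\<^sup>2 / 16))"
      using S by (intro integrable_mult_left integrable_real_indicator) (auto simp: unif.emeasure_eq_measure)
    show "integrable unif (\<lambda>v. (q v - m)\<^sup>2)" using sq by (simp add: sq_integrable_def)
    fix v assume "v \<in> space unif"
    then have v: "0 < v" "v < 1" by auto
    show "indicator S v * (K\<^sup>2 / 16) \<le> (q v - m)\<^sup>2"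
    proof (cases "v \<in> S")
      case True
      have "K / 4 \<le> \<bar>q v - m\<bar>"
      proof (cases "q (1/2) \<le> m")
        case True
        have "K * (1/4) \<le> K * (1/2 - v)" using \<open>v \<in> S\<close> True K_pos by (intro mult_left_mono) (auto simp: S_def)
        also have "\<dots> \<le> q (1/2) - q v" using \<open>v \<in> S\<close> True v by (intro spread_ge) (auto simp: S_def)
        finally show ?thesis using True by linarith
      next
        case False
        have "K * (1/4) \<le> K * (v - 1/2)" using \<open>v \<in> S\<close> False K_pos by (intro mult_left_mono) (auto simp: S_def)
        also have "\<dots> \<le> q v - q (1/2)" using \<open>v \<in> S\<close> False v by (intro spread_ge) (auto simp: S_def)
        finally show ?thesis using False by linarith
      qed
      then have "(K / 4)\<^sup>2 \<le> \<bar>q v - m\<bar>\<^sup>2" using K_pos by (intro power_mono) auto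
      then show ?thesis using True by (simp add: power_divide)
    qed simp
  qed
  finally show ?thesis using S by simp
qed

end

section \<open>A negative Sobolev bound for the transport cost\<close>

text \<open>The integral of the distance to \<open>x\<close> over the points between
  \<open>x\<close> and \<open>y\<close>. The intervals are half-open to match the comparison of a
  level with two quantiles; end points carry no mass.\<close>

lemma nn_integral_dist_between:
  fixes x y :: real
  shows "(\<integral>\<^sup>+s. ennreal (\<bar>s - x\<bar> * indicator {s. x \<le> s \<and> s < y \<or> y \<le> s \<and> s < x} s) \<partial>lborel)
    = ennreal ((x - y)\<^sup>2 / 2)"
proof (cases "x \<le> y")
  case True
  have d: "((\<lambda>s. (s - x)\<^sup>2 / 2) has_real_derivative (s - x)) (at s)" for s
    by (auto intro!: derivative_eq_intros)
  have "(\<integral>\<^sup>+s. ennreal (\<bar>s - x\<bar> * indicator {s. x \<le> s \<and> s < y \<or> y \<le> s \<and> s < x} s) \<partial>lborel)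
      = (\<integral>\<^sup>+s. ennreal (s - x) * indicator {x..y} s \<partial>lborel)"
    using AE_lborel_singleton[of y] True
    by (intro nn_integral_cong_AE) (auto elim!: eventually_mono simp: indicator_def)
  also have "\<dots> = ennreal ((y - x)\<^sup>2 / 2 - (x - x)\<^sup>2 / 2)"
    by (rule nn_integral_FTC_Icc[OF _ d]) (use True in auto)
  finally show ?thesis by (simp add: power2_commute)
next
  case False
  have d: "((\<lambda>s. - (x - s)\<^sup>2 / 2) has_real_derivative (x - s)) (at s)" for s
    by (auto intro!: derivative_eq_intros simp: field_simps)
  have "(\<integral>\<^sup>+s. ennreal (\<bar>s - x\<bar> * indicator {s. x \<le> s \<and> s < y \<or> y \<le> s \<and> s < x} s) \<partial>lborel)
      = (\<integral>\<^sup>+s. ennreal (x - s) * indicator {y..x} s \<partial>lborel)"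
    using AE_lborel_singleton[of x] False
    by (intro nn_integral_cong_AE) (auto elim!: eventually_mono simp: indicator_def)
  also have "\<dots> = ennreal (- (x - x)\<^sup>2 / 2 - - (x - y)\<^sup>2 / 2)"
    by (rule nn_integral_FTC_Icc[OF _ d]) (use False in auto)
  finally show ?thesis by simp
qed

context lc_density_quantile
begin

definition clamp :: "real \<Rightarrow> real \<Rightarrow> real" where
  "clamp h x = max (q h) (min x (q (1 - h)))"

text \<open>The weight 1 / f in quantile coordinates, cut off outside the central levels; also the
  Jacobian of the substitution \<open>s = q w\<close>.\<close>

definition trunc_deriv :: "real \<Rightarrow> real \<Rightarrow> real" where
  "trunc_deriv h w = (if w \<in> {h..1 - h} then 1 / I w else 0)"

lemma clamp_measurable [measurable]: "clamp h \<in> borel_measurable borel"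
  unfolding clamp_def[abs_def] by measurable

lemma clamp_mono: "x \<le> y \<Longrightarrow> clamp h x \<le> clamp h y"
  by (auto simp: clamp_def)

lemma I_measurable [measurable]: "I \<in> borel_measurable unif"
proof -
  have 1: "(borel_measurable unif :: (real \<Rightarrow> real) set) = borel_measurable (restrict_space borel {0<..<1})"
    by (rule measurable_cong_sets) (auto simp: sets_restrict_space)
  show ?thesis
    unfolding 1 by (rule borel_measurable_continuous_on_restrict[OF continuous_I])
qed

lemma id_measurable_unif [measurable]: "(\<lambda>v. v) \<in> borel_measurable unif"
  by (rule measurable_restrict_space1) simp

lemma trunc_deriv_measurable [measurable]: "trunc_deriv h \<in> borel_measurable unif"
  unfolding trunc_deriv_def[abs_def] atLeastAtMost_iff by measurable

context
  fixes h :: real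
  assumes h: "0 < h" "h \<le> 1/2"
begin

lemma q_ends: "q h \<le> q (1 - h)"
  using h by (simp add: q_le_iff)

lemma clamp_bounds: "q h \<le> clamp h x" "clamp h x \<le> q (1 - h)"
  using q_ends by (auto simp: clamp_def)

lemma trunc_deriv_nonneg: "0 \<le> trunc_deriv h w"
  using pos[of w] h by (auto simp: trunc_deriv_def intro: less_imp_le)

lemma clamp_q: "w \<in> {h..1 - h} \<Longrightarrow> clamp h (q w) = q w"
  using h by (auto simp: clamp_def q_le_iff max_def min_def)

lemma nn_integral_quantile_subst:
  assumes [measurable]: "g \<in> borel_measurable borel"
  shows "(\<integral>\<^sup>+s. ennreal (g s * indicator {q h..q (1 - h)} s) \<partial>lborel) = (\<integral>\<^sup>+w. ennreal (g (q w) * trunc_deriv h w) \<partial>unif)"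
proof -
  have sub: "{h..1 - h} \<subseteq> {0<..<1}" using h by auto
  have "(\<integral>\<^sup>+s. ennreal (g s * indicator {q h..q (1 - h)} s) \<partial>lborel) =
      (\<integral>\<^sup>+w. ennreal (g (q w) * (1 / I w) * indicator {h..1 - h} w) \<partial>lborel)"
  proof (rule nn_integral_substitution[where g=q and f=g and g'="\<lambda>v. 1 / I v"])
    show "continuous_on {h..1 - h} (\<lambda>v. 1 / I v)"
      using sub pos by (intro continuous_intros continuous_on_subset[OF continuous_I]) (auto, force)
  qed (use sub dq pos h in \<open>auto simp: set_borel_measurable_def less_imp_le\<close>)
  also have "\<dots> = (\<integral>\<^sup>+w. ennreal (g (q w) * trunc_deriv h w) * indicator {0<..<1} w \<partial>lborel)"
    using h by (intro nn_integral_cong) (auto simp: trunc_deriv_def indicator_def)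
  also have "\<dots> = (\<integral>\<^sup>+w. ennreal (g (q w) * trunc_deriv h w) \<partial>unif)"
    by (subst nn_integral_restrict_space) auto
  finally show ?thesis .
qed

text \<open>
  Writing \<open>x = clamp (p v)\<close>, \<open>y = clamp (q v)\<close>, the square \<open>(x - y)\<^sup>2\<close> is twice the integral of
  \<open>|s - x|\<close> over the \<open>s\<close> between them.  For \<open>s = q w\<close> in that range, \<open>v\<close> lies between \<open>w\<close> and \<open>G s\<close>,
  and monotonicity bounds \<open>|s - x|\<close> by its value at \<open>v = w\<close>.  Integrating over \<open>v\<close> first and using
  AM-GM, half of the left-hand side is absorbed.
\<close>

lemma clamped_cost_le:
  assumes p: "mono_on {0<..<1} p" and G: "mono G"
    and pG: "\<And>v x. 0 < v \<Longrightarrow> v < 1 \<Longrightarrow> v \<le> G x \<longleftrightarrow> p v \<le> x"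
  shows "(\<integral>\<^sup>+v. ennreal ((clamp h (p v) - clamp h (q v))\<^sup>2) \<partial>unif) \<le>
    4 * (\<integral>\<^sup>+w. ennreal ((trunc_deriv h w * (G (q w) - w))\<^sup>2) \<partial>unif)"
proof -
  note [measurable] = mono_on_measurable_unif[OF p] borel_measurable_mono[OF G]
  define X Y where "X v = clamp h (p v)" and "Y v = clamp h (q v)" for v
  have [measurable]: "X \<in> borel_measurable unif" "Y \<in> borel_measurable unif"
    unfolding X_def[abs_def] Y_def[abs_def] by measurable
  define k where "k v w = ennreal (trunc_deriv h w * \<bar>q w - X v\<bar> *
      indicator {s. X v \<le> s \<and> s < Y v \<or> Y v \<le> s \<and> s < X v} (q w))" for v w
  have km[measurable]: "(\<lambda>z. k (fst z) (snd z)) \<in> borel_measurable (unif \<Otimes>\<^sub>M unif)"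
    unfolding k_def indicator_def mem_Collect_eq by measurable
  have [measurable]: "(\<lambda>z. k (snd z) (fst z)) \<in> borel_measurable (unif \<Otimes>\<^sub>M unif)"
    unfolding k_def indicator_def mem_Collect_eq by measurable
  \<comment> \<open>The integral over the points \<open>s\<close> between \<open>X v\<close> and
    \<open>Y v\<close>, substituted by \<open>s = q w\<close>. Clamping keeps \<open>s\<close>
    within the range of the substitution.\<close>
  have 1: "ennreal ((X v - Y v)\<^sup>2) = 2 * (\<integral>\<^sup>+w. k v w \<partial>unif)" for v
  proof -
    have "ennreal ((X v - Y v)\<^sup>2 / 2) = (\<integral>\<^sup>+s. ennreal (\<bar>s - X v\<bar> *
        indicator {s. X v \<le> s \<and> s < Y v \<or> Y v \<le> s \<and> s < X v} s * indicator {q h..q (1 - h)} s) \<partial>lborel)"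
      unfolding nn_integral_dist_between[symmetric]
      using clamp_bounds[of "p v"] clamp_bounds[of "q v"]
      by (intro nn_integral_cong) (auto simp: indicator_def X_def Y_def)
    also have "\<dots> = (\<integral>\<^sup>+w. k v w \<partial>unif)"
      unfolding k_def by (subst nn_integral_quantile_subst) (auto simp: mult_ac)
    finally have "(\<integral>\<^sup>+w. k v w \<partial>unif) = ennreal ((X v - Y v)\<^sup>2 / 2)" by simp
    moreover have "ennreal ((X v - Y v)\<^sup>2) = ennreal 2 * ennreal ((X v - Y v)\<^sup>2 / 2)"
      by (subst ennreal_mult[symmetric]) auto
    ultimately show ?thesis by simp
  qed
  have 2: "2 * (\<integral>\<^sup>+v. k v w \<partial>unif) \<le>
      2 * ennreal ((trunc_deriv h w * (G (q w) - w))\<^sup>2) + ennreal ((X w - Y w)\<^sup>2 / 2)" if w: "0 < w" "w < 1" for w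
  proof (cases "w \<in> {h..1 - h}")
    case False
    then have "trunc_deriv h w = 0" by (auto simp: trunc_deriv_def)
    then show ?thesis by (simp add: k_def)
  next
    case True
    have Yw: "Y w = q w" using clamp_q[OF True] by (simp add: Y_def)
    \<comment> \<open>The levels between \<open>w\<close> and \<open>G (q w)\<close>, an interval of
      length \<open>\<bar>G (q w) - w\<bar>\<close>. Its half-open shape follows the two ways in
      which \<open>q w\<close> can separate \<open>X v\<close> from \<open>Y v\<close>.\<close>
    define T where "T = (if w \<le> G (q w) then {w<..G (q w)} else {G (q w)<..w})"
    have kT: "k v w \<le> ennreal (trunc_deriv h w * \<bar>q w - X w\<bar>) * indicator T v" if v: "0 < v" "v < 1" for v
    proof -
      have "\<bar>q w - X v\<bar> \<le> \<bar>q w - X w\<bar> \<and> v \<in> T" if "X v \<le> q w \<and> q w < Y v \<or> Y v \<le> q w \<and> q w < X v"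
        using that
      proof
        assume A: "X v \<le> q w \<and> q w < Y v"
        have wv: "w < v"
        proof (rule ccontr)
          assume "\<not> w < v"
          then have "Y v \<le> Y w" using v w unfolding Y_def by (intro clamp_mono) (simp add: q_le_iff)
          then show False using A Yw by simp
        qed
        then have "X w \<le> X v" using mono_onD[OF p, of w v] v w unfolding X_def by (intro clamp_mono) auto
        moreover have "p v \<le> q w"
          using A clamp_bounds(2)[of "q v"] by (auto simp: X_def Y_def clamp_def)
        then have "v \<le> G (q w)" using pG[OF v] by simp
        ultimately show ?thesis using A wv by (auto simp: T_def)
      next
        assume A: "Y v \<le> q w \<and> q w < X v"
        have wv: "v \<le> w"
        proof (rule ccontr)
          assume "\<not> v \<le> w"
          then have "q w < q v" using strict[of w v] v w by simp
          \<comment> \<open>As \<open>q w\<close> is strictly below the upper truncation point,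
            clamping \<open>q v\<close> cannot bring \<open>Y v\<close> down to
            \<open>q w\<close>.\<close>
          moreover have "q w < q (1 - h)" using A clamp_bounds(2)[of "p v"] by (simp add: X_def)
          ultimately have "q w < Y v" by (auto simp: Y_def clamp_def)
          then show False using A by simp
        qed
        then have "X v \<le> X w" using mono_onD[OF p, of v w] v w unfolding X_def by (intro clamp_mono) auto
        moreover have "q w < p v"
          using A clamp_bounds(1)[of "q v"] by (auto simp: X_def Y_def clamp_def)
        then have "G (q w) < v" using pG[OF v, of "q w"] by simp
        ultimately show ?thesis using A wv by (auto simp: T_def)
      qed
      then show ?thesis
        using trunc_deriv_nonneg[of w] unfolding k_def
        by (auto simp: indicator_def intro!: ennreal_leI mult_left_mono)
    qed
    have "(\<integral>\<^sup>+v. k v w \<partial>unif) \<le> (\<integral>\<^sup>+v. ennreal (trunc_deriv h w * \<bar>q w - X w\<bar>) * indicator T v \<partial>unif)"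
      using kT by (intro nn_integral_mono) auto
    also have "\<dots> \<le> (\<integral>\<^sup>+v. ennreal (trunc_deriv h w * \<bar>q w - X w\<bar>) * indicator T v \<partial>lborel)"
      by (subst nn_integral_restrict_space) (auto intro!: nn_integral_mono simp: indicator_def)
    also have "\<dots> = ennreal (trunc_deriv h w * \<bar>q w - X w\<bar> * \<bar>G (q w) - w\<bar>)"
      using trunc_deriv_nonneg[of w]
      by (subst nn_integral_cmult_indicator) (auto simp: T_def ennreal_mult mult_ac)
    finally have "2 * (\<integral>\<^sup>+v. k v w \<partial>unif) \<le> ennreal 2 * ennreal (trunc_deriv h w * \<bar>q w - X w\<bar> * \<bar>G (q w) - w\<bar>)"
      by (simp add: mult_left_mono)
    also have "\<dots> = ennreal (2 * (trunc_deriv h w * \<bar>q w - X w\<bar> * \<bar>G (q w) - w\<bar>))"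
      using trunc_deriv_nonneg[of w] by (intro ennreal_mult[symmetric]) auto
    \<comment> \<open>AM-GM as \<open>2 * a * b \<le> 2 * a\<^sup>2 + b\<^sup>2 / 2\<close>: the
      coefficient of \<open>b\<^sup>2\<close> is below 1, so after integration this term can be
      absorbed into the left-hand side.\<close>
    also have "\<dots> \<le> ennreal (2 * (trunc_deriv h w * (G (q w) - w))\<^sup>2 + (X w - Y w)\<^sup>2 / 2)"
    proof (rule ennreal_leI)
      let ?a = "trunc_deriv h w * \<bar>G (q w) - w\<bar>" and ?b = "\<bar>X w - Y w\<bar>"
      have "0 \<le> (2 * ?a - ?b)\<^sup>2 / 2" by simp
      also have "\<dots> = 2 * ?a\<^sup>2 + ?b\<^sup>2 / 2 - 2 * (?a * ?b)"
        by (simp add: power2_eq_square algebra_simps add_divide_distrib diff_divide_distrib)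
      finally have "2 * (?a * ?b) \<le> 2 * ?a\<^sup>2 + ?b\<^sup>2 / 2" by simp
      moreover have "?a\<^sup>2 = (trunc_deriv h w * (G (q w) - w))\<^sup>2" by (simp add: power_mult_distrib)
      moreover have "?a * ?b = trunc_deriv h w * \<bar>q w - X w\<bar> * \<bar>G (q w) - w\<bar>"
        by (simp add: Yw abs_minus_commute)
      ultimately show "2 * (trunc_deriv h w * \<bar>q w - X w\<bar> * \<bar>G (q w) - w\<bar>)
          \<le> 2 * (trunc_deriv h w * (G (q w) - w))\<^sup>2 + (X w - Y w)\<^sup>2 / 2" by simp
    qed
    also have "\<dots> = 2 * ennreal ((trunc_deriv h w * (G (q w) - w))\<^sup>2) + ennreal ((X w - Y w)\<^sup>2 / 2)"
      by (subst ennreal_plus) (auto simp: ennreal_mult)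
    finally show ?thesis .
  qed
  interpret UU: pair_sigma_finite unif unif ..
  let ?A = "\<integral>\<^sup>+v. ennreal ((X v - Y v)\<^sup>2) \<partial>unif" and ?B = "\<integral>\<^sup>+w. ennreal ((trunc_deriv h w * (G (q w) - w))\<^sup>2) \<partial>unif"
  have "?A = (\<integral>\<^sup>+v. 2 * (\<integral>\<^sup>+w. k v w \<partial>unif) \<partial>unif)" by (simp only: 1)
  also have "\<dots> = 2 * (\<integral>\<^sup>+v. \<integral>\<^sup>+w. k v w \<partial>unif \<partial>unif)"
    by (rule nn_integral_cmult) measurable
  also have "(\<integral>\<^sup>+v. \<integral>\<^sup>+w. k v w \<partial>unif \<partial>unif) = (\<integral>\<^sup>+w. \<integral>\<^sup>+v. k v w \<partial>unif \<partial>unif)"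
    using km by (intro UU.Fubini'[of k, symmetric]) (simp only: case_prod_beta')
  also have "2 * \<dots> = (\<integral>\<^sup>+w. 2 * (\<integral>\<^sup>+v. k v w \<partial>unif) \<partial>unif)"
    by (rule nn_integral_cmult[symmetric]) measurable
  also have "\<dots> \<le> (\<integral>\<^sup>+w. 2 * ennreal ((trunc_deriv h w * (G (q w) - w))\<^sup>2) + ennreal ((X w - Y w)\<^sup>2 / 2) \<partial>unif)"
    using 2 by (intro nn_integral_mono) auto
  also have "\<dots> = 2 * ?B + (\<integral>\<^sup>+w. ennreal ((X w - Y w)\<^sup>2 / 2) \<partial>unif)"
    by (subst nn_integral_add) (auto simp: nn_integral_cmult)
  finally have le: "?A \<le> 2 * ?B + (\<integral>\<^sup>+w. ennreal ((X w - Y w)\<^sup>2 / 2) \<partial>unif)" .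
  \<comment> \<open>Clamped values lie in a bounded interval, so \<open>?A\<close> is finite, and
    half of it may be subtracted from both sides.\<close>
  have "?A \<le> (\<integral>\<^sup>+v. ennreal ((q (1 - h) - q h)\<^sup>2) \<partial>unif)"
  proof (intro nn_integral_mono ennreal_leI)
    fix v
    have "\<bar>X v - Y v\<bar> \<le> q (1 - h) - q h"
      using clamp_bounds[of "p v"] clamp_bounds[of "q v"] unfolding X_def Y_def by linarith
    then have "\<bar>X v - Y v\<bar>\<^sup>2 \<le> (q (1 - h) - q h)\<^sup>2" by (intro power_mono) auto
    then show "(X v - Y v)\<^sup>2 \<le> (q (1 - h) - q h)\<^sup>2" by simp
  qed
  also have "\<dots> < \<infinity>" by (simp add: unif.emeasure_space_1[simplified])
  finally have fin: "sq_integrable (\<lambda>v. X v - Y v)" by (intro sq_integrableI) auto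
  define a where "a = sq_dist X Y"
  have a: "?A = ennreal a" "0 \<le> a" using nn_integral_sq[OF fin] by (auto simp: a_def)
  have a2: "(\<integral>\<^sup>+w. ennreal ((X w - Y w)\<^sup>2 / 2) \<partial>unif) = ennreal (a / 2)"
    using fin by (subst nn_integral_eq_integral) (auto simp: sq_integrable_def a_def)
  have "?A \<le> 4 * ?B"
  proof (cases ?B)
    case (real b)
    have "ennreal a \<le> ennreal 2 * ennreal b + ennreal (a / 2)" using le unfolding a a2 real by simp
    also have "\<dots> = ennreal (2 * b + a / 2)" using real a by (simp add: ennreal_mult ennreal_plus)
    finally have "a \<le> 4 * b" using real a by (subst (asm) ennreal_le_iff) auto
    then have "ennreal a \<le> ennreal (4 * b)" by (rule ennreal_leI)
    then show ?thesis unfolding a real using real by (simp add: ennreal_mult)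
  qed (simp add: ennreal_mult_top)
  then show ?thesis by (simp add: X_def Y_def)
qed

end

end

section \<open>Empirical measures\<close>

abbreviation index_law :: "nat \<Rightarrow> nat measure" where
  "index_law n \<equiv> measure_pmf (pmf_of_set {1..n})"

lemma nn_integral_index_law:
  assumes "1 \<le> n"
  shows "(\<integral>\<^sup>+i. f i \<partial>index_law n) = ennreal (1 / real n) * (\<Sum>i=1..n. f i)"
  using assms by (subst nn_integral_pmf_of_set)
    (auto simp: divide_ennreal_def mult.commute ennreal_of_nat_eq_real_of_nat inverse_ennreal inverse_eq_divide)

text \<open>Drawing an index uniformly makes the empirical measure an image measure, and a common
  index couples two samples of the same size.\<close>

lemma empirical_measure_eq_distr:
  assumes "1 \<le> n" shows "empirical_measure n x = distr (index_law n) borel x"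
proof (rule measure_eqI)
  fix A assume "A \<in> sets (empirical_measure n x)"
  then have A: "A \<in> sets borel" by simp
  have "emeasure (distr (index_law n) borel x) A = (\<integral>\<^sup>+i. indicator A (x i) \<partial>index_law n)"
    using A by (subst nn_integral_indicator[symmetric], simp, subst nn_integral_distr) auto
  also have "\<dots> = emeasure (empirical_measure n x) A"
    using A by (simp only: nn_integral_index_law[OF assms] emeasure_empirical_measure emeasure_return sum_distrib_left)
  finally show "emeasure (empirical_measure n x) A = emeasure (distr (index_law n) borel x) A" ..
qed simp

lemma prob_space_empirical_measure:
  assumes "1 \<le> n" shows "prob_space (empirical_measure n x)"
  unfolding empirical_measure_eq_distr[OF assms]
  by (intro prob_space.prob_space_distr measure_pmf.prob_space_axioms) simp

lemma nn_integral_empirical_measure: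
  assumes "1 \<le> n" "f \<in> borel_measurable borel"
  shows "(\<integral>\<^sup>+y. f y \<partial>empirical_measure n x) = ennreal (1 / real n) * (\<Sum>i=1..n. f (x i))"
  unfolding empirical_measure_eq_distr[OF assms(1)] nn_integral_index_law[OF assms(1), symmetric]
  using assms(2) by (intro nn_integral_distr) auto

lemma transport_cost_empirical_le:
  assumes "1 \<le> n"
  shows "transport_cost (empirical_measure n x) (empirical_measure n y)
    \<le> ennreal (1 / real n) * (\<Sum>i=1..n. ennreal ((x i - y i)\<^sup>2))"
  unfolding empirical_measure_eq_distr[OF assms] nn_integral_index_law[OF assms, symmetric]
  by (intro transport_cost_distr_le measure_pmf.prob_space_axioms) auto

lemma cdf_empirical_measure:
  assumes "1 \<le> n"
  shows "cdf (empirical_measure n x) s = (\<Sum>i=1..n. indicator {..s} (x i)) / real n"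
proof -
  have "emeasure (empirical_measure n x) {..s} = ennreal (1 / real n) * (\<Sum>i=1..n. ennreal (indicator {..s} (x i)))"
    using nn_integral_empirical_measure[OF assms, of "indicator {..s}" x] by (simp add: ennreal_indicator)
  also have "\<dots> = ennreal ((\<Sum>i=1..n. indicator {..s} (x i)) / real n)"
    by (subst sum_ennreal, simp, subst ennreal_mult[symmetric]) (auto intro!: sum_nonneg)
  finally show ?thesis
    unfolding cdf_def measure_def by (simp add: sum_nonneg)
qed

section \<open>Sums and averages over independent samples\<close>

lemma second_moment_iid_sum:
  fixes g :: "real \<Rightarrow> real"
  assumes "prob_space \<mu>" "sets \<mu> = sets borel" and [measurable]: "g \<in> borel_measurable borel"
    and bd: "\<And>x. \<bar>g x\<bar> \<le> 1" and mean: "(\<integral>x. g x \<partial>\<mu>) = 0"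
  shows "(\<integral>x. (\<Sum>i=1..n. g (x i))\<^sup>2 \<partial>iid_law n \<mu>) = real n * (\<integral>x. (g x)\<^sup>2 \<partial>\<mu>)"
proof -
  interpret \<mu>: prob_space \<mu> by fact
  note [measurable_cong] = assms(2)
  interpret PS: product_prob_space "\<lambda>_::nat. \<mu>" "{1..n}" ..
  have int: "integrable \<mu> (\<lambda>x. g x ^ k)" for k
    by (intro \<mu>.integrable_const_bound[where B=1]) (auto simp: power_abs power_le_one bd)
  have prod: "(\<Prod>k\<in>{1..n}. if k = i then a k else if k = j then b k else 1) = (if i = j then a i else a i * b j)"
    if "i \<in> {1..n}" "j \<in> {1..n}" for i j and a b :: "nat \<Rightarrow> real"
  proof (cases "i = j")
    case True
    then show ?thesis using that by (simp add: prod.delta' if_distrib cong: if_cong)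
  next
    case False
    have "(\<Prod>k\<in>{1..n}. if k = i then a k else if k = j then b k else 1) =
        a i * (\<Prod>k\<in>{1..n} - {i}. if k = j then b k else 1)"
      using that by (subst prod.remove[of _ i]) (auto intro!: arg_cong2[where f="(*)"] prod.cong)
    also have "\<dots> = a i * b j" using that False by (simp add: prod.delta)
    finally show ?thesis using False by simp
  qed
  \<comment> \<open>Independence factorizes the expectation, and a coordinate that occurs once
    contributes the mean 0.\<close>
  have cross: "(\<integral>x. g (x i) * g (x j) \<partial>iid_law n \<mu>) = (if i = j then (\<integral>x. (g x)\<^sup>2 \<partial>\<mu>) else 0)"
    if ij: "i \<in> {1..n}" "j \<in> {1..n}" for i j
  proof -
    \<comment> \<open>Exponents 2, 1 or 0 write \<open>g (x i) * g (x j)\<close> as a product over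
      all coordinates, so that one product formula covers the diagonal and the off-diagonal
      terms.\<close>
    let ?e = "\<lambda>k. if k = i then (if i = j then 2 else 1) else if k = j then 1 else (0::nat)"
    have "(\<integral>x. g (x i) * g (x j) \<partial>iid_law n \<mu>) = (\<integral>x. (\<Prod>k\<in>{1..n}. g (x k) ^ ?e k) \<partial>iid_law n \<mu>)"
    proof (rule Bochner_Integration.integral_cong[OF refl])
      fix x
      have "(\<Prod>k\<in>{1..n}. g (x k) ^ ?e k) = (\<Prod>k\<in>{1..n}. if k = i then g (x k) ^ (if i = j then 2 else 1) else if k = j then g (x k) else 1)"
        by (intro prod.cong) auto
      then show "g (x i) * g (x j) = (\<Prod>k\<in>{1..n}. g (x k) ^ ?e k)"
        using prod[OF ij, of "\<lambda>k. g (x k) ^ (if i = j then 2 else 1)" "\<lambda>k. g (x k)"]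
        by (auto simp: power2_eq_square)
    qed
    also have "\<dots> = (\<Prod>k\<in>{1..n}. \<integral>x. g x ^ ?e k \<partial>\<mu>)"
      by (rule PS.product_integral_prod) (simp, rule int)
    also have "\<dots> = (\<Prod>k\<in>{1..n}. if k = i then (\<integral>x. g x ^ (if i = j then 2 else 1) \<partial>\<mu>) else if k = j then (\<integral>x. g x \<partial>\<mu>) else 1)"
      by (intro prod.cong) (auto simp: \<mu>.prob_space)
    also have "\<dots> = (if i = j then (\<integral>x. (g x)\<^sup>2 \<partial>\<mu>) else 0)"
      using prod[OF ij, of "\<lambda>k. (\<integral>x. g x ^ (if i = j then 2 else 1) \<partial>\<mu>)" "\<lambda>k. (\<integral>x. g x \<partial>\<mu>)"] by (simp add: mean)
    finally show ?thesis .
  qed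
  have "(\<integral>x. (\<Sum>i=1..n. g (x i))\<^sup>2 \<partial>iid_law n \<mu>) = (\<integral>x. (\<Sum>i=1..n. \<Sum>j=1..n. g (x i) * g (x j)) \<partial>iid_law n \<mu>)"
    by (simp add: power2_eq_square sum_product)
  also have "\<dots> = (\<Sum>i=1..n. \<Sum>j=1..n. \<integral>x. g (x i) * g (x j) \<partial>iid_law n \<mu>)"
  proof -
    have "integrable (iid_law n \<mu>) (\<lambda>x. g (x i) * g (x j))" if "i \<in> {1..n}" "j \<in> {1..n}" for i j
      using that by (intro PS.P.integrable_const_bound[where B=1])
        (auto simp: abs_mult intro!: mult_le_one bd)
    then show ?thesis
      by (subst Bochner_Integration.integral_sum) (auto intro!: sum.cong Bochner_Integration.integral_sum)
  qed
  also have "\<dots> = (\<Sum>i=1..n. \<Sum>j=1..n. if i = j then (\<integral>x. (g x)\<^sup>2 \<partial>\<mu>) else 0)"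
    by (intro sum.cong cross refl)
  also have "\<dots> = real n * (\<integral>x. (g x)\<^sup>2 \<partial>\<mu>)" by simp
  finally show ?thesis .
qed

lemma empirical_cdf_variance:
  assumes "prob_space \<mu>" "sets \<mu> = sets borel" "1 \<le> n"
  shows "(\<integral>\<^sup>+x. ennreal ((cdf (empirical_measure n x) s - cdf \<mu> s)\<^sup>2) \<partial>iid_law n \<mu>)
    = ennreal (cdf \<mu> s * (1 - cdf \<mu> s) / real n)"
proof -
  interpret \<mu>: prob_space \<mu> by fact
  note [measurable_cong] = assms(2)
  interpret P: prob_space "iid_law n \<mu>" by (rule prob_space_PiM) (rule assms(1))
  have sp: "space \<mu> = UNIV" using sets_eq_imp_space_eq[OF assms(2)] by simp
  let ?F = "cdf \<mu> s"
  define g where "g x = indicator {..s} x - ?F" for x :: real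
  have F: "0 \<le> ?F" "?F \<le> 1" by (auto simp: cdf_def)
  have gm[measurable]: "g \<in> borel_measurable borel" unfolding g_def[abs_def] by measurable
  have ind: "integrable \<mu> (\<lambda>x. indicator {..s} x :: real)"
    by (intro integrable_real_indicator) (auto simp: assms(2) \<mu>.emeasure_eq_measure)
  have indI: "(\<integral>x. indicator {..s} x \<partial>\<mu>) = ?F" by (simp add: cdf_def sp)
  have mean: "(\<integral>x. g x \<partial>\<mu>) = 0"
    unfolding g_def using ind indI by (simp add: \<mu>.prob_space)
  have "(\<integral>x. (g x)\<^sup>2 \<partial>\<mu>) = (\<integral>x. (1 - 2 * ?F) * indicator {..s} x + ?F\<^sup>2 \<partial>\<mu>)"
    by (intro Bochner_Integration.integral_cong) (auto simp: g_def indicator_def power2_eq_square algebra_simps)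
  also have "\<dots> = ?F * (1 - ?F)"
    using ind indI by (simp add: \<mu>.prob_space power2_eq_square algebra_simps)
  finally have sq: "(\<integral>x. (g x)\<^sup>2 \<partial>\<mu>) = ?F * (1 - ?F)" .
  have bd: "\<bar>g x\<bar> \<le> 1" for x using F by (auto simp: g_def indicator_def)
  have eq: "(cdf (empirical_measure n x) s - ?F)\<^sup>2 = (\<Sum>i=1..n. g (x i))\<^sup>2 / (real n)\<^sup>2" for x
  proof -
    have "cdf (empirical_measure n x) s - ?F = (\<Sum>i=1..n. g (x i)) / real n"
      using assms(3) by (simp add: cdf_empirical_measure g_def sum_subtractf field_simps)
    then show ?thesis by (simp add: power_divide)
  qed
  have "integrable (iid_law n \<mu>) (\<lambda>x. (\<Sum>i=1..n. g (x i))\<^sup>2 / (real n)\<^sup>2)"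
  proof (intro P.integrable_const_bound[where B=1] AE_I2)
    fix x
    have "\<bar>\<Sum>i=1..n. g (x i)\<bar> \<le> (\<Sum>i=1..n. 1)"
      by (rule order_trans[OF sum_abs]) (intro sum_mono bd)
    then have "\<bar>\<Sum>i=1..n. g (x i)\<bar>\<^sup>2 \<le> (real n)\<^sup>2" by (intro power_mono) auto
    then show "norm ((\<Sum>i=1..n. g (x i))\<^sup>2 / (real n)\<^sup>2) \<le> 1"
      using assms(3) by simp
  qed measurable
  then have "(\<integral>\<^sup>+x. ennreal ((cdf (empirical_measure n x) s - ?F)\<^sup>2) \<partial>iid_law n \<mu>)
      = ennreal (\<integral>x. (\<Sum>i=1..n. g (x i))\<^sup>2 / (real n)\<^sup>2 \<partial>iid_law n \<mu>)"
    unfolding eq by (intro nn_integral_eq_integral) auto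
  also have "(\<integral>x. (\<Sum>i=1..n. g (x i))\<^sup>2 / (real n)\<^sup>2 \<partial>iid_law n \<mu>) = ?F * (1 - ?F) / real n"
    unfolding integral_divide_zero second_moment_iid_sum[OF assms(1,2) gm bd mean, of n] sq
    using assms(3) by (simp add: power2_eq_square)
  finally show ?thesis .
qed

lemma nn_integral_iid_component:
  assumes "prob_space \<mu>" "sets \<mu> = sets borel" "i \<in> {1..n}" and [measurable]: "f \<in> borel_measurable borel"
  shows "(\<integral>\<^sup>+x. f (x i) \<partial>iid_law n \<mu>) = (\<integral>\<^sup>+y. f y \<partial>\<mu>)"
proof -
  interpret prob_space \<mu> by fact
  note [measurable_cong] = assms(2)
  interpret PS: product_prob_space "\<lambda>_::nat. \<mu>" "{1..n}" ..
  have "(\<integral>\<^sup>+y. f y \<partial>\<mu>) = (\<integral>\<^sup>+y. f y \<partial>distr (iid_law n \<mu>) \<mu> (\<lambda>x. x i))"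
    using PS.PiM_component[OF assms(3)] by simp
  also have "\<dots> = (\<integral>\<^sup>+x. f (x i) \<partial>iid_law n \<mu>)"
    using assms(3) by (intro nn_integral_distr) auto
  finally show ?thesis ..
qed

lemma iid_average_measurable:
  fixes f :: "real \<Rightarrow> ennreal"
  assumes [measurable_cong]: "sets \<mu> = sets borel" and [measurable]: "f \<in> borel_measurable borel"
  shows "(\<lambda>x. c * (\<Sum>i=1..n. f (x i))) \<in> borel_measurable (iid_law n \<mu>)"
  by measurable

lemma nn_integral_iid_average:
  assumes "prob_space \<mu>" "sets \<mu> = sets borel" "1 \<le> n" and f[measurable]: "f \<in> borel_measurable borel"
  shows "(\<integral>\<^sup>+x. ennreal (1 / real n) * (\<Sum>i=1..n. f (x i)) \<partial>iid_law n \<mu>) = (\<integral>\<^sup>+y. f y \<partial>\<mu>)"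
proof -
  note [measurable_cong] = assms(2)
  have "(\<integral>\<^sup>+x. ennreal (1 / real n) * (\<Sum>i=1..n. f (x i)) \<partial>iid_law n \<mu>) =
      ennreal (1 / real n) * (\<integral>\<^sup>+x. (\<Sum>i=1..n. f (x i)) \<partial>iid_law n \<mu>)"
    by (rule nn_integral_cmult) measurable
  also have "(\<integral>\<^sup>+x. (\<Sum>i=1..n. f (x i)) \<partial>iid_law n \<mu>) = (\<Sum>i=1..n. \<integral>\<^sup>+x. f (x i) \<partial>iid_law n \<mu>)"
    by (rule nn_integral_sum) measurable
  also have "\<dots> = (\<Sum>i=1..n. \<integral>\<^sup>+y. f y \<partial>\<mu>)"
    by (intro sum.cong refl nn_integral_iid_component assms)
  also have "ennreal (1 / real n) * \<dots> = (ennreal (1 / real n) * ennreal (real n)) * (\<integral>\<^sup>+y. f y \<partial>\<mu>)"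
    by (simp add: mult.assoc ennreal_of_nat_eq_real_of_nat)
  also have "ennreal (1 / real n) * ennreal (real n) = 1"
    using assms(3) by (subst ennreal_mult[symmetric]) auto
  finally show ?thesis by simp
qed

text \<open>Counting with a conditional instead of an indicator exposes the joint dependence on
  sample and level to the measurability prover.\<close>

lemma cdf_empirical_measure_count:
  assumes "1 \<le> n"
  shows "cdf (empirical_measure n x) s = (\<Sum>i=1..n. if x i \<le> s then 1 else 0) / real n"
  unfolding cdf_empirical_measure[OF assms]
  by (intro arg_cong2[where f="(/)"] sum.cong refl) (auto simp: indicator_def)

lemma empirical_quantile:
  assumes "1 \<le> n"
  obtains p where "mono_on {0<..<1} p" "law p = empirical_measure n x"
    "\<And>v s. 0 < v \<Longrightarrow> v < 1 \<Longrightarrow> v \<le> cdf (empirical_measure n x) s \<longleftrightarrow> p v \<le> s"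
    "\<And>f. f \<in> borel_measurable borel \<Longrightarrow>
      (\<integral>\<^sup>+v. f (p v) \<partial>unif) = ennreal (1 / real n) * (\<Sum>i=1..n. f (x i))"
    "sq_integrable p"
proof -
  obtain p where p: "mono_on {0<..<1} p" "law p = empirical_measure n x"
    "\<And>v s. 0 < v \<Longrightarrow> v < 1 \<Longrightarrow> v \<le> cdf (empirical_measure n x) s \<longleftrightarrow> p v \<le> s"
    using exists_quantile[OF prob_space_empirical_measure[OF assms, of x]] by auto
  note [measurable] = mono_on_measurable_unif[OF p(1)]
  have int: "(\<integral>\<^sup>+v. f (p v) \<partial>unif) = ennreal (1 / real n) * (\<Sum>i=1..n. f (x i))"
    if [measurable]: "f \<in> borel_measurable borel" for f
  proof -
    have "(\<integral>\<^sup>+v. f (p v) \<partial>unif) = (\<integral>\<^sup>+y. f y \<partial>law p)"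
      by (rule nn_integral_distr[symmetric]) measurable
    then show ?thesis unfolding p(2) nn_integral_empirical_measure[OF assms that] .
  qed
  have "(\<integral>\<^sup>+v. ennreal ((p v)\<^sup>2) \<partial>unif) < \<infinity>"
    using int[of "\<lambda>y. ennreal (y\<^sup>2)"] by (simp add: ennreal_mult_less_top)
  then have "sq_integrable p" by (intro sq_integrableI) measurable
  with p int show ?thesis using that by blast
qed

section \<open>Expected transport cost between the empirical and the true law\<close>

context lc_density_quantile
begin

lemma cdf_distr_q:
  assumes "0 < w" "w < 1" shows "cdf (law q) (q w) = w"
proof -
  have "cdf (law q) (q w) = measure unif (q -` {..q w} \<inter> space unif)"
    unfolding cdf_def by (rule measure_distr) auto
  also have "q -` {..q w} \<inter> space unif = {0<..w}"
    using assms by (auto simp: q_le_iff)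
  also have "measure unif {0<..w} = w"
    using assms by (subst measure_restrict_space) auto
  finally show ?thesis .
qed

text \<open>Split \<open>p - q\<close> into the difference of the clamped functions and two
  truncation errors. The first costs \<open>2 * 4\<close> by \<open>clamped_cost_le\<close>, the
  error of the sample is an average over its points, and the error of \<open>q\<close> costs
  \<open>4 * 64\<close> by \<open>tails\<close>.\<close>

lemma transport_cost_empirical_split:
  assumes n: "2 \<le> n"
  defines "h \<equiv> 1 / real n"
  shows "transport_cost (empirical_measure n x) (law q) \<le>
    8 * (\<integral>\<^sup>+w. ennreal ((trunc_deriv h w * (cdf (empirical_measure n x) (q w) - w))\<^sup>2) \<partial>unif) +
    4 * (ennreal (1 / real n) * (\<Sum>i=1..n. ennreal ((x i - clamp h (x i))\<^sup>2))) + ennreal (256 * K\<^sup>2 / n)"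
proof -
  have h: "0 < h" "h \<le> 1/2" using n by (auto simp: h_def field_simps)
  have n1: "1 \<le> n" using n by simp
  interpret finite_borel_measure "empirical_measure n x"
    using prob_space_empirical_measure[OF n1, of x]
    by (intro finite_borel_measure.intro finite_borel_measure_axioms.intro) (auto simp: prob_space_def)
  obtain p where p: "mono_on {0<..<1} p" "law p = empirical_measure n x"
    "\<And>v s. 0 < v \<Longrightarrow> v < 1 \<Longrightarrow> v \<le> cdf (empirical_measure n x) s \<longleftrightarrow> p v \<le> s"
    "\<And>f. f \<in> borel_measurable borel \<Longrightarrow>
      (\<integral>\<^sup>+v. f (p v) \<partial>unif) = ennreal (1 / real n) * (\<Sum>i=1..n. f (x i))"
    using empirical_quantile[OF n1, of x] by metis
  note [measurable] = mono_on_measurable_unif[OF p(1)]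
  have "transport_cost (empirical_measure n x) (law q) = nn_sq_dist p q"
    unfolding p(2)[symmetric] by (rule transport_cost_quantiles[OF p(1) q_mono_on])
  also have "\<dots> \<le> (\<integral>\<^sup>+v. 2 * ennreal ((clamp h (p v) - clamp h (q v))\<^sup>2) +
      4 * ennreal ((p v - clamp h (p v))\<^sup>2) + 4 * ennreal ((q v - clamp h (q v))\<^sup>2) \<partial>unif)"
  proof (rule nn_integral_mono)
    fix v
    let ?a = "clamp h (p v) - clamp h (q v)" and ?b = "p v - clamp h (p v)" and ?c = "q v - clamp h (q v)"
    have "(p v - q v)\<^sup>2 \<le> 2 * ?a\<^sup>2 + 4 * ?b\<^sup>2 + 4 * ?c\<^sup>2"
    proof -
      \<comment> \<open>The parallelogram identity twice, for the pair \<open>?a\<close>,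
        \<open>?b - ?c\<close> and for the pair \<open>?b\<close>, \<open>?c\<close>; hence the
        coefficients 2 and 4.\<close>
      have "2 * ?a\<^sup>2 + 4 * ?b\<^sup>2 + 4 * ?c\<^sup>2 - (?a + (?b - ?c))\<^sup>2 = (?a - (?b - ?c))\<^sup>2 + 2 * (?b + ?c)\<^sup>2"
        by (simp add: power2_eq_square algebra_simps)
      then have "(?a + (?b - ?c))\<^sup>2 \<le> 2 * ?a\<^sup>2 + 4 * ?b\<^sup>2 + 4 * ?c\<^sup>2"
        using zero_le_power2[of "?a - (?b - ?c)"] zero_le_power2[of "?b + ?c"] by linarith
      then show ?thesis by simp
    qed
    then have "ennreal ((p v - q v)\<^sup>2) \<le> ennreal (2 * ?a\<^sup>2 + 4 * ?b\<^sup>2 + 4 * ?c\<^sup>2)" by (rule ennreal_leI)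
    also have "\<dots> = 2 * ennreal (?a\<^sup>2) + 4 * ennreal (?b\<^sup>2) + 4 * ennreal (?c\<^sup>2)"
      by (simp add: ennreal_plus ennreal_mult)
    finally show "ennreal ((p v - q v)\<^sup>2) \<le> 2 * ennreal (?a\<^sup>2) + 4 * ennreal (?b\<^sup>2) + 4 * ennreal (?c\<^sup>2)" .
  qed
  also have "\<dots> = 2 * (\<integral>\<^sup>+v. ennreal ((clamp h (p v) - clamp h (q v))\<^sup>2) \<partial>unif) +
      4 * (\<integral>\<^sup>+v. ennreal ((p v - clamp h (p v))\<^sup>2) \<partial>unif) + 4 * (\<integral>\<^sup>+v. ennreal ((q v - clamp h (q v))\<^sup>2) \<partial>unif)"
    by (simp add: nn_integral_add nn_integral_cmult)
  also have "\<dots> \<le> 2 * (4 * (\<integral>\<^sup>+w. ennreal ((trunc_deriv h w * (cdf (empirical_measure n x) (q w) - w))\<^sup>2) \<partial>unif)) +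
      4 * (ennreal (1 / real n) * (\<Sum>i=1..n. ennreal ((x i - clamp h (x i))\<^sup>2))) + 4 * ennreal (64 * K\<^sup>2 * h)"
  proof (intro add_mono mult_left_mono)
    show "(\<integral>\<^sup>+v. ennreal ((clamp h (p v) - clamp h (q v))\<^sup>2) \<partial>unif)
        \<le> 4 * (\<integral>\<^sup>+w. ennreal ((trunc_deriv h w * (cdf (empirical_measure n x) (q w) - w))\<^sup>2) \<partial>unif)"
      by (rule clamped_cost_le[OF h p(1) _ p(3)]) (auto intro: monoI cdf_nondecreasing)
    show "(\<integral>\<^sup>+v. ennreal ((p v - clamp h (p v))\<^sup>2) \<partial>unif) \<le> ennreal (1 / real n) * (\<Sum>i=1..n. ennreal ((x i - clamp h (x i))\<^sup>2))"
      using p(4)[of "\<lambda>y. ennreal ((y - clamp h y)\<^sup>2)"] by simp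
    show "(\<integral>\<^sup>+v. ennreal ((q v - clamp h (q v))\<^sup>2) \<partial>unif) \<le> ennreal (64 * K\<^sup>2 * h)"
      unfolding clamp_def by (rule tails[OF h])
  qed auto
  also have "4 * ennreal (64 * K\<^sup>2 * h) = ennreal (256 * K\<^sup>2 / n)"
    using h by (simp add: h_def flip: ennreal_mult' ennreal_numeral)
  finally show ?thesis by (simp add: mult.assoc[symmetric])
qed

lemma cdf_deviation_measurable:
  assumes n: "1 \<le> n" and [measurable_cong]: "sets \<mu> = sets borel"
  shows "(\<lambda>z. ennreal ((trunc_deriv h (snd z) * (cdf (empirical_measure n (fst z)) (q (snd z)) - snd z))\<^sup>2))
    \<in> borel_measurable (iid_law n \<mu> \<Otimes>\<^sub>M unif)"
  unfolding cdf_empirical_measure_count[OF n] by measurable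

lemma expected_cdf_deviation:
  assumes n: "2 \<le> n"
  defines "h \<equiv> 1 / real n" and "\<mu> \<equiv> law q"
  shows "(\<integral>\<^sup>+x. \<integral>\<^sup>+w. ennreal ((trunc_deriv h w * (cdf (empirical_measure n x) (q w) - w))\<^sup>2) \<partial>unif \<partial>iid_law n \<mu>)
    \<le> ennreal (K * (q (1 - h) - q h) / n)"
proof -
  have h: "0 < h" "h \<le> 1/2" using n by (auto simp: h_def field_simps)
  have n1: "1 \<le> n" using n by simp
  have ps: "prob_space \<mu>" unfolding \<mu>_def by (rule prob_space_distr_unif[OF q_mono_on])
  have s[measurable_cong]: "sets \<mu> = sets borel" by (simp add: \<mu>_def)
  interpret P: prob_space "iid_law n \<mu>" by (rule prob_space_PiM) (rule ps)
  interpret PU: pair_sigma_finite "iid_law n \<mu>" unif ..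
  note meas = cdf_deviation_measurable[OF n1 s, of h]
  have "(\<integral>\<^sup>+x. \<integral>\<^sup>+w. ennreal ((trunc_deriv h w * (cdf (empirical_measure n x) (q w) - w))\<^sup>2) \<partial>unif \<partial>iid_law n \<mu>)
      = (\<integral>\<^sup>+w. \<integral>\<^sup>+x. ennreal ((trunc_deriv h w * (cdf (empirical_measure n x) (q w) - w))\<^sup>2) \<partial>iid_law n \<mu> \<partial>unif)"
    using meas by (intro PU.Fubini'[symmetric]) (simp only: case_prod_beta')
  also have "\<dots> \<le> (\<integral>\<^sup>+w. ennreal (K / n * trunc_deriv h w) \<partial>unif)"
  proof (rule nn_integral_mono)
    fix w assume "w \<in> space unif"
    then have w: "0 < w" "w < 1" by auto
    have [measurable]: "(\<lambda>x. cdf (empirical_measure n x) (q w)) \<in> borel_measurable (iid_law n \<mu>)"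
      unfolding cdf_empirical_measure_count[OF n1] by measurable
    have "(\<integral>\<^sup>+x. ennreal ((trunc_deriv h w * (cdf (empirical_measure n x) (q w) - w))\<^sup>2) \<partial>iid_law n \<mu>)
        = ennreal ((trunc_deriv h w)\<^sup>2) * (\<integral>\<^sup>+x. ennreal ((cdf (empirical_measure n x) (q w) - w)\<^sup>2) \<partial>iid_law n \<mu>)"
      unfolding power_mult_distrib ennreal_mult[OF zero_le_power2 zero_le_power2]
      by (rule nn_integral_cmult) measurable
    also have "(\<integral>\<^sup>+x. ennreal ((cdf (empirical_measure n x) (q w) - w)\<^sup>2) \<partial>iid_law n \<mu>) = ennreal (w * (1 - w) / n)"
      using empirical_cdf_variance[OF ps s n1, of "q w"] unfolding cdf_distr_q[OF w, folded \<mu>_def] .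
    also have "ennreal ((trunc_deriv h w)\<^sup>2) * ennreal (w * (1 - w) / n) = ennreal ((trunc_deriv h w)\<^sup>2 * (w * (1 - w) / n))"
      using w by (intro ennreal_mult[symmetric]) auto
    also have "\<dots> \<le> ennreal (K / n * trunc_deriv h w)"
    proof (rule ennreal_leI)
      \<comment> \<open>The variance \<open>w * (1 - w)\<close> absorbs one of the two factors
        \<open>trunc_deriv\<close>; the other is the Jacobian, and its integral is the distance of
        two quantiles.\<close>
      have "w * (1 - w) * trunc_deriv h w \<le> K"
        using deriv_le[OF w] K_pos by (auto simp: trunc_deriv_def)
      then have "trunc_deriv h w * (w * (1 - w) * trunc_deriv h w) / n \<le> trunc_deriv h w * K / n"
        using trunc_deriv_nonneg[OF h, of w] by (intro divide_right_mono mult_left_mono) auto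
      then show "(trunc_deriv h w)\<^sup>2 * (w * (1 - w) / n) \<le> K / n * trunc_deriv h w"
        by (simp add: power2_eq_square mult_ac)
    qed
    finally show "(\<integral>\<^sup>+x. ennreal ((trunc_deriv h w * (cdf (empirical_measure n x) (q w) - w))\<^sup>2) \<partial>iid_law n \<mu>)
        \<le> ennreal (K / n * trunc_deriv h w)" .
  qed
  also have "\<dots> = (\<integral>\<^sup>+s. ennreal (K / n * indicator {q h..q (1 - h)} s) \<partial>lborel)"
    using nn_integral_quantile_subst[OF h, of "\<lambda>_. K / n"] by simp
  also have "\<dots> = (\<integral>\<^sup>+s. ennreal (K / n) * indicator {q h..q (1 - h)} s \<partial>lborel)"
    by (intro nn_integral_cong) (simp add: indicator_def)
  also have "\<dots> = ennreal (K / n) * ennreal (q (1 - h) - q h)"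
    using q_ends[OF h] by (subst nn_integral_cmult_indicator) auto
  also have "\<dots> = ennreal (K * (q (1 - h) - q h) / n)"
    using K_pos q_ends[OF h] by (subst ennreal_mult[symmetric]) auto
  finally show ?thesis .
qed

text \<open>The truncation error of the sample averages identically distributed terms, so its mean
  is the truncation error of the true law, again at most \<open>64 * K\<^sup>2 / n\<close>. Both
  tail terms together give \<open>4 * 64 + 256 = 512\<close>.\<close>

lemma expected_transport_cost:
  assumes n: "2 \<le> n"
  defines "h \<equiv> 1 / real n" and "\<mu> \<equiv> law q"
  shows "(\<integral>\<^sup>+x. transport_cost (empirical_measure n x) \<mu> \<partial>iid_law n \<mu>)
    \<le> ennreal ((8 * K * (q (1 - h) - q h) + 512 * K\<^sup>2) / n)"
proof -
  have h: "0 < h" "h \<le> 1/2" using n by (auto simp: h_def field_simps)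
  have n1: "1 \<le> n" using n by simp
  have ps: "prob_space \<mu>" unfolding \<mu>_def by (rule prob_space_distr_unif[OF q_mono_on])
  have s[measurable_cong]: "sets \<mu> = sets borel" by (simp add: \<mu>_def)
  interpret P: prob_space "iid_law n \<mu>" by (rule prob_space_PiM) (rule ps)
  let ?B = "\<lambda>x. \<integral>\<^sup>+w. ennreal ((trunc_deriv h w * (cdf (empirical_measure n x) (q w) - w))\<^sup>2) \<partial>unif"
  let ?T = "\<lambda>x. ennreal (1 / real n) * (\<Sum>i=1..n. ennreal ((x i - clamp h (x i))\<^sup>2))"
  note [measurable] = cdf_deviation_measurable[OF n1 s, of h]
  have [measurable]: "?B \<in> borel_measurable (iid_law n \<mu>)" by measurable
  have gm: "(\<lambda>y. ennreal ((y - clamp h y)\<^sup>2)) \<in> borel_measurable borel" by measurable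
  have [measurable]: "?T \<in> borel_measurable (iid_law n \<mu>)"
    by (rule iid_average_measurable[OF s gm])
  have gen: "8 * ennreal a + 4 * ennreal b + ennreal c = ennreal (8 * a + 4 * b + c)"
    if "0 \<le> a" "0 \<le> b" "0 \<le> c" for a b c
    using that by (simp add: ennreal_plus ennreal_mult)
  have lin: "(\<integral>\<^sup>+x. 8 * b x + 4 * t x + c \<partial>iid_law n \<mu>) =
      8 * (\<integral>\<^sup>+x. b x \<partial>iid_law n \<mu>) + 4 * (\<integral>\<^sup>+x. t x \<partial>iid_law n \<mu>) + c"
    if "b \<in> borel_measurable (iid_law n \<mu>)" "t \<in> borel_measurable (iid_law n \<mu>)" for b t c
    using that P.emeasure_space_1 by (simp add: nn_integral_add nn_integral_cmult)
  have T: "(\<integral>\<^sup>+x. ?T x \<partial>iid_law n \<mu>) \<le> ennreal (64 * K\<^sup>2 / n)"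
  proof -
    have "(\<integral>\<^sup>+x. ?T x \<partial>iid_law n \<mu>) = (\<integral>\<^sup>+y. ennreal ((y - clamp h y)\<^sup>2) \<partial>\<mu>)"
      by (rule nn_integral_iid_average[OF ps s n1 gm])
    also have "\<dots> = (\<integral>\<^sup>+v. ennreal ((q v - clamp h (q v))\<^sup>2) \<partial>unif)"
      unfolding \<mu>_def using gm by (intro nn_integral_distr) auto
    also have "\<dots> \<le> ennreal (64 * K\<^sup>2 * h)"
      unfolding clamp_def by (rule tails[OF h])
    finally show ?thesis by (simp add: h_def)
  qed
  have "(\<integral>\<^sup>+x. transport_cost (empirical_measure n x) \<mu> \<partial>iid_law n \<mu>)
      \<le> (\<integral>\<^sup>+x. 8 * ?B x + 4 * ?T x + ennreal (256 * K\<^sup>2 / n) \<partial>iid_law n \<mu>)"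
    unfolding \<mu>_def h_def by (intro nn_integral_mono transport_cost_empirical_split n)
  also have "\<dots> = 8 * (\<integral>\<^sup>+x. ?B x \<partial>iid_law n \<mu>) + 4 * (\<integral>\<^sup>+x. ?T x \<partial>iid_law n \<mu>) + ennreal (256 * K\<^sup>2 / n)"
    by (rule lin) measurable
  also have "\<dots> \<le> 8 * ennreal (K * (q (1 - h) - q h) / n) + 4 * ennreal (64 * K\<^sup>2 / n) + ennreal (256 * K\<^sup>2 / n)"
    using expected_cdf_deviation[OF n] T unfolding h_def \<mu>_def
    by (intro add_mono mult_left_mono) auto
  also have "\<dots> = ennreal (8 * (K * (q (1 - h) - q h) / n) + 4 * (64 * K\<^sup>2 / n) + 256 * K\<^sup>2 / n)"
    using K_pos q_ends[OF h] by (intro gen) auto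
  also have "8 * (K * (q (1 - h) - q h) / n) + 4 * (64 * K\<^sup>2 / n) + 256 * K\<^sup>2 / n
      = (8 * K * (q (1 - h) - q h) + 512 * K\<^sup>2) / n"
    by (simp add: add_divide_distrib)
  finally show ?thesis .
qed

end

section \<open>The projected empirical measure\<close>

lemma W2_squared: "(W2 \<mu> \<nu>)\<^sup>2 = transport_cost \<mu> \<nu>"
  by (cases "transport_cost \<mu> \<nu>") (auto simp: W2_def ennreal_power)

lemma W2_less_iff: "W2 a b < W2 c d \<longleftrightarrow> transport_cost a b < transport_cost c d"
  by (cases "transport_cost a b"; cases "transport_cost c d") (auto simp: W2_def ennreal_less_iff)

lemma lc_quantiles_sq_integrable:
  assumes q: "q \<in> lc_quantiles" shows "sq_integrable q"
proof (cases rule: lc_quantiles_cases[OF q, case_names const deriv])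
  case (const c)
  have "(\<integral>\<^sup>+v. ennreal ((q v)\<^sup>2) \<partial>unif) = (\<integral>\<^sup>+v. ennreal (c\<^sup>2) \<partial>unif)"
    by (intro nn_integral_cong) (simp add: const)
  then show ?thesis
    using unif.emeasure_space_1
    by (intro sq_integrableI mono_on_measurable_unif lc_quantiles_mono_on q) simp
next
  case (deriv I)
  then interpret lc_density_quantile q I by unfold_locales
  show ?thesis by (rule q_sq_integrable)
qed

lemma transport_cost_sq_integrable:
  assumes "mono_on {0<..<1} q" "sq_integrable q" "mono_on {0<..<1} r" "sq_integrable r"
  shows "transport_cost (law q) (law r) = ennreal (sq_dist q r)"
  using assms by (simp add: transport_cost_quantiles nn_integral_sq sq_integrable_diff)

lemma is_lc_projection_nonexpansive:
  assumes "is_lc_projection p q" "is_lc_projection s r" "sq_integrable p" "sq_integrable s"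
  shows "sq_dist q r \<le> sq_dist p s"
  by (rule lc_projection_nonexpansive[OF assms(1) _ assms(2) _ assms(3,4)])
    (rule lc_quantiles_sq_integrable, rule is_lc_projectionD(1), rule assms)+

text \<open>Every log-concave competitor is the law of a function in the cone, so minimizing over
  measures is minimizing over the cone. Uniqueness is nonexpansiveness at distance 0: two
  projections of the same \<open>p\<close> agree almost everywhere and have the same law.\<close>

lemma W2_proj_eq_distr:
  assumes p: "mono_on {0<..<1} p" "sq_integrable p" and q: "is_lc_projection p q"
  shows "W2_proj log_concave_dists (law p) = law q"
  unfolding W2_proj_def
proof (rule the_equality)
  note qK = is_lc_projectionD(1)[OF q] and min = is_lc_projectionD(2)[OF q]
  show "is_arg_min (\<lambda>\<nu>. W2 \<nu> (law p)) (\<lambda>\<nu>. \<nu> \<in> log_concave_dists) (law q)"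
    unfolding is_arg_min_def
  proof (intro conjI notI)
    show "law q \<in> log_concave_dists" by (rule distr_lc_quantiles[OF qK])
    assume "\<exists>\<nu>. \<nu> \<in> log_concave_dists \<and> W2 \<nu> (law p) < W2 (law q) (law p)"
    then obtain \<nu> where \<nu>: "\<nu> \<in> log_concave_dists" "W2 \<nu> (law p) < W2 (law q) (law p)"
      by blast
    obtain r where r: "r \<in> lc_quantiles" "law r = \<nu>"
      using log_concave_dists_quantile[OF \<nu>(1)] by blast
    show False
      using \<nu>(2) min[OF r(1)] unfolding r(2)[symmetric] W2_less_iff
      by (simp add: transport_cost_quantiles p(1) lc_quantiles_mono_on qK r(1))
  qed
  fix \<nu> assume "is_arg_min (\<lambda>\<nu>. W2 \<nu> (law p)) (\<lambda>\<nu>. \<nu> \<in> log_concave_dists) \<nu>"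
  then have \<nu>: "\<nu> \<in> log_concave_dists" "\<not> W2 (law q) (law p) < W2 \<nu> (law p)"
    using distr_lc_quantiles[OF qK] by (auto simp: is_arg_min_def)
  obtain r where r: "r \<in> lc_quantiles" "law r = \<nu>"
    using log_concave_dists_quantile[OF \<nu>(1)] by blast
  have "nn_sq_dist r p \<le> nn_sq_dist q p"
    using \<nu>(2) unfolding r(2)[symmetric] W2_less_iff
    by (simp add: transport_cost_quantiles p(1) lc_quantiles_mono_on qK r(1) not_less)
  then have "is_lc_projection p r"
    using min r(1) by (auto simp: is_lc_projection_def intro: order_trans)
  from is_lc_projection_nonexpansive[OF this q p(2) p(2)]
  have "sq_dist r q = 0" by (simp add: antisym)
  moreover have "sq_integrable (\<lambda>v. r v - q v)"
    by (intro sq_integrable_diff lc_quantiles_sq_integrable r qK)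
  ultimately have "AE v in unif. r v = q v"
    by (subst (asm) integral_nonneg_eq_0_iff_AE) (auto simp: sq_integrable_def)
  then show "\<nu> = law q"
    unfolding r(2)[symmetric]
    by (intro distr_cong_AE refl mono_on_measurable_unif lc_quantiles_mono_on r qK)
qed

section \<open>The loss in terms of quantile functions and its measurability\<close>

lemma sq_loss_quantiles:
  assumes q: "q \<in> lc_quantiles" and n: "1 \<le> n"
  obtains p r where "mono_on {0<..<1} p" "law p = empirical_measure n x" "sq_integrable p"
    "is_lc_projection p r" "r \<in> lc_quantiles" "sq_loss (law q) n x = ennreal (sq_dist r q)"
proof -
  obtain p where p: "mono_on {0<..<1} p" "law p = empirical_measure n x" "sq_integrable p"
    using empirical_quantile[OF n, of x] by metis
  obtain r where r: "is_lc_projection p r" using lc_projection_exists[OF p(3)] .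
  then have rK: "r \<in> lc_quantiles" by (simp add: is_lc_projection_def)
  have "sq_loss (law q) n x = ennreal (sq_dist r q)"
    unfolding sq_loss_def W2_squared p(2)[symmetric] W2_proj_eq_distr[OF p(1,3) r]
    by (intro transport_cost_sq_integrable lc_quantiles_mono_on lc_quantiles_sq_integrable rK q)
  with p r rK show ?thesis using that by blast
qed

lemma sq_loss_le_transport_cost:
  assumes "\<mu> \<in> log_concave_dists" "1 \<le> n"
  shows "sq_loss \<mu> n x \<le> transport_cost (empirical_measure n x) \<mu>"
proof -
  obtain q where q: "q \<in> lc_quantiles" "law q = \<mu>"
    using log_concave_dists_quantile[OF assms(1)] by blast
  obtain p r where p: "mono_on {0<..<1} p" "law p = empirical_measure n x" "sq_integrable p"
    and r: "is_lc_projection p r" "r \<in> lc_quantiles" "sq_loss \<mu> n x = ennreal (sq_dist r q)"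
    by (rule sq_loss_quantiles[OF q(1) assms(2), of x, unfolded q(2)])
  have "sq_dist r q \<le> sq_dist p q"
    by (intro is_lc_projection_nonexpansive r(1) is_lc_projection_self p lc_quantiles_sq_integrable q)
  then have "sq_loss \<mu> n x \<le> ennreal (sq_dist p q)"
    unfolding r(3) by (rule ennreal_leI)
  also have "\<dots> = transport_cost (empirical_measure n x) \<mu>"
    unfolding p(2)[symmetric] q(2)[symmetric]
    by (intro transport_cost_sq_integrable[symmetric] lc_quantiles_mono_on lc_quantiles_sq_integrable p q)
  finally show ?thesis .
qed

text \<open>The projections of two samples are no further apart than the samples, which are coupled
  by their common index. The weighted inequality for \<open>(a + b)\<^sup>2\<close> plays the role
  of the triangle inequality and keeps all terms squared.\<close>

lemma sq_loss_perturb: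
  assumes "\<mu> \<in> log_concave_dists" "1 \<le> n" "0 < e"
  shows "sq_loss \<mu> n y \<le> ennreal (1 + e) * sq_loss \<mu> n x +
    ennreal ((1 + 1 / e) * ((\<Sum>i=1..n. (x i - y i)\<^sup>2) / real n))"
proof -
  obtain q where q: "q \<in> lc_quantiles" "law q = \<mu>"
    using log_concave_dists_quantile[OF assms(1)] by blast
  obtain p r where p: "mono_on {0<..<1} p" "law p = empirical_measure n x" "sq_integrable p"
    and r: "is_lc_projection p r" "r \<in> lc_quantiles" "sq_loss \<mu> n x = ennreal (sq_dist r q)"
    by (rule sq_loss_quantiles[OF q(1) assms(2), of x, unfolded q(2)])
  obtain p' r' where p': "mono_on {0<..<1} p'" "law p' = empirical_measure n y" "sq_integrable p'"
    and r': "is_lc_projection p' r'" "r' \<in> lc_quantiles" "sq_loss \<mu> n y = ennreal (sq_dist r' q)"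
    by (rule sq_loss_quantiles[OF q(1) assms(2), of y, unfolded q(2)])
  let ?D = "(\<Sum>i=1..n. (x i - y i)\<^sup>2) / real n"
  have D0: "0 \<le> ?D" by (simp add: sum_nonneg)
  have "ennreal (sq_dist p p') = transport_cost (empirical_measure n x) (empirical_measure n y)"
    unfolding p(2)[symmetric] p'(2)[symmetric]
    by (intro transport_cost_sq_integrable[symmetric] p p')
  also have "\<dots> \<le> ennreal (1 / real n) * (\<Sum>i=1..n. ennreal ((x i - y i)\<^sup>2))"
    by (rule transport_cost_empirical_le[OF assms(2)])
  also have "\<dots> = ennreal ?D"
    by (subst sum_ennreal, simp, subst ennreal_mult[symmetric]) (auto intro!: sum_nonneg)
  finally have pp: "sq_dist p p' \<le> ?D" using D0 by (simp add: ennreal_le_iff)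
  have s: "sq_integrable (\<lambda>v. r v - q v)" "sq_integrable (\<lambda>v. r' v - r v)"
    by (intro sq_integrable_diff lc_quantiles_sq_integrable r r' q)+
  have rr: "sq_dist r' r \<le> ?D"
    using is_lc_projection_nonexpansive[OF r(1) r'(1) p(3) p'(3)] pp by (simp add: power2_commute)
  have "sq_dist r' q \<le> (\<integral>v. (1 + e) * (r v - q v)\<^sup>2 + (1 + 1 / e) * (r' v - r v)\<^sup>2 \<partial>unif)"
  proof (rule integral_mono)
    show "integrable unif (\<lambda>v. (r' v - q v)\<^sup>2)"
      using sq_integrable_diff[OF lc_quantiles_sq_integrable[OF r'(2)] lc_quantiles_sq_integrable[OF q(1)]]
      by (simp add: sq_integrable_def)
    show "integrable unif (\<lambda>v. (1 + e) * (r v - q v)\<^sup>2 + (1 + 1 / e) * (r' v - r v)\<^sup>2)"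
      using s by (simp add: sq_integrable_def)
    fix v
    let ?a = "r v - q v" and ?b = "r' v - r v"
    have "0 \<le> (e * ?a - ?b)\<^sup>2 / e" using assms(3) by simp
    also have "\<dots> = e * ?a\<^sup>2 + ?b\<^sup>2 / e - 2 * (?a * ?b)"
      using assms(3) by (simp add: power2_eq_square field_simps)
    finally have "2 * (?a * ?b) \<le> e * ?a\<^sup>2 + ?b\<^sup>2 / e" by simp
    moreover have "(?a + ?b)\<^sup>2 = ?a\<^sup>2 + ?b\<^sup>2 + 2 * (?a * ?b)"
      by (simp only: power2_sum mult.assoc)
    moreover have "(1 + e) * ?a\<^sup>2 + (1 + 1 / e) * ?b\<^sup>2 = ?a\<^sup>2 + ?b\<^sup>2 + (e * ?a\<^sup>2 + ?b\<^sup>2 / e)"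
      by (simp only: distrib_right) simp
    ultimately have "(?a + ?b)\<^sup>2 \<le> (1 + e) * ?a\<^sup>2 + (1 + 1 / e) * ?b\<^sup>2" by linarith
    then show "(r' v - q v)\<^sup>2 \<le> (1 + e) * ?a\<^sup>2 + (1 + 1 / e) * ?b\<^sup>2" by simp
  qed
  also have "\<dots> = (1 + e) * sq_dist r q + (1 + 1 / e) * sq_dist r' r"
    using s by (simp add: sq_integrable_def)
  also have "\<dots> \<le> (1 + e) * sq_dist r q + (1 + 1 / e) * ?D"
    using rr assms(3) by (intro add_left_mono mult_left_mono) auto
  finally have "sq_loss \<mu> n y \<le> ennreal ((1 + e) * sq_dist r q + (1 + 1 / e) * ?D)"
    unfolding r'(3) by (rule ennreal_leI)
  also have "\<dots> = ennreal (1 + e) * sq_loss \<mu> n x + ennreal ((1 + 1 / e) * ?D)"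
  proof -
    have "0 \<le> (1 + 1 / e) * ?D" using assms(3) D0 by (intro mult_nonneg_nonneg) auto
    from ennreal_plus[OF _ this] show ?thesis
      unfolding r(3) using assms(3) by (simp add: ennreal_mult)
  qed
  finally show ?thesis .
qed

lemma sq_loss_cong:
  assumes "\<And>i. i \<in> {1..n} \<Longrightarrow> x i = y i" shows "sq_loss \<mu> n x = sq_loss \<mu> n y"
proof -
  have "empirical_measure n x = empirical_measure n y"
    unfolding empirical_measure_def using assms by (intro arg_cong2[where f="measure_of UNIV"] ext sum.cong) auto
  then show ?thesis by (simp add: sq_loss_def)
qed

text \<open>
  By the perturbation bound the loss is upper semicontinuous in the sample, for the product topology
  on all real sequences.
\<close>

lemma sq_loss_measurable:
  assumes mu: "\<mu> \<in> log_concave_dists" and n: "1 \<le> n"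
  shows "sq_loss \<mu> n \<in> borel_measurable (iid_law n \<mu>)"
proof -
  have [measurable_cong]: "sets \<mu> = sets borel" using mu by (simp add: log_concave_dists_def)
  have "sq_loss \<mu> n \<in> borel_measurable borel"
  proof (rule borel_measurableI_less)
    fix c :: ennreal
    have "open {y. sq_loss \<mu> n y < c}"
    proof (subst open_subopen, intro ballI)
      fix x assume "x \<in> {y. sq_loss \<mu> n y < c}"
      then have x: "sq_loss \<mu> n x < c" by simp
      have fin: "sq_loss \<mu> n x < \<infinity>" using x by (simp add: less_le_trans)
      then obtain l where l: "0 \<le> l" "sq_loss \<mu> n x = ennreal l"
        by (cases "sq_loss \<mu> n x") auto
      obtain d where d: "l < d" "ennreal d \<le> c"
      proof (cases c)
        case (real c')
        then show ?thesis using that[of c'] x l by (simp add: ennreal_less_iff)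
      next
        case top
        then show ?thesis using that[of "l + 1"] by simp
      qed
      \<comment> \<open>Small enough that \<open>e * l \<le> (d - l) / 2\<close>, which leaves room
        below \<open>d\<close>; the summand 1 allows \<open>l = 0\<close>.\<close>
      define e where "e = (d - l) / (2 * (l + 1))"
      have e: "0 < e" using d l by (simp add: e_def)
      have el: "(1 + e) * l < d"
      proof -
        have "e * l \<le> e * (l + 1)" using e by simp
        also have "\<dots> = (d - l) / 2" unfolding e_def using l(1) by (simp add: divide_simps)
        finally show ?thesis using d by (simp add: algebra_simps)
      qed
      define T where "T = {y. (1 + 1 / e) * ((\<Sum>i=1..n. (x i - y i)\<^sup>2) / real n) < d - (1 + e) * l}"
      have "open T"
        unfolding T_def by (intro open_Collect_less continuous_intros) (use n in auto)
      moreover have "x \<in> T" using el by (simp add: T_def)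
      moreover have "T \<subseteq> {y. sq_loss \<mu> n y < c}"
      proof
        fix y assume "y \<in> T"
        then have y: "(1 + 1 / e) * ((\<Sum>i=1..n. (x i - y i)\<^sup>2) / real n) < d - (1 + e) * l" by (simp add: T_def)
        have "sq_loss \<mu> n y \<le> ennreal (1 + e) * ennreal l + ennreal ((1 + 1 / e) * ((\<Sum>i=1..n. (x i - y i)\<^sup>2) / real n))"
          using sq_loss_perturb[OF mu n e, of y x] l by simp
        also have "\<dots> = ennreal ((1 + e) * l + (1 + 1 / e) * ((\<Sum>i=1..n. (x i - y i)\<^sup>2) / real n))"
          using e l by (subst ennreal_plus) (auto simp: ennreal_mult sum_nonneg)
        also have "\<dots> < ennreal d"
          using y e l d by (intro ennreal_lessI) auto
        finally show "y \<in> {y. sq_loss \<mu> n y < c}" using d by simp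
      qed
      ultimately show "\<exists>T. open T \<and> x \<in> T \<and> T \<subseteq> {y. sq_loss \<mu> n y < c}" by blast
    qed
    then show "{y \<in> space borel. sq_loss \<mu> n y < c} \<in> sets borel" by simp
  qed
  then have m: "sq_loss \<mu> n \<in> borel_measurable (Pi\<^sub>M UNIV (\<lambda>_::nat. borel))"
    using measurable_cong_sets[OF sets_PiM_equal_borel[where 'a=nat and 'b=real] refl] by blast
  \<comment> \<open>The sample law lives on \<open>n\<close> coordinates, the topology on all
    sequences. Extension by 0 links them, and the loss depends only on the first \<open>n\<close>
    entries.\<close>
  have "(\<lambda>x i. if i \<in> {1..n} then x i else 0) \<in> iid_law n \<mu> \<rightarrow>\<^sub>M Pi\<^sub>M UNIV (\<lambda>_::nat. borel)"
  proof (rule measurable_PiM_single')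
    fix i :: nat
    show "(\<lambda>x. if i \<in> {1..n} then x i else 0) \<in> borel_measurable (iid_law n \<mu>)"
      by (cases "i \<in> {1..n}") auto
  qed auto
  from measurable_compose[OF this m] show ?thesis
    using sq_loss_cong[of n "\<lambda>i. if i \<in> {1..n} then _ i else 0" _ \<mu>] by simp
qed

section \<open>The risk bounds\<close>

text \<open>The degenerate case: the only coupling with a point mass is the product, so the cost is
  the mean squared distance of the sample to \<open>c\<close>.\<close>

lemma expected_transport_cost_const:
  assumes "1 \<le> n"
  shows "(\<integral>\<^sup>+x. transport_cost (empirical_measure n x) (return borel c) \<partial>iid_law n (return borel c)) = 0"
proof -
  have ps: "prob_space (return borel c)" by (intro prob_space_return) simp
  have "transport_cost (empirical_measure n x) (return borel c) =
      ennreal (1 / real n) * (\<Sum>i=1..n. ennreal ((x i - c)\<^sup>2))" for x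
  proof -
    obtain p where p: "mono_on {0<..<1} p" "law p = empirical_measure n x"
      "\<And>f. f \<in> borel_measurable borel \<Longrightarrow>
        (\<integral>\<^sup>+v. f (p v) \<partial>unif) = ennreal (1 / real n) * (\<Sum>i=1..n. f (x i))"
      using empirical_quantile[OF assms, of x] by metis
    have "transport_cost (law p) (law (\<lambda>_. c)) = (\<integral>\<^sup>+v. ennreal ((p v - c)\<^sup>2) \<partial>unif)"
      by (rule transport_cost_quantiles[OF p(1)]) (simp add: mono_on_def)
    then show ?thesis
      unfolding p(2) using p(3)[of "\<lambda>y. ennreal ((y - c)\<^sup>2)"] distr_unif_const[of "\<lambda>_. c" c] by simp
  qed
  then have "(\<integral>\<^sup>+x. transport_cost (empirical_measure n x) (return borel c) \<partial>iid_law n (return borel c)) =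
      (\<integral>\<^sup>+x. ennreal (1 / real n) * (\<Sum>i=1..n. ennreal ((x i - c)\<^sup>2)) \<partial>iid_law n (return borel c))"
    by simp
  also have "\<dots> = (\<integral>\<^sup>+y. ennreal ((y - c)\<^sup>2) \<partial>return borel c)"
    by (rule nn_integral_iid_average[OF ps _ assms]) auto
  also have "\<dots> = 0" by (subst nn_integral_return) auto
  finally show ?thesis .
qed

section \<open>The scale \<open>K\<close> against standard deviation and support\<close>

lemma (in lc_density_quantile) K_sq_le_variance:
  "K\<^sup>2 \<le> 64 * (std_dev (law q))\<^sup>2"
proof -
  let ?\<mu> = "law q"
  let ?m = "prob_space.expectation ?\<mu> (\<lambda>x. x)"
  have "prob_space.variance ?\<mu> (\<lambda>x. x) = (\<integral>v. (q v - ?m)\<^sup>2 \<partial>unif)"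
    by (subst integral_distr) auto
  moreover have "0 \<le> (\<integral>v. (q v - ?m)\<^sup>2 \<partial>unif)" by simp
  ultimately show ?thesis using K_sq_le[of ?m] by (simp add: std_dev_def)
qed

text \<open>Some level below \<open>v\<close> and some level above it have quantiles in
  \<open>[a, b]\<close>; monotonicity carries the bounds to \<open>v\<close> itself.\<close>

lemma (in lc_density_quantile) in_support:
  assumes "AE x in law q. x \<in> {a..b}" "0 < v" "v < 1"
  shows "a \<le> q v" "q v \<le> b"
proof -
  have AE: "AE v in unif. q v \<in> {a..b}"
    using assms(1) by (subst (asm) AE_distr_iff) auto
  obtain u where "0 < u" "u < v" "q u \<in> {a..b}" using AE_unif_dense[OF AE, of 0 v] assms by auto
  then show "a \<le> q v" using assms strict[of u v] by auto
  obtain w where "v < w" "w < 1" "q w \<in> {a..b}" using AE_unif_dense[OF AE, of v 1] assms by auto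
  then show "q v \<le> b" using assms strict[of v w] by auto
qed

text \<open>Split at the median: either half is at most \<open>K * ln (n / 2)\<close>.\<close>

lemma (in lc_density_quantile) spread_le_ln:
  assumes n: "2 \<le> n"
  shows "q (1 - 1 / real n) - q (1 / real n) \<le> 2 * K * ln (real n)"
proof -
  have "q (1/2) - q (1 / real n) \<le> K * ln ((1/2) / (1 / real n))"
    using n by (intro spread_le_left) (auto simp: field_simps)
  moreover have "q (1 - 1 / real n) - q (1/2) \<le> K * ln ((1 - 1/2) / (1 - (1 - 1 / real n)))"
    using n by (intro spread_le_right) (auto simp: field_simps)
  moreover have "K * ln (real n / 2) \<le> K * ln (real n)"
    using n K_pos by (intro mult_left_mono) auto
  ultimately show ?thesis by simp
qed

text \<open>From \<open>n \<ge> 2\<close> comes \<open>1 \<le> 2 * ln n\<close>, which lets the tail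
  term join the logarithmic one: \<open>16 + 1024 = 1040\<close>, and the factor 64 between
  \<open>K\<^sup>2\<close> and the variance gives 66560.\<close>

lemma (in lc_density_quantile) risk_le_variance:
  assumes n: "2 \<le> n"
  defines "\<mu> \<equiv> law q"
  shows "(8 * K * (q (1 - 1 / real n) - q (1 / real n)) + 512 * K\<^sup>2) / real n
    \<le> 70000 * (std_dev \<mu>)\<^sup>2 * (ln (real n) / real n)"
proof -
  have "1/2 \<le> ln (2::real)" using ln_le_minus_one[of "1/2::real"] by (simp add: ln_div)
  also have "\<dots> \<le> ln (real n)" using n by simp
  finally have L: "1 \<le> 2 * ln (real n)" by simp
  have "8 * K * (q (1 - 1 / real n) - q (1 / real n)) \<le> 8 * K * (2 * K * ln (real n))"
    using spread_le_ln[OF n] K_pos by (intro mult_left_mono) auto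
  moreover have "512 * K\<^sup>2 * 1 \<le> 512 * K\<^sup>2 * (2 * ln (real n))"
    using L by (intro mult_left_mono) auto
  ultimately have "8 * K * (q (1 - 1 / real n) - q (1 / real n)) + 512 * K\<^sup>2 \<le> 1040 * K\<^sup>2 * ln (real n)"
    by (simp add: power2_eq_square)
  also have "\<dots> \<le> 1040 * (64 * (std_dev \<mu>)\<^sup>2) * ln (real n)"
    using K_sq_le_variance L by (intro mult_right_mono mult_left_mono) (auto simp: \<mu>_def)
  also have "\<dots> \<le> 70000 * (std_dev \<mu>)\<^sup>2 * ln (real n)"
    using L by (simp add: mult_right_mono)
  finally show ?thesis
    using n by (simp add: divide_right_mono)
qed

text \<open>The quartiles lie in the support and are at least \<open>K / 2\<close> apart, so
  \<open>K \<le> 2 * (b - a)\<close>. This gives \<open>16 + 4 * 512 = 2064\<close>, doubled by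
  \<open>n + 1 \<le> 2 * n\<close>.\<close>

lemma (in lc_density_quantile) risk_le_support:
  assumes n: "2 \<le> n" and ab: "AE x in law q. x \<in> {a..b}"
  shows "(8 * K * (q (1 - 1 / real n) - q (1 / real n)) + 512 * K\<^sup>2) / real n
    \<le> 70000 * (b - a)\<^sup>2 / (real n + 1)"
proof -
  have n': "0 < 1 / real n" "1 / real n < 1" using n by auto
  have s: "q (1 - 1 / real n) - q (1 / real n) \<le> b - a"
    using in_support[OF ab, of "1 / real n"] in_support[OF ab, of "1 - 1 / real n"] n' by simp
  have "K * (3/4 - 1/4) \<le> q (3/4) - q (1/4)" by (rule spread_ge) auto
  also have "\<dots> \<le> b - a"
    using in_support[OF ab, of "1/4"] in_support[OF ab, of "3/4"] by simp
  finally have K: "K \<le> 2 * (b - a)" by simp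
  then have ab0: "0 \<le> b - a" using K_pos by simp
  have "8 * K * (q (1 - 1 / real n) - q (1 / real n)) \<le> 8 * K * (b - a)"
    using s K_pos by (intro mult_left_mono) auto
  also have "\<dots> \<le> 8 * (2 * (b - a)) * (b - a)"
    using K ab0 by (intro mult_right_mono) auto
  also have "\<dots> = 16 * (b - a)\<^sup>2" by (simp add: power2_eq_square algebra_simps)
  finally have 1: "8 * K * (q (1 - 1 / real n) - q (1 / real n)) \<le> 16 * (b - a)\<^sup>2" .
  have "K\<^sup>2 \<le> (2 * (b - a))\<^sup>2" using K K_pos by (intro power_mono) auto
  also have "\<dots> = 4 * (b - a)\<^sup>2" by (simp only: power_mult_distrib) simp
  finally have "8 * K * (q (1 - 1 / real n) - q (1 / real n)) + 512 * K\<^sup>2 \<le> 2064 * (b - a)\<^sup>2"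
    using 1 by linarith
  then have "(8 * K * (q (1 - 1 / real n) - q (1 / real n)) + 512 * K\<^sup>2) / real n \<le> 2064 * (b - a)\<^sup>2 / real n"
    by (intro divide_right_mono) auto
  also have "\<dots> = 2064 * (b - a)\<^sup>2 * (1 / real n)" by simp
  also have "\<dots> \<le> 2064 * (b - a)\<^sup>2 * (2 / (real n + 1))"
    using n by (intro mult_left_mono) (auto simp: field_simps)
  also have "\<dots> = 4128 * (b - a)\<^sup>2 / (real n + 1)" by simp
  also have "\<dots> \<le> 70000 * (b - a)\<^sup>2 / (real n + 1)"
    by (intro divide_right_mono mult_right_mono) auto
  finally show ?thesis .
qed

text \<open>The nonnegative integral is defined for every function, so measurability of the loss is
  asserted as well; it makes the integral a genuine expectation. The support condition is stated
  almost surely.\<close>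

theorem proposition4p5:
  shows "\<exists>C::real. C > 0 \<and>
    (\<forall>\<mu>\<in>log_concave_dists. \<forall>n::nat. n \<ge> 2 \<longrightarrow>
       sq_loss \<mu> n \<in> borel_measurable (iid_law n \<mu>) \<and>
       (\<integral>\<^sup>+x. sq_loss \<mu> n x \<partial>iid_law n \<mu>)
         \<le> ennreal (C * (std_dev \<mu>)\<^sup>2 * (ln (real n) / real n)) \<and>
       (\<forall>a b::real. (AE x in \<mu>. x \<in> {a..b}) \<longrightarrow>
          (\<integral>\<^sup>+x. sq_loss \<mu> n x \<partial>iid_law n \<mu>)
            \<le> ennreal (C * (b - a)\<^sup>2 / (real n + 1))))"
proof (intro exI[of _ 70000] conjI ballI allI impI)
  fix \<mu> and n :: nat assume mu: "\<mu> \<in> log_concave_dists" and n: "2 \<le> n"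
  then have n1: "1 \<le> n" by simp
  show "sq_loss \<mu> n \<in> borel_measurable (iid_law n \<mu>)" by (rule sq_loss_measurable[OF mu n1])
  have le: "(\<integral>\<^sup>+x. sq_loss \<mu> n x \<partial>iid_law n \<mu>) \<le> (\<integral>\<^sup>+x. transport_cost (empirical_measure n x) \<mu> \<partial>iid_law n \<mu>)"
    by (intro nn_integral_mono sq_loss_le_transport_cost mu n1)
  obtain q where q: "q \<in> lc_quantiles" "law q = \<mu>"
    using log_concave_dists_quantile[OF mu] by blast
  have "(\<integral>\<^sup>+x. sq_loss \<mu> n x \<partial>iid_law n \<mu>) \<le> ennreal (70000 * (std_dev \<mu>)\<^sup>2 * (ln (real n) / real n)) \<and>
    (\<forall>a b. (AE x in \<mu>. x \<in> {a..b}) \<longrightarrow>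
      (\<integral>\<^sup>+x. sq_loss \<mu> n x \<partial>iid_law n \<mu>) \<le> ennreal (70000 * (b - a)\<^sup>2 / (real n + 1)))"
  proof (cases rule: lc_quantiles_cases[OF q(1), case_names const deriv])
    case (const c)
    then have "\<mu> = return borel c" using distr_unif_const[of q c] q(2) by simp
    then have "(\<integral>\<^sup>+x. sq_loss \<mu> n x \<partial>iid_law n \<mu>) = 0"
      using le expected_transport_cost_const[OF n1, of c] by simp
    then show ?thesis by simp
  next
    case (deriv I)
    then interpret lc_density_quantile q I by unfold_locales
    note cost = order_trans[OF le expected_transport_cost[OF n, unfolded q(2)]]
    show ?thesis
    proof (intro conjI allI impI)
      show "(\<integral>\<^sup>+x. sq_loss \<mu> n x \<partial>iid_law n \<mu>) \<le> ennreal (70000 * (std_dev \<mu>)\<^sup>2 * (ln (real n) / real n))"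
        by (rule order_trans[OF cost ennreal_leI[OF risk_le_variance[OF n, unfolded q(2)]]])
      fix a b assume "AE x in \<mu>. x \<in> {a..b}"
      then show "(\<integral>\<^sup>+x. sq_loss \<mu> n x \<partial>iid_law n \<mu>) \<le> ennreal (70000 * (b - a)\<^sup>2 / (real n + 1))"
        by (intro order_trans[OF cost ennreal_leI] risk_le_support[OF n]) (simp only: q(2))
    qed
  qed
  then show "(\<integral>\<^sup>+x. sq_loss \<mu> n x \<partial>iid_law n \<mu>) \<le> ennreal (70000 * (std_dev \<mu>)\<^sup>2 * (ln (real n) / real n))"
    and "\<And>a b. AE x in \<mu>. x \<in> {a..b} \<Longrightarrow> (\<integral>\<^sup>+x. sq_loss \<mu> n x \<partial>iid_law n \<mu>) \<le> ennreal (70000 * (b - a)\<^sup>2 / (real n + 1))"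
    by blast+
qed simp

end
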